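(* Let $\mathcal A$ be a unital $C^*$-algebra, $\delta:\mathcal A\to\mathcal A$ an endomorphism and $\delta_*$ a complete transfer operator for $(\mathcal A,\delta)$. Let $H$, $U$ and $\pi$ be built from $(\mathcal A,\delta,\delta_* )$ as described in the context. Then $U$ and $U^*$ are well-defined, mutually adjoint operators on $H$; the triple $(H,\pi,U)$ satisfies: $\pi:\mathcal A\to L(H)$ is a faithful non-degenerate representation and, for every $a\in\mathcal A$, $$\pi(\delta(a))=U\pi(a)U^*,\qquad U^*\pi(a)U\in\pi(\mathcal A),\qquad U\pi(a)=\pi(\delta(a))U;$$ and the assignment $\hat a\mapsto\pi(a)$ $(a\in\mathcal A)$, $\hat U\mapsto U$ determines a faithful representation (the regular representation) of the crossed product $\mathcal A\times_\delta\mathbb Z$ on $H$.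
   Context: Endomorphisms of $C^*$-algebras are $*$-endomorphisms and need not be unital. A transfer operator for $(\mathcal A,\delta)$ is a continuous positive linear map $\delta_*:\mathcal A\to\mathcal A$ with $\delta_*(\delta(a)b)=a\delta_*(b)$ for all $a,b\in\mathcal A$. It is called complete if $\delta\delta_*(a)=\delta(1)a\delta(1)$ for all $a\in\mathcal A$. A complete transfer operator, if it exists, is unique. If a complete transfer operator $\delta_*$ exists, the crossed product $\mathcal A\times_\delta\mathbb Z$ is the universal unital $C^*$-algebra generated by a copy of $\mathcal A$ and a partial isometry $U$ subject to the relations $\delta(a)=UaU^*$, $\delta_*(a)=U^*aU$ for $a\in\mathcal A$. The canonical images of $a\in\mathcal A$ and of the universal partial isometry are denoted $\hat a$ and $\hat U$. Construction of $(H,\pi,U)$. The Hilbert space generated by a non-negative (possibly degenerate) inner product $\langle\cdot,\cdot\rangle$ on $\mathcal A$ is the completion of the quotient of $\mathcal A$ by $\{v:\langle v,v\rangle=0\}$ with respect to the norm $\sqrt{\langle v,v\rangle}$. Let $F$ be the set of all positive linear functionals on $\mathcal A$. For $f\in F$ and $n\in\mathbb Z$ let $H^f_n$ be the Hilbert space generated by the inner product on $\mathcal A$ $$\langle v,u\rangle_n=f(\delta_*^n(u^*v))\ \ (n\ge0),\qquad \langle v,u\rangle_n=f(u^*\delta^{|n|}(1)v)\ \ (n\le0)$$ (for $n=0$ both equal $f(u^*v)$). Let $H^f$ be the Hilbert space direct sum of the $H^f_n$, $n\in\mathbb Z$, and $H$ the Hilbert space direct sum of the $H^f$, $f\in F$.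 The operators $U$, $U^*$ and $\pi(a)$ leave every $H^f$ invariant, and on finite sums $h=\bigoplus_n h_n\in H^f$, with $h_n\in H^f_n$ represented by elements of $\mathcal A$, they are given by $$(Uh)_n=\begin{cases}\delta(h_{n-1}),&n>0,\\ \delta^{|n|+1}(1)h_{n-1},&n\le0,\end{cases}\qquad (U^*h)_n=\begin{cases}\delta_*(h_{n+1}),&n\ge0,\\ \delta^{|n|}(1)h_{n+1},&n<0,\end{cases}$$ $$\pi(a)h_n=\begin{cases}ah_n,&n\ge0,\\ \delta^{|n|}(a)h_n,&n\le0,\end{cases}$$ and are extended by continuity. *)

theory Defs
  imports "HOL-Analysis.Analysis" "HOL-Library.Poly_Mapping"
begin

section \<open>Unital C*-algebras, endomorphisms and transfer operators\<close>

class scaleC =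
  fixes scaleC :: "complex \<Rightarrow> 'a \<Rightarrow> 'a"  (infixr \<open>*\<^sub>C\<close> 75)

class star =
  fixes star :: "'a \<Rightarrow> 'a"

text \<open>The unit is taken from \<open>monoid_mult\<close> rather than \<open>ring_1\<close>, so that the zero algebra is
  included. The real structure is the restriction of the complex one.\<close>

class unital_cstar_algebra = real_normed_algebra + banach + monoid_mult + scaleC + star +
  assumes scaleC_add_right: "c *\<^sub>C (x + y) = c *\<^sub>C x + c *\<^sub>C y"
    and scaleC_add_left: "(c + d) *\<^sub>C x = c *\<^sub>C x + d *\<^sub>C x"
    and scaleC_scaleC: "c *\<^sub>C d *\<^sub>C x = (c * d) *\<^sub>C x"
    and scaleR_scaleC: "r *\<^sub>R x = complex_of_real r *\<^sub>C x"
    and mult_scaleC_left: "(c *\<^sub>C x) * y = c *\<^sub>C (x * y)"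
    and mult_scaleC_right: "x * (c *\<^sub>C y) = c *\<^sub>C (x * y)"
    and norm_scaleC: "norm (c *\<^sub>C x) = cmod c * norm x"
    and star_add: "star (x + y) = star x + star y"
    and star_scaleC: "star (c *\<^sub>C x) = cnj c *\<^sub>C star x"
    and star_mult: "star (x * y) = star y * star x"
    and star_star: "star (star x) = x"
    and cstar_identity: "norm (star x * x) = (norm x)\<^sup>2"

definition star_endomorphism :: "('a::unital_cstar_algebra \<Rightarrow> 'a) \<Rightarrow> bool" where
  "star_endomorphism \<delta> \<longleftrightarrow>
     Vector_Spaces.linear scaleC scaleC \<delta> \<and>
     (\<forall>a b. \<delta> (a * b) = \<delta> a * \<delta> b) \<and> (\<forall>a. \<delta> (star a) = star (\<delta> a))"

definition positive_elem :: "'a::unital_cstar_algebra \<Rightarrow> bool" where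
  "positive_elem a \<longleftrightarrow> (\<exists>b. a = star b * b)"

definition transfer_operator ::
    "('a::unital_cstar_algebra \<Rightarrow> 'a) \<Rightarrow> ('a \<Rightarrow> 'a) \<Rightarrow> bool" where
  "transfer_operator \<delta> \<delta>s \<longleftrightarrow>
     Vector_Spaces.linear scaleC scaleC \<delta>s \<and> continuous_on UNIV \<delta>s \<and>
     (\<forall>a. positive_elem a \<longrightarrow> positive_elem (\<delta>s a)) \<and>
     (\<forall>a b. \<delta>s (\<delta> a * b) = a * \<delta>s b)"

definition complete_transfer_operator ::
    "('a::unital_cstar_algebra \<Rightarrow> 'a) \<Rightarrow> ('a \<Rightarrow> 'a) \<Rightarrow> bool" where
  "complete_transfer_operator \<delta> \<delta>s \<longleftrightarrow>
     transfer_operator \<delta> \<delta>s \<and> (\<forall>a. \<delta> (\<delta>s a) = \<delta> 1 * a * \<delta> 1)"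

definition positive_functionals :: "('a::unital_cstar_algebra \<Rightarrow> complex) set" where
  "positive_functionals =
     {f. Vector_Spaces.linear scaleC (*) f \<and> (\<forall>a. positive_elem a \<longrightarrow> f a \<in> \<real>\<^sub>\<ge>\<^sub>0)}"


section \<open>Completion with respect to a seminorm\<close>

text \<open>The Hausdorff completion of a group with seminorm \<open>p\<close>: Cauchy sequences modulo null
  sequences. Since elements of seminorm 0 are identified with 0, the quotient by the null space is
  included. Operations are lifted by acting on arbitrarily chosen representing sequences.\<close>

definition cauchy_wrt :: "('v::ab_group_add \<Rightarrow> real) \<Rightarrow> (nat \<Rightarrow> 'v) \<Rightarrow> bool" where
  "cauchy_wrt p X \<longleftrightarrow> (\<forall>e>0. \<exists>N. \<forall>m\<ge>N. \<forall>n\<ge>N. p (X m - X n) < e)"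

definition seq_class :: "('v::ab_group_add \<Rightarrow> real) \<Rightarrow> (nat \<Rightarrow> 'v) \<Rightarrow> (nat \<Rightarrow> 'v) set" where
  "seq_class p X = {Y. cauchy_wrt p Y \<and> (\<lambda>n. p (X n - Y n)) \<longlonglongrightarrow> 0}"

definition completion :: "('v::ab_group_add \<Rightarrow> real) \<Rightarrow> (nat \<Rightarrow> 'v) set set" where
  "completion p = {seq_class p X |X. cauchy_wrt p X}"

definition embed :: "('v::ab_group_add \<Rightarrow> real) \<Rightarrow> 'v \<Rightarrow> (nat \<Rightarrow> 'v) set" where
  "embed p v = seq_class p (\<lambda>_. v)"

definition rep_seq :: "(nat \<Rightarrow> 'v) set \<Rightarrow> nat \<Rightarrow> 'v" where
  "rep_seq C = (SOME X. X \<in> C)"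

definition lift1 ::
    "('v::ab_group_add \<Rightarrow> real) \<Rightarrow> ('v \<Rightarrow> 'v) \<Rightarrow> (nat \<Rightarrow> 'v) set \<Rightarrow> (nat \<Rightarrow> 'v) set" where
  "lift1 p g C = seq_class p (\<lambda>n. g (rep_seq C n))"

definition lift2 ::
    "('v::ab_group_add \<Rightarrow> real) \<Rightarrow> ('v \<Rightarrow> 'v \<Rightarrow> 'v) \<Rightarrow>
     (nat \<Rightarrow> 'v) set \<Rightarrow> (nat \<Rightarrow> 'v) set \<Rightarrow> (nat \<Rightarrow> 'v) set" where
  "lift2 p g C D = seq_class p (\<lambda>n. g (rep_seq C n) (rep_seq D n))"


section \<open>Hilbert spaces on carrier sets\<close>

text \<open>Inner products are linear in the first argument.\<close>

record 'h hilbert =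
  hcarrier :: "'h set"
  hplus :: "'h \<Rightarrow> 'h \<Rightarrow> 'h"
  hscale :: "complex \<Rightarrow> 'h \<Rightarrow> 'h"
  hinner :: "'h \<Rightarrow> 'h \<Rightarrow> complex"

definition hnorm :: "'h hilbert \<Rightarrow> 'h \<Rightarrow> real" where
  "hnorm H x = sqrt (Re (hinner H x x))"

definition inner_seminorm :: "('v \<Rightarrow> 'v \<Rightarrow> complex) \<Rightarrow> 'v \<Rightarrow> real" where
  "inner_seminorm ip v = sqrt (Re (ip v v))"

definition hilbert_generated ::
    "('v \<Rightarrow> 'v \<Rightarrow> complex) \<Rightarrow> (nat \<Rightarrow> 'v::unital_cstar_algebra) set hilbert" where
  "hilbert_generated ip =
     \<lparr>hcarrier = completion (inner_seminorm ip),
      hplus = lift2 (inner_seminorm ip) (+),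
      hscale = (\<lambda>c. lift1 (inner_seminorm ip) (scaleC c)),
      hinner = (\<lambda>C D. lim (\<lambda>n. ip (rep_seq C n) (rep_seq D n)))\<rparr>"

definition hilbert_sum :: "'i set \<Rightarrow> ('i \<Rightarrow> 'h hilbert) \<Rightarrow> ('i \<Rightarrow> 'h) hilbert" where
  "hilbert_sum I K =
     \<lparr>hcarrier = {x \<in> \<Pi>\<^sub>E i\<in>I. hcarrier (K i). (\<lambda>i. (hnorm (K i) (x i))\<^sup>2) summable_on I},
      hplus = (\<lambda>x y. \<lambda>i\<in>I. hplus (K i) (x i) (y i)),
      hscale = (\<lambda>c x. \<lambda>i\<in>I. hscale (K i) c (x i)),
      hinner = (\<lambda>x y. \<Sum>\<^sub>\<infinity>i\<in>I. hinner (K i) (x i) (y i))\<rparr>"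

definition closed_subspace :: "'h hilbert \<Rightarrow> 'h set \<Rightarrow> bool" where
  "closed_subspace H M \<longleftrightarrow>
     M \<subseteq> hcarrier H \<and> M \<noteq> {} \<and>
     (\<forall>x\<in>M. \<forall>y\<in>M. hplus H x y \<in> M) \<and> (\<forall>c. \<forall>x\<in>M. hscale H c x \<in> M) \<and>
     (\<forall>X. \<forall>x\<in>hcarrier H. (\<forall>n. X n \<in> M) \<and>
        (\<lambda>n. hnorm H (hplus H (X n) (hscale H (-1) x))) \<longlonglongrightarrow> 0 \<longrightarrow> x \<in> M)"

text \<open>Operators are extensional on the carrier, so that they are determined by their values there.\<close>

definition bounded_ops :: "'h hilbert \<Rightarrow> ('h \<Rightarrow> 'h) set" where
  "bounded_ops H =
     {T \<in> hcarrier H \<rightarrow>\<^sub>E hcarrier H.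
        (\<forall>x\<in>hcarrier H. \<forall>y\<in>hcarrier H. T (hplus H x y) = hplus H (T x) (T y)) \<and>
        (\<forall>c. \<forall>x\<in>hcarrier H. T (hscale H c x) = hscale H c (T x)) \<and>
        (\<exists>K. \<forall>x\<in>hcarrier H. hnorm H (T x) \<le> K * hnorm H x)}"

definition op_comp :: "'h hilbert \<Rightarrow> ('h \<Rightarrow> 'h) \<Rightarrow> ('h \<Rightarrow> 'h) \<Rightarrow> 'h \<Rightarrow> 'h" where
  "op_comp H S T = compose (hcarrier H) S T"

definition mutually_adjoint :: "'h hilbert \<Rightarrow> ('h \<Rightarrow> 'h) \<Rightarrow> ('h \<Rightarrow> 'h) \<Rightarrow> bool" where
  "mutually_adjoint H S T \<longleftrightarrow>
     (\<forall>x\<in>hcarrier H. \<forall>y\<in>hcarrier H. hinner H (S x) y = hinner H x (T y))"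


section \<open>Representations\<close>

record 'b star_algebra =
  acarrier :: "'b set"
  aplus :: "'b \<Rightarrow> 'b \<Rightarrow> 'b"
  ascale :: "complex \<Rightarrow> 'b \<Rightarrow> 'b"
  atimes :: "'b \<Rightarrow> 'b \<Rightarrow> 'b"
  aone :: 'b
  astar :: "'b \<Rightarrow> 'b"
  anorm :: "'b \<Rightarrow> real"

definition type_algebra :: "'a::unital_cstar_algebra star_algebra" where
  "type_algebra =
     \<lparr>acarrier = UNIV, aplus = (+), ascale = scaleC, atimes = (*), aone = 1, astar = star,
      anorm = norm\<rparr>"

definition star_representation ::
    "'b star_algebra \<Rightarrow> 'h hilbert \<Rightarrow> ('b \<Rightarrow> 'h \<Rightarrow> 'h) \<Rightarrow> bool" where
  "star_representation B H \<rho> \<longleftrightarrow>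
     \<rho> \<in> acarrier B \<rightarrow> bounded_ops H \<and>
     (\<forall>x\<in>acarrier B. \<forall>y\<in>acarrier B. \<forall>h\<in>hcarrier H.
        \<rho> (aplus B x y) h = hplus H (\<rho> x h) (\<rho> y h)) \<and>
     (\<forall>c. \<forall>x\<in>acarrier B. \<forall>h\<in>hcarrier H. \<rho> (ascale B c x) h = hscale H c (\<rho> x h)) \<and>
     (\<forall>x\<in>acarrier B. \<forall>y\<in>acarrier B. \<rho> (atimes B x y) = op_comp H (\<rho> x) (\<rho> y)) \<and>
     (\<forall>x\<in>acarrier B. mutually_adjoint H (\<rho> x) (\<rho> (astar B x)))"

definition faithful :: "'b star_algebra \<Rightarrow> ('b \<Rightarrow> 'h \<Rightarrow> 'h) \<Rightarrow> bool" where
  "faithful B \<rho> \<longleftrightarrow> inj_on \<rho> (acarrier B)"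

definition nondegenerate :: "'b star_algebra \<Rightarrow> 'h hilbert \<Rightarrow> ('b \<Rightarrow> 'h \<Rightarrow> 'h) \<Rightarrow> bool" where
  "nondegenerate B H \<rho> \<longleftrightarrow>
     (\<forall>M. closed_subspace H M \<and> (\<forall>x\<in>acarrier B. \<forall>h\<in>hcarrier H. \<rho> x h \<in> M) \<longrightarrow> M = hcarrier H)"


section \<open>Universal C*-algebras given by generators and relations\<close>

text \<open>The free unital *-algebra on \<open>'g\<close> is the algebra of the free monoid on the letters
  \<open>g\<close>, \<open>g\<^sup>*\<close>; its product is the convolution product of \<open>Poly_Mapping\<close>.\<close>

datatype 'g letter = Gen 'g | Adj 'g

primrec flip_letter :: "'g letter \<Rightarrow> 'g letter" where
  "flip_letter (Gen g) = Adj g"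
| "flip_letter (Adj g) = Gen g"

datatype 'g word = Word (letters: "'g letter list")

instantiation word :: (type) monoid_add
begin

definition zero_word :: "'a word" where
  "zero_word = Word []"

definition plus_word :: "'a word \<Rightarrow> 'a word \<Rightarrow> 'a word" where
  "plus_word u v = Word (letters u @ letters v)"

instance
  by standard (simp_all add: zero_word_def plus_word_def)

end

type_synonym 'g free_star = "'g word \<Rightarrow>\<^sub>0 complex"

definition gen :: "'g \<Rightarrow> 'g free_star" where
  "gen g = Poly_Mapping.single (Word [Gen g]) 1"

definition free_scale :: "complex \<Rightarrow> 'g free_star \<Rightarrow> 'g free_star" where
  "free_scale c x = Poly_Mapping.single 0 c * x"

definition free_adj :: "'g free_star \<Rightarrow> 'g free_star" where
  "free_adj x = (\<Sum>w\<in>Poly_Mapping.keys x.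
     Poly_Mapping.single (Word (rev (map flip_letter (letters w)))) (cnj (Poly_Mapping.lookup x w)))"

definition cstar_seminorm :: "('g free_star \<Rightarrow> real) \<Rightarrow> bool" where
  "cstar_seminorm p \<longleftrightarrow>
     (\<forall>x. p x \<ge> 0) \<and>
     (\<forall>x y. p (x + y) \<le> p x + p y) \<and>
     (\<forall>c x. p (free_scale c x) = cmod c * p x) \<and>
     (\<forall>x y. p (x * y) \<le> p x * p y) \<and>
     (\<forall>x. p (free_adj x * x) = (p x)\<^sup>2)"

text \<open>A C*-seminorm killing the relators is the same thing as the pulled back norm of a C*-algebra
  generated by elements satisfying the relations. Thus the supremum below is the supremum of
  \<open>\<parallel>\<phi>(x)\<parallel>\<close> over all realisations \<open>\<phi>\<close> of the relations in C*-algebras, and the completion is the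
  universal C*-algebra. Using seminorms avoids quantifying over all C*-algebras.\<close>

definition universal_seminorm :: "'g free_star set \<Rightarrow> 'g free_star \<Rightarrow> real" where
  "universal_seminorm R x = Sup {p x |p. cstar_seminorm p \<and> (\<forall>r\<in>R. p r = 0)}"

definition universal_cstar_algebra ::
    "'g free_star set \<Rightarrow> (nat \<Rightarrow> 'g free_star) set star_algebra" where
  "universal_cstar_algebra R =
     (let p = universal_seminorm R in
      \<lparr>acarrier = completion p,
       aplus = lift2 p (+),
       ascale = (\<lambda>c. lift1 p (free_scale c)),
       atimes = lift2 p (*),
       aone = embed p 1,
       astar = lift1 p free_adj,
       anorm = (\<lambda>C. lim (\<lambda>n. p (rep_seq C n)))\<rparr>)"


section \<open>The crossed product\<close>

datatype 'a cp_gen = Coeff 'a | PIso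

text \<open>The first set makes the coefficients a *-homomorphic image of the algebra with the same
  unit; the second one makes \<open>PIso\<close> a partial isometry implementing \<open>\<delta>\<close> and \<open>\<delta>s\<close>.\<close>

definition coeff_relators :: "'a::unital_cstar_algebra cp_gen free_star set" where
  "coeff_relators =
     {gen (Coeff (a + b)) - (gen (Coeff a) + gen (Coeff b)) |a b. True} \<union>
     {gen (Coeff (c *\<^sub>C a)) - free_scale c (gen (Coeff a)) |c a. True} \<union>
     {gen (Coeff (a * b)) - gen (Coeff a) * gen (Coeff b) |a b. True} \<union>
     {gen (Coeff (star a)) - free_adj (gen (Coeff a)) |a. True} \<union>
     {gen (Coeff 1) - 1}"

definition covariance_relators ::
    "('a::unital_cstar_algebra \<Rightarrow> 'a) \<Rightarrow> ('a \<Rightarrow> 'a) \<Rightarrow> 'a cp_gen free_star set" where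
  "covariance_relators \<delta> \<delta>s =
     {gen PIso * free_adj (gen PIso) * gen PIso - gen PIso} \<union>
     {gen PIso * gen (Coeff a) * free_adj (gen PIso) - gen (Coeff (\<delta> a)) |a. True} \<union>
     {free_adj (gen PIso) * gen (Coeff a) * gen PIso - gen (Coeff (\<delta>s a)) |a. True}"

definition cp_relators ::
    "('a::unital_cstar_algebra \<Rightarrow> 'a) \<Rightarrow> ('a \<Rightarrow> 'a) \<Rightarrow> 'a cp_gen free_star set" where
  "cp_relators \<delta> \<delta>s = coeff_relators \<union> covariance_relators \<delta> \<delta>s"

definition crossed_product ::
    "('a::unital_cstar_algebra \<Rightarrow> 'a) \<Rightarrow> ('a \<Rightarrow> 'a) \<Rightarrow>
     (nat \<Rightarrow> 'a cp_gen free_star) set star_algebra" where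
  "crossed_product \<delta> \<delta>s = universal_cstar_algebra (cp_relators \<delta> \<delta>s)"

definition cp_coeff ::
    "('a::unital_cstar_algebra \<Rightarrow> 'a) \<Rightarrow> ('a \<Rightarrow> 'a) \<Rightarrow> 'a \<Rightarrow> (nat \<Rightarrow> 'a cp_gen free_star) set" where
  "cp_coeff \<delta> \<delta>s a = embed (universal_seminorm (cp_relators \<delta> \<delta>s)) (gen (Coeff a))"

definition cp_isometry ::
    "('a::unital_cstar_algebra \<Rightarrow> 'a) \<Rightarrow> ('a \<Rightarrow> 'a) \<Rightarrow> (nat \<Rightarrow> 'a cp_gen free_star) set" where
  "cp_isometry \<delta> \<delta>s = embed (universal_seminorm (cp_relators \<delta> \<delta>s)) (gen PIso)"


section \<open>The regular representation\<close>

type_synonym 'a reg_vector = "('a \<Rightarrow> complex) \<Rightarrow> int \<Rightarrow> (nat \<Rightarrow> 'a) set"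

definition reg_inner ::
    "('a::unital_cstar_algebra \<Rightarrow> 'a) \<Rightarrow> ('a \<Rightarrow> 'a) \<Rightarrow> ('a \<Rightarrow> complex) \<Rightarrow> int \<Rightarrow>
     'a \<Rightarrow> 'a \<Rightarrow> complex" where
  "reg_inner \<delta> \<delta>s f n v u =
     (if n \<ge> 0 then f ((\<delta>s ^^ nat n) (star u * v))
      else f (star u * (\<delta> ^^ nat \<bar>n\<bar>) 1 * v))"

definition reg_summand ::
    "('a::unital_cstar_algebra \<Rightarrow> 'a) \<Rightarrow> ('a \<Rightarrow> 'a) \<Rightarrow> ('a \<Rightarrow> complex) \<Rightarrow> int \<Rightarrow>
     (nat \<Rightarrow> 'a) set hilbert" where
  "reg_summand \<delta> \<delta>s f n = hilbert_generated (reg_inner \<delta> \<delta>s f n)"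

definition reg_space ::
    "('a::unital_cstar_algebra \<Rightarrow> 'a) \<Rightarrow> ('a \<Rightarrow> 'a) \<Rightarrow> 'a reg_vector hilbert" where
  "reg_space \<delta> \<delta>s =
     hilbert_sum positive_functionals (\<lambda>f. hilbert_sum UNIV (reg_summand \<delta> \<delta>s f))"

text \<open>The vector of the \<open>f\<close>-th summand whose \<open>n\<close>-th component is represented by \<open>h n\<close>.\<close>

definition reg_vec ::
    "('a::unital_cstar_algebra \<Rightarrow> 'a) \<Rightarrow> ('a \<Rightarrow> 'a) \<Rightarrow> ('a \<Rightarrow> complex) \<Rightarrow> (int \<Rightarrow> 'a) \<Rightarrow>
     'a reg_vector" where
  "reg_vec \<delta> \<delta>s f h =
     (\<lambda>g\<in>positive_functionals. \<lambda>n.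
        embed (inner_seminorm (reg_inner \<delta> \<delta>s g n)) (if g = f then h n else 0))"

text \<open>\<open>T\<close> is a bounded operator acting on finite sums of vectors represented by elements of the
  algebra by the formula \<open>\<Phi>\<close> for representatives. As this is required for every choice of
  representatives, the existence of \<open>T\<close> includes that \<open>\<Phi>\<close> respects the null spaces.\<close>

definition continuous_extension ::
    "('a::unital_cstar_algebra \<Rightarrow> 'a) \<Rightarrow> ('a \<Rightarrow> 'a) \<Rightarrow> ((int \<Rightarrow> 'a) \<Rightarrow> int \<Rightarrow> 'a) \<Rightarrow>
     ('a reg_vector \<Rightarrow> 'a reg_vector) \<Rightarrow> bool" where
  "continuous_extension \<delta> \<delta>s \<Phi> T \<longleftrightarrow>
     T \<in> bounded_ops (reg_space \<delta> \<delta>s) \<and>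
     (\<forall>f\<in>positive_functionals. \<forall>h. finite {n. h n \<noteq> 0} \<longrightarrow>
        T (reg_vec \<delta> \<delta>s f h) = reg_vec \<delta> \<delta>s f (\<Phi> h))"

definition U_formula ::
    "('a::unital_cstar_algebra \<Rightarrow> 'a) \<Rightarrow> (int \<Rightarrow> 'a) \<Rightarrow> int \<Rightarrow> 'a" where
  "U_formula \<delta> h n =
     (if n > 0 then \<delta> (h (n - 1)) else (\<delta> ^^ (nat \<bar>n\<bar> + 1)) 1 * h (n - 1))"

definition Ustar_formula ::
    "('a::unital_cstar_algebra \<Rightarrow> 'a) \<Rightarrow> ('a \<Rightarrow> 'a) \<Rightarrow> (int \<Rightarrow> 'a) \<Rightarrow> int \<Rightarrow> 'a" where
  "Ustar_formula \<delta> \<delta>s h n =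
     (if n \<ge> 0 then \<delta>s (h (n + 1)) else (\<delta> ^^ nat \<bar>n\<bar>) 1 * h (n + 1))"

definition pi_formula ::
    "('a::unital_cstar_algebra \<Rightarrow> 'a) \<Rightarrow> 'a \<Rightarrow> (int \<Rightarrow> 'a) \<Rightarrow> int \<Rightarrow> 'a" where
  "pi_formula \<delta> a h n = (if n \<ge> 0 then a * h n else (\<delta> ^^ nat \<bar>n\<bar>) a * h n)"

definition reg_U ::
    "('a::unital_cstar_algebra \<Rightarrow> 'a) \<Rightarrow> ('a \<Rightarrow> 'a) \<Rightarrow> 'a reg_vector \<Rightarrow> 'a reg_vector" where
  "reg_U \<delta> \<delta>s = (THE T. continuous_extension \<delta> \<delta>s (U_formula \<delta>) T)"

definition reg_Ustar ::
    "('a::unital_cstar_algebra \<Rightarrow> 'a) \<Rightarrow> ('a \<Rightarrow> 'a) \<Rightarrow> 'a reg_vector \<Rightarrow> 'a reg_vector" where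
  "reg_Ustar \<delta> \<delta>s = (THE T. continuous_extension \<delta> \<delta>s (Ustar_formula \<delta> \<delta>s) T)"

definition reg_pi ::
    "('a::unital_cstar_algebra \<Rightarrow> 'a) \<Rightarrow> ('a \<Rightarrow> 'a) \<Rightarrow> 'a \<Rightarrow> 'a reg_vector \<Rightarrow> 'a reg_vector" where
  "reg_pi \<delta> \<delta>s a = (THE T. continuous_extension \<delta> \<delta>s (pi_formula \<delta> a) T)"

definition regular_representation ::
    "('a::unital_cstar_algebra \<Rightarrow> 'a) \<Rightarrow> ('a \<Rightarrow> 'a) \<Rightarrow>
     ((nat \<Rightarrow> 'a cp_gen free_star) set \<Rightarrow> 'a reg_vector \<Rightarrow> 'a reg_vector) \<Rightarrow> bool" where
  "regular_representation \<delta> \<delta>s \<rho> \<longleftrightarrow>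
     \<rho> \<in> extensional (acarrier (crossed_product \<delta> \<delta>s)) \<and>
     star_representation (crossed_product \<delta> \<delta>s) (reg_space \<delta> \<delta>s) \<rho> \<and>
     (\<forall>a. \<rho> (cp_coeff \<delta> \<delta>s a) = reg_pi \<delta> \<delta>s a) \<and>
     \<rho> (cp_isometry \<delta> \<delta>s) = reg_U \<delta> \<delta>s"

end

theory Submission
  imports Defs
begin

text \<open>
The crossed product is the completion of the free unital *-algebra on the coefficients and the
partial isometry in the largest C*-seminorm that kills the relators. The operators of the regular
representation satisfy the relations, so \<open>\<parallel>x\<parallel>\<^sub>r = \<parallel>x(\<pi>, U)\<parallel>\<close> is one such seminorm
(\<open>admissible_reg\<close>). The heart of the matter is that it is the largest one
(\<open>admissible_le_reg_norm\<close>). Then the completion is isometric to an algebra of operators on \<open>H\<close>,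
which is existence and faithfulness of the regular representation.

Let \<open>p\<close> be a C*-seminorm that kills the relators. Count \<open>U\<close> with degree 1 and \<open>U\<^sup>*\<close> with degree -1.
Since \<open>U a U\<^sup>*\<close> and \<open>U\<^sup>* a U\<close> are coefficients, every element of degree 0 reduces to a coefficient
\<open>a\<close> (\<open>degree_zero_reduction\<close>), and \<open>p(a) \<le> \<parallel>a\<parallel>\<close> (\<open>p_c_le\<close>). If \<open>x\<^sub>k\<close> is the homogeneous part of
degree \<open>k\<close> of \<open>x\<close>, apply this to \<open>x\<^sub>k x\<^sub>k\<^sup>*\<close>. A state \<open>f\<close> with \<open>f(a\<^sup>*a) = \<parallel>a\<parallel>\<^sup>2\<close> gives a vector
\<open>\<xi>\<close> of degree 0 and norm at most 1 in \<open>H\<close> with \<open>\<parallel>a \<xi>\<parallel> = \<parallel>a\<parallel>\<close>, and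
\<open>a \<xi> = x\<^sub>k x\<^sub>k\<^sup>* \<xi> = P\<^sub>0 x P\<^sub>-\<^sub>k x\<^sup>* \<xi>\<close> with the projections \<open>P\<^sub>j\<close> onto the degrees. Hence
\<open>p(x\<^sub>k)\<^sup>2 \<le> \<parallel>x\<parallel>\<^sub>r\<^sup>2\<close> (\<open>part_le_reg_norm\<close>), and \<open>p(x) \<le> (2n + 1) \<parallel>x\<parallel>\<^sub>r\<close> if the degrees in \<open>x\<close> are at most
\<open>n\<close>. For \<open>(x\<^sup>*x)\<^sup>m\<close> with \<open>m = 2\<^sup>j\<close> the degrees grow linearly in \<open>m\<close> while both seminorms take the
\<open>2m\<close>-th power, so the factor disappears in the limit.

Two ingredients precede this. The first is the order structure of a C*-algebra: the
square root series gives square roots of elements that are positive in the sense of a norm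
condition, from which \<open>a\<^sup>*a\<close> is shown to be positive (\<open>npos_star_mult\<close>), and norming functionals
become states (\<open>state_attaining_norm\<close>). The second is the Hilbert space \<open>H\<close>: completions and
direct sums are Hilbert spaces, and all operators in question are weighted shifts along the degree,
hence determined by their action on vectors with one component represented in the algebra.

The relations hold for the weights, exactly or up to null vectors. For uniqueness, a representation
of the crossed product is determined on words by its values on the generators, and its continuity is
automatic (\<open>\<sigma>_contractive\<close>): the Neumann series provides inverses in the completion, which
bound the norms of the images.
\<close>

section \<open>Positivity in C*-algebras\<close>

lemma scaleC_one [simp]: "1 *\<^sub>C x = (x::'a::unital_cstar_algebra)"
  using scaleR_scaleC[of 1 x] by simp

lemma scaleC_zero_left [simp]: "0 *\<^sub>C x = (0::'a::unital_cstar_algebra)"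
  using scaleR_scaleC[of 0 x] by simp

lemma scaleC_zero_right [simp]: "c *\<^sub>C 0 = (0::'a::unital_cstar_algebra)"
  using scaleC_add_right[of c 0 "0::'a"] by simp

lemma scaleC_minus_left: "(- c) *\<^sub>C x = - (c *\<^sub>C x)" for x :: "'a::unital_cstar_algebra"
  by (rule minus_unique[symmetric]) (simp flip: scaleC_add_left)

lemma scaleC_minus_right: "c *\<^sub>C (- x) = - (c *\<^sub>C x)" for x :: "'a::unital_cstar_algebra"
  by (rule minus_unique[symmetric]) (simp flip: scaleC_add_right)

lemma scaleC_diff_right: "c *\<^sub>C (x - y) = c *\<^sub>C x - c *\<^sub>C y" for x :: "'a::unital_cstar_algebra"
  using scaleC_add_right[of c x "- y"] by (simp add: scaleC_minus_right)

lemma star_zero [simp]: "star 0 = (0::'a::unital_cstar_algebra)"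
  using star_add[of 0 "0::'a"] by simp

lemma star_minus: "star (- x) = - star x" for x :: "'a::unital_cstar_algebra"
  by (rule minus_unique[symmetric]) (simp flip: star_add)

lemma star_diff: "star (x - y) = star x - star y" for x :: "'a::unital_cstar_algebra"
  using star_add[of x "- y"] by (simp add: star_minus)

lemma star_one [simp]: "star 1 = (1::'a::unital_cstar_algebra)"
  using star_mult[of "star (1::'a)" 1] by (simp add: star_star)

lemma star_scaleR: "star (r *\<^sub>R x) = r *\<^sub>R star x" for x :: "'a::unital_cstar_algebra"
  by (simp add: scaleR_scaleC star_scaleC)

lemma norm_star [simp]: "norm (star x) = norm (x::'a::unital_cstar_algebra)"
proof -
  have le: "norm x \<le> norm (star x)" for x :: 'a
  proof (cases "norm x = 0")
    case False
    have "norm x * norm x \<le> norm (star x) * norm x"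
      using norm_mult_ineq[of "star x" x] by (simp add: cstar_identity power2_eq_square)
    then show ?thesis using False by simp
  qed auto
  show ?thesis using le[of x] le[of "star x"] by (simp add: star_star)
qed

lemma norm_one_le: "norm (1::'a::unital_cstar_algebra) \<le> 1"
proof -
  have "norm (1::'a) = (norm (1::'a))\<^sup>2" using cstar_identity[of "1::'a"] by simp
  then have "norm (1::'a) = 0 \<or> norm (1::'a) = 1" by (simp add: power2_eq_square)
  then show ?thesis by auto
qed

lemma norm_scaleR_one_le: "norm (r *\<^sub>R (1::'a::unital_cstar_algebra)) \<le> \<bar>r\<bar>"
  using mult_left_mono[OF norm_one_le, of "\<bar>r\<bar>"] by simp

lemma norm_mult_self: "star h = h \<Longrightarrow> norm (h * h) = (norm (h::'a::unital_cstar_algebra))\<^sup>2"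
  using cstar_identity[of h] by simp

lemma square_eq_0: "star h = h \<Longrightarrow> h * h = 0 \<Longrightarrow> h = (0::'a::unital_cstar_algebra)"
  using norm_mult_self[of h] by simp

lemma cube_eq_0: "star h = h \<Longrightarrow> h * h * h = 0 \<Longrightarrow> h = (0::'a::unital_cstar_algebra)"
  by (rule square_eq_0, assumption, rule square_eq_0) (auto simp: star_mult mult.assoc)

lemma bounded_linear_star: "bounded_linear (star :: 'a::unital_cstar_algebra \<Rightarrow> 'a)"
  by (rule bounded_linear_intro[where K = 1]) (auto simp: star_add star_scaleR)


lemma commute_square: "a * b = b * a \<Longrightarrow> a * (b * b) = b * b * (a::'a::unital_cstar_algebra)"
  by (metis mult.assoc)


subsection \<open>The square root series\<close>

definition sqrt_coeff :: "nat \<Rightarrow> real" where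
  "sqrt_coeff k = ((1/2) gchoose k) * (- 1) ^ k"

definition sqrt1m :: "'a::unital_cstar_algebra \<Rightarrow> 'a" where
  "sqrt1m x = (suminf (\<lambda>k. sqrt_coeff k *\<^sub>R x ^ k))"

lemma sqrt_coeff_0 [simp]: "sqrt_coeff 0 = 1"
  by (simp add: sqrt_coeff_def)

lemma alternating_gbinomial_nonneg:
  fixes a :: real
  assumes "a \<le> 0"
  shows "0 \<le> (- 1) ^ n * (a gchoose n)"
proof -
  have "(- 1) ^ n * (a gchoose n) = (of_nat n - a - 1) gchoose n"
    by (subst gbinomial_negated_upper) (simp flip: power_mult_distrib mult.assoc)
  also have "\<dots> = (\<Prod>i<n. of_nat n - a - 1 - of_nat i) / fact n"
    by (simp add: gbinomial_prod_rev lessThan_atLeast0)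
  also have "\<dots> \<ge> 0"
  proof (intro divide_nonneg_pos prod_nonneg ballI)
    fix i assume "i \<in> {..<n}"
    then have "real i + 1 \<le> real n" by auto
    then show "0 \<le> real n - a - 1 - real i" using assms by linarith
  qed auto
  finally show ?thesis .
qed

lemma sum_sqrt_coeff_nonneg: "0 \<le> (\<Sum>k\<le>n. sqrt_coeff k)"
  unfolding sqrt_coeff_def gbinomial_sum_lower_neg
  by (rule alternating_gbinomial_nonneg) simp

lemma sqrt_coeff_Suc_nonpos: "sqrt_coeff (Suc k) \<le> 0"
proof -
  have "sqrt_coeff (Suc k) = - (1/2 / real (Suc k)) * ((- 1) ^ k * ((-1/2) gchoose k))"
    using gbinomial_absorption[of k "1/2::real"] unfolding sqrt_coeff_def
    by (simp add: field_simps del: of_nat_Suc)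
  also have "\<dots> \<le> 0"
    using alternating_gbinomial_nonneg[of "-1/2" k]
    by (intro mult_nonpos_nonneg) auto
  finally show ?thesis .
qed

text \<open>All coefficients after the first are non-positive and the partial sums stay non-negative,
  so the series converges absolutely on the closed unit ball. No limit argument is needed for
  elements of norm 1.\<close>

lemma sum_abs_sqrt_coeff: "(\<Sum>k<n. \<bar>sqrt_coeff (Suc k)\<bar>) \<le> 1"
proof -
  have "(\<Sum>k<n. \<bar>sqrt_coeff (Suc k)\<bar>) = - (\<Sum>k<n. sqrt_coeff (Suc k))"
    by (simp add: sum_negf[symmetric] abs_of_nonpos sqrt_coeff_Suc_nonpos)
  moreover have "(\<Sum>k\<le>n. sqrt_coeff k) = 1 + (\<Sum>k<n. sqrt_coeff (Suc k))"
    by (simp add: sum.atMost_shift)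
  ultimately show ?thesis using sum_sqrt_coeff_nonneg[of n] by linarith
qed

lemma summable_abs_sqrt_coeff: "summable (\<lambda>k. \<bar>sqrt_coeff (Suc k)\<bar>)"
  by (rule summableI_nonneg_bounded[where x = 1]) (auto simp: sum_abs_sqrt_coeff)

lemma norm_power_le_one:
  fixes x :: "'a::unital_cstar_algebra"
  assumes "norm x \<le> 1"
  shows "norm (x ^ k) \<le> 1"
proof (induction k)
  case (Suc k)
  have "norm (x ^ Suc k) \<le> norm x * norm (x ^ k)" by (simp add: norm_mult_ineq)
  also have "\<dots> \<le> 1 * 1" using Suc assms by (intro mult_mono) auto
  finally show ?case by simp
qed (simp add: norm_one_le)

context
  fixes x :: "'a::unital_cstar_algebra"
  assumes x: "norm x \<le> 1"
begin

lemma norm_sqrt_term: "norm (sqrt_coeff k *\<^sub>R x ^ k) \<le> \<bar>sqrt_coeff k\<bar>"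
  using mult_left_mono[OF norm_power_le_one[OF x, of k], of "\<bar>sqrt_coeff k\<bar>"] by simp

lemma summable_sqrt: "summable (\<lambda>k. norm (sqrt_coeff k *\<^sub>R x ^ k))"
proof (rule summable_comparison_test'[where N = 0])
  show "summable (\<lambda>k. \<bar>sqrt_coeff k\<bar>)"
    using summable_abs_sqrt_coeff summable_Suc_iff[of "\<lambda>k. \<bar>sqrt_coeff k\<bar>"] by blast
qed (simp only: real_norm_def abs_norm_cancel norm_sqrt_term)

lemma sqrt1m_square: "sqrt1m x * sqrt1m x = 1 - x"
proof -
  have coeff: "(\<Sum>i\<le>k. sqrt_coeff i * sqrt_coeff (k - i)) = ((1::real) gchoose k) * (- 1) ^ k" for k
  proof -
    have "(\<Sum>i\<le>k. sqrt_coeff i * sqrt_coeff (k - i))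
        = (\<Sum>i\<le>k. ((1/2::real) gchoose i) * ((1/2) gchoose (k - i)) * (- 1) ^ k)"
      by (rule sum.cong) (auto simp: sqrt_coeff_def mult_ac simp flip: power_add)
    then show ?thesis
      using gbinomial_Vandermonde[where a = "1/2::real" and b = "1/2" and n = k] by (simp add: atLeast0AtMost flip: sum_distrib_right)
  qed
  have summand: "(\<Sum>i\<le>k. (sqrt_coeff i *\<^sub>R x ^ i) * (sqrt_coeff (k - i) *\<^sub>R x ^ (k - i)))
      = (((1::real) gchoose k) * (- 1) ^ k) *\<^sub>R x ^ k" for k
  proof -
    have "(\<Sum>i\<le>k. (sqrt_coeff i *\<^sub>R x ^ i) * (sqrt_coeff (k - i) *\<^sub>R x ^ (k - i)))
      = (\<Sum>i\<le>k. (sqrt_coeff i * sqrt_coeff (k - i)) *\<^sub>R x ^ k)"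
      by (rule sum.cong) (auto simp flip: power_add)
    then show ?thesis by (simp add: coeff flip: scaleR_sum_left)
  qed
  have "(\<lambda>k. (((1::real) gchoose k) * (- 1) ^ k) *\<^sub>R x ^ k) sums (sqrt1m x * sqrt1m x)"
    using Cauchy_product_sums[OF summable_sqrt summable_sqrt] unfolding summand sqrt1m_def .
  moreover have "(\<lambda>k. (((1::real) gchoose k) * (- 1) ^ k) *\<^sub>R x ^ k) sums
      (\<Sum>k\<in>{0,1}. (((1::real) gchoose k) * (- 1) ^ k) *\<^sub>R x ^ k)"
  proof (rule sums_finite)
    fix k :: nat assume "k \<notin> {0, 1}"
    then have "(1 :: real) gchoose k = 0"
      using binomial_gbinomial[of 1 k, where 'a = real] by (simp add: binomial_eq_0)
    then show "(((1::real) gchoose k) * (- 1) ^ k) *\<^sub>R x ^ k = 0" by simp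
  qed simp
  ultimately have "sqrt1m x * sqrt1m x = (\<Sum>k\<in>{0,1}. (((1::real) gchoose k) * (- 1) ^ k) *\<^sub>R x ^ k)"
    by (rule sums_unique2)
  then show ?thesis by simp
qed

lemma star_sqrt1m:
  assumes "star x = x"
  shows "star (sqrt1m x) = sqrt1m x"
proof -
  have "star (x ^ k) = x ^ k" for k
    by (induction k) (auto simp: star_mult assms power_commutes)
  then show ?thesis
    unfolding sqrt1m_def
    using bounded_linear.suminf[OF bounded_linear_star summable_norm_cancel[OF summable_sqrt]]
    by (simp add: star_scaleR)
qed

lemma commute_sqrt1m:
  assumes "y * x = x * y"
  shows "y * sqrt1m x = sqrt1m x * y"
proof -
  have "y * x ^ k = x ^ k * y" for k
    by (induction k) (auto simp: mult.assoc, metis assms mult.assoc)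
  then show ?thesis
    unfolding sqrt1m_def
    using bounded_linear.suminf[OF bounded_linear_mult_right[of y] summable_norm_cancel[OF summable_sqrt]]
      bounded_linear.suminf[OF bounded_linear_mult_left[of y] summable_norm_cancel[OF summable_sqrt]]
    by simp
qed

lemma norm_one_minus_sqrt1m: "norm (1 - sqrt1m x) \<le> 1"
proof -
  have s: "summable (\<lambda>k. norm (sqrt_coeff (Suc k) *\<^sub>R x ^ Suc k))"
    using summable_sqrt summable_Suc_iff[of "\<lambda>k. norm (sqrt_coeff k *\<^sub>R x ^ k)"] by blast
  have "sqrt1m x = 1 + (suminf (\<lambda>k. sqrt_coeff (Suc k) *\<^sub>R x ^ Suc k))"
    unfolding sqrt1m_def
    using suminf_split_head[OF summable_norm_cancel[OF summable_sqrt]] by simp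
  then have "norm (1 - sqrt1m x) = norm (suminf (\<lambda>k. sqrt_coeff (Suc k) *\<^sub>R x ^ Suc k))" by simp
  also have "\<dots> \<le> (suminf (\<lambda>k. norm (sqrt_coeff (Suc k) *\<^sub>R x ^ Suc k)))"
    by (rule summable_norm[OF s])
  also have "\<dots> \<le> (suminf (\<lambda>k. \<bar>sqrt_coeff (Suc k)\<bar>))"
    by (intro suminf_le s summable_abs_sqrt_coeff) (simp only: norm_sqrt_term)
  also have "\<dots> \<le> 1"
    by (rule suminf_le_const[OF summable_abs_sqrt_coeff]) (rule sum_abs_sqrt_coeff)
  finally show ?thesis .
qed

end


subsection \<open>Positivity by norms\<close>

lemma star_mult_cartesian:
  fixes h k :: "'a::unital_cstar_algebra"
  assumes "star h = h" "star k = k"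
  shows "star (h + \<i> *\<^sub>C k) * (h + \<i> *\<^sub>C k) = h * h + k * k + \<i> *\<^sub>C (h * k - k * h)"
    and "(h + \<i> *\<^sub>C k) * star (h + \<i> *\<^sub>C k) = h * h + k * k - \<i> *\<^sub>C (h * k - k * h)"
  by (auto simp: assms star_add star_scaleC mult_scaleC_left mult_scaleC_right scaleC_scaleC
      scaleC_minus_left scaleC_diff_right scaleC_add_right algebra_simps)

lemma cartesian_decomposition:
  fixes b :: "'a::unital_cstar_algebra"
  obtains x y where "star x = x" "star y = y" "b = x + \<i> *\<^sub>C y"
proof -
  define x where "x = (1/2) *\<^sub>R (b + star b)"
  define y where "y = (- \<i>/2) *\<^sub>C (b - star b)"
  have xy: "star x = x" "star y = y"
    by (auto simp: x_def y_def star_scaleR star_scaleC star_add star_diff star_star scaleC_diff_right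
        scaleC_minus_left add.commute)
  have b: "b = x + \<i> *\<^sub>C y"
    by (simp add: x_def y_def scaleC_scaleC scaleR_scaleC flip: scaleC_add_right scaleC_add_left)
      (simp add: scaleC_diff_right scaleC_add_right flip: scaleC_add_left)
  show ?thesis using that xy b by blast
qed

text \<open>For \<open>u = h + ik\<close> the right side is \<open>\<parallel>u\<^sup>*u\<parallel> = \<parallel>u\<parallel>\<^sup>2\<close>, and \<open>h\<close> is the mean of \<open>u\<close> and \<open>u\<^sup>*\<close>.\<close>

lemma norm_le_cartesian:
  fixes h k :: "'a::unital_cstar_algebra"
  assumes "star h = h" "star k = k" "h * k = k * h"
  shows "(norm h)\<^sup>2 \<le> norm (h * h + k * k)"
proof -
  let ?u = "h + \<i> *\<^sub>C k"
  have "?u + star ?u = 2 *\<^sub>R h"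
    by (simp add: assms star_add star_scaleC scaleC_minus_left scaleR_2)
  then have "h = (1/2) *\<^sub>R (?u + star ?u)" by simp
  then have "norm h = 1/2 * norm (?u + star ?u)" by (metis abs_of_nonneg norm_scaleR zero_le_divide_1_iff zero_le_numeral)
  also have "\<dots> \<le> norm ?u" using norm_triangle_ineq[of ?u "star ?u"] by simp
  finally have "(norm h)\<^sup>2 \<le> (norm ?u)\<^sup>2" by (simp add: power_mono)
  also have "\<dots> = norm (h * h + k * k)"
    using cstar_identity[of ?u] star_mult_cartesian(1)[OF assms(1,2)] assms(3) by simp
  finally show ?thesis .
qed

text \<open>The imaginary part of the unitary \<open>u\<close> is \<open>k = sqrt (1 - h\<^sup>2)\<close>, given by the square root series.\<close>

lemma contraction_unitary:
  fixes h :: "'a::unital_cstar_algebra"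
  assumes h: "star h = h" "norm h \<le> 1"
  obtains k u where "star k = k" "h * h + k * k = 1" "h * k = k * h"
    "star u * u = 1" "u * star u = 1" "h = (1/2) *\<^sub>R (u + star u)"
proof -
  have hh: "norm (h * h) \<le> 1" "star (h * h) = h * h"
    using h by (auto simp: norm_mult_self star_mult power_le_one)
  define k where "k = sqrt1m (h * h)"
  define u where "u = h + \<i> *\<^sub>C k"
  have k: "star k = k" "h * h + k * k = 1" "h * k = k * h"
    unfolding k_def using hh by (auto simp: star_sqrt1m sqrt1m_square commute_sqrt1m mult.assoc)
  have "star u * u = 1" "u * star u = 1"
    unfolding u_def using star_mult_cartesian[OF h(1) k(1)] k(2,3) by auto
  moreover have "u + star u = 2 *\<^sub>R h"
    by (simp add: u_def h k star_add star_scaleC scaleC_minus_left scaleR_2)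
  then have "h = (1/2) *\<^sub>R (u + star u)" by simp
  ultimately show ?thesis using that k by blast
qed

text \<open>Positivity as a condition on the norm. Sums of such elements are such elements at sight, and the
  square root series makes them squares of self-adjoint elements. That every \<open>a\<^sup>*a\<close> satisfies the
  condition lies deeper, see \<open>npos_star_mult\<close>.\<close>

definition npos :: "'a::unital_cstar_algebra \<Rightarrow> bool" where
  "npos h \<longleftrightarrow> star h = h \<and> (\<exists>t\<ge>0. norm (t *\<^sub>R 1 - h) \<le> t)"

lemma npos_star: "npos h \<Longrightarrow> star h = h"
  by (simp add: npos_def)

lemma npos_zero [simp]: "npos 0"
  by (auto simp: npos_def intro: exI[of _ 0])

lemma nposI: "star h = h \<Longrightarrow> norm (t *\<^sub>R 1 - h) \<le> t \<Longrightarrow> npos h"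
  unfolding npos_def by (meson norm_ge_zero order.trans)

lemma npos_add:
  fixes h k :: "'a::unital_cstar_algebra"
  assumes "npos h" "npos k"
  shows "npos (h + k)"
proof -
  obtain s t where "norm (s *\<^sub>R 1 - h) \<le> s" "norm (t *\<^sub>R 1 - k) \<le> t"
    using assms unfolding npos_def by blast
  then have "norm ((s + t) *\<^sub>R 1 - (h + k)) \<le> s + t"
    using norm_triangle_ineq[of "s *\<^sub>R 1 - h" "t *\<^sub>R 1 - k"] by (simp add: algebra_simps)
  then show ?thesis using assms by (intro nposI) (auto simp: npos_star star_add)
qed

lemma npos_scaleR:
  fixes h :: "'a::unital_cstar_algebra"
  assumes "npos h" "r \<ge> 0"
  shows "npos (r *\<^sub>R h)"
proof -
  obtain s where "norm (s *\<^sub>R 1 - h) \<le> s" using assms unfolding npos_def by blast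
  then have "r * norm (s *\<^sub>R 1 - h) \<le> r * s" using assms by (intro mult_left_mono) auto
  then have "norm ((r * s) *\<^sub>R 1 - r *\<^sub>R h) \<le> r * s"
    using assms norm_scaleR[of r "s *\<^sub>R 1 - h"] by (simp add: scaleR_diff_right)
  then show ?thesis using assms by (intro nposI) (auto simp: npos_star star_scaleR)
qed

lemma npos_one_diff: "star h = h \<Longrightarrow> norm h \<le> t \<Longrightarrow> npos (t *\<^sub>R 1 - h)"
  by (rule nposI[where t = t]) (auto simp: star_diff star_scaleR)

lemma npos_scale_one: "t \<ge> 0 \<Longrightarrow> npos (t *\<^sub>R 1)"
  using npos_one_diff[of 0 t] by simp

text \<open>Scaled by \<open>t\<close>, the condition says \<open>h = 1 - x\<close> with \<open>\<parallel>x\<parallel> \<le> 1\<close>. The commutation property of the root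
  stands in for working in the commutative subalgebra generated by \<open>h\<close>.\<close>

lemma npos_sqrt:
  fixes h :: "'a::unital_cstar_algebra"
  assumes h: "npos h"
  obtains g where "npos g" "g * g = h" "\<And>y. y * h = h * y \<Longrightarrow> y * g = g * y"
proof -
  obtain t where t: "norm (t *\<^sub>R 1 - h) \<le> t" "t \<ge> 0" using h unfolding npos_def by blast
  show ?thesis
  proof (cases "t = 0")
    case True
    then show ?thesis using t that[of 0] by simp
  next
    case False
    define x where "x = 1 - (1/t) *\<^sub>R h"
    have "t *\<^sub>R x = t *\<^sub>R 1 - h" using False by (simp add: x_def scaleR_diff_right)
    then have "t * norm x \<le> t" using t by (metis abs_of_nonneg norm_scaleR)
    then have x: "norm x \<le> 1" using False t by simp
    have xs: "star x = x" using h by (simp add: x_def star_diff star_scaleR npos_star)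
    define g where "g = sqrt t *\<^sub>R sqrt1m x"
    have "npos g"
      unfolding g_def using norm_one_minus_sqrt1m[OF x] star_sqrt1m[OF x xs] t
      by (intro npos_scaleR nposI[where t = 1]) auto
    moreover have "g * g = h"
      using sqrt1m_square[OF x] t False by (simp add: g_def x_def)
    moreover have "y * g = g * y" if "y * h = h * y" for y
      using commute_sqrt1m[OF x, of y] that by (simp add: g_def x_def algebra_simps)
    ultimately show ?thesis using that by blast
  qed
qed

lemma square_le:
  fixes h :: "'a::unital_cstar_algebra"
  assumes h: "star h = h" and t: "norm (h * h) \<le> t"
  shows "norm (t *\<^sub>R 1 - h * h) \<le> t"
proof (cases "t = 0")
  case False
  then have t0: "t > 0" using t norm_ge_zero[of "h * h"] by linarith
  define x where "x = (1 / sqrt t) *\<^sub>R h"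
  have x: "star x = x" by (simp add: x_def h star_scaleR)
  have "(norm x)\<^sup>2 \<le> 1"
    using t t0 unfolding norm_mult_self[OF x, symmetric]
    by (simp add: x_def field_simps)
  then have "norm x \<le> 1" using power2_le_imp_le[of "norm x" 1] by simp
  then obtain k where k: "star k = k" "x * x + k * k = 1" "x * k = k * x"
    using contraction_unitary[OF x] by metis
  have "(norm k)\<^sup>2 \<le> norm (k * k + x * x)"
    using norm_le_cartesian[of k x] k x by simp
  also have "\<dots> \<le> 1" using k(2) norm_one_le by (simp add: add.commute)
  finally have "norm (k * k) \<le> 1" using norm_mult_self[OF k(1)] by simp
  moreover have "t *\<^sub>R 1 - h * h = t *\<^sub>R (k * k)"
  proof -
    have "k * k = 1 - x * x" using k(2) by (simp add: algebra_simps)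
    then show ?thesis using t0 by (simp add: x_def scaleR_diff_right)
  qed
  ultimately show ?thesis using t0 by simp
qed (use t in simp)

lemma npos_square: "star h = h \<Longrightarrow> npos (h * h)"
  by (rule nposI[OF _ square_le]) (auto simp: star_mult)

lemma npos_le: "npos h \<Longrightarrow> norm h \<le> t \<Longrightarrow> norm (t *\<^sub>R 1 - h) \<le> t"
  using npos_sqrt[of h] square_le npos_star by metis

lemma npos_mult:
  fixes h k :: "'a::unital_cstar_algebra"
  assumes "npos h" "npos k" and comm: "h * k = k * h"
  shows "npos (h * k)"
proof -
  obtain g where g: "npos g" "g * g = h" "\<And>y. y * h = h * y \<Longrightarrow> y * g = g * y"
    using npos_sqrt[OF assms(1)] by blast
  obtain l where l: "npos l" "l * l = k" "\<And>y. y * k = k * y \<Longrightarrow> y * l = l * y"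
    using npos_sqrt[OF assms(2)] by blast
  have gl: "g * l = l * g" using l(3)[of g] g(3)[of k] comm by simp
  have "h * k = (g * l) * (g * l)" using g(2) l(2) gl by (metis mult.assoc)
  moreover have "star (g * l) = g * l" using gl g(1) l(1) by (simp add: star_mult npos_star)
  ultimately show ?thesis using npos_square by metis
qed

text \<open>If \<open>k = g\<^sup>2\<close> and \<open>t - k = l\<^sup>2\<close> with commuting roots, then \<open>(g + il)\<^sup>*(g + il) = t\<close>.\<close>

lemma npos_norm_bound:
  fixes k :: "'a::unital_cstar_algebra"
  assumes "npos k" "npos (t *\<^sub>R 1 - k)"
  shows "norm k \<le> \<bar>t\<bar>"
proof -
  obtain g where g: "npos g" "g * g = k" "\<And>y. y * k = k * y \<Longrightarrow> y * g = g * y"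
    using npos_sqrt[OF assms(1)] by blast
  obtain l where l: "npos l" "l * l = t *\<^sub>R 1 - k"
    "\<And>y. y * (t *\<^sub>R 1 - k) = (t *\<^sub>R 1 - k) * y \<Longrightarrow> y * l = l * y"
    using npos_sqrt[OF assms(2)] by blast
  have "g * k = k * g" using g(2) by (metis mult.assoc)
  then have gl: "g * l = l * g" by (intro l(3)) (simp add: algebra_simps)
  have "norm k = (norm g)\<^sup>2" using norm_mult_self[of g] g(1,2) by (simp add: npos_star)
  also have "\<dots> \<le> norm (g * g + l * l)" using norm_le_cartesian[of g l] gl g(1) l(1) by (simp add: npos_star)
  also have "\<dots> \<le> \<bar>t\<bar>" using norm_scaleR_one_le[of t] g(2) l(2) by simp
  finally show ?thesis .
qed

lemma npos_antisym: "npos h \<Longrightarrow> npos (- h) \<Longrightarrow> h = 0"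
  using npos_norm_bound[of h 0] by simp

lemma npos_norm_mono:
  assumes "npos h" "npos k"
  shows "norm h \<le> norm (h + k)"
proof -
  have "npos (norm (h + k) *\<^sub>R 1 - (h + k) + k)"
    using assms by (intro npos_add npos_one_diff) (auto simp: npos_star star_add)
  then show ?thesis using npos_norm_bound[of h "norm (h + k)"] assms by simp
qed

text \<open>The element \<open>m\<close> below is the absolute value of \<open>h\<close>. That \<open>m - h\<close> is positive is shown
  without spectral calculus by comparing \<open>k = m - h\<close> with its own absolute value \<open>n\<close>: the relation
  \<open>k\<^sup>2 = 2mk\<close> forces \<open>(n - k)\<^sup>3 = 0\<close>.\<close>

lemma npos_abs:
  fixes h :: "'a::unital_cstar_algebra"
  assumes h: "star h = h"
  obtains m where "npos m" "m * m = h * h" "h * m = m * h" "npos (m - h)"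
proof -
  obtain m where m: "npos m" "m * m = h * h" "\<And>y. y * (h * h) = (h * h) * y \<Longrightarrow> y * m = m * y"
    using npos_sqrt[OF npos_square[OF h]] by blast
  have hm: "h * m = m * h" by (rule m(3)) (simp add: mult.assoc)
  define k where "k = m - h"
  have k: "star k = k" using h m(1) by (simp add: k_def star_diff npos_star)
  have mk: "m * k = k * m" using hm by (simp add: k_def algebra_simps)
  have kk: "k * k = 2 *\<^sub>R (m * k)" using m(2) hm by (simp add: k_def algebra_simps scaleR_2)
  obtain n where n: "npos n" "n * n = k * k" "\<And>y. y * (k * k) = (k * k) * y \<Longrightarrow> y * n = n * y"
    using npos_sqrt[OF npos_square[OF k]] by blast
  have kn: "k * n = n * k" by (rule n(3)) (simp add: mult.assoc)
  have mn: "m * n = n * m" by (rule n(3)) (metis mk mult.assoc)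
  define d where "d = n - k"
  have d: "star d = d" using k n(1) by (simp add: d_def star_diff npos_star)
  have dd1: "d * d = - 2 *\<^sub>R (k * d)" and dd2: "d * d = 2 *\<^sub>R (n * d)"
    using n(2) kn by (simp_all add: d_def algebra_simps scaleR_2 scaleR_minus_left)
  have md: "m * d = d * m" and nd: "n * d = d * n" using mk mn kn by (simp_all add: d_def algebra_simps)
  have "2 *\<^sub>R (m * (d * d)) = - (n * (d * d))"
  proof -
    have "2 *\<^sub>R (m * (d * d)) = - 2 *\<^sub>R ((2 *\<^sub>R (m * k)) * d)"
      unfolding dd1 by (simp add: mult.assoc)
    also have "\<dots> = - 2 *\<^sub>R (k * k * d)" using kk by simp
    also have "\<dots> = - 2 *\<^sub>R (n * n * d)" using n(2) by simp
    also have "\<dots> = - (n * (d * d))" unfolding dd2 by (simp add: mult.assoc)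
    finally show ?thesis .
  qed
  moreover have "npos (2 *\<^sub>R (m * (d * d)))"
    using npos_mult[OF m(1) npos_square[OF d] commute_square[OF md]] by (rule npos_scaleR) simp
  moreover have "npos (n * (d * d))"
    by (rule npos_mult[OF n(1) npos_square[OF d] commute_square[OF nd]])
  ultimately have "n * (d * d) = 0" using npos_antisym by metis
  then have "d * d * d = 0" using dd2 nd by (metis mult.assoc mult_scaleR_left scaleR_zero_right)
  then have "d = 0" using cube_eq_0 d by blast
  then have "k = n" by (simp add: d_def)
  then show ?thesis using that m hm n(1) unfolding k_def by blast
qed

text \<open>For \<open>k = - b\<^sup>*b\<close> and \<open>p = b b\<^sup>*\<close>, both positive of norm \<open>t\<close>, the identity
  \<open>b (t - k) = (t + p) b\<close> compares norms: the left side has squared norm at most \<open>t\<^sup>3\<close>, the right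
  side at least \<open>2 t\<parallel>p\<^sup>2\<parallel> = 2 t\<^sup>3\<close>.\<close>

lemma npos_minus_star_mult:
  fixes b :: "'a::unital_cstar_algebra"
  assumes k: "npos (- (star b * b))"
  shows "b = 0"
proof -
  obtain x y where xy: "star x = x" "star y = y" and b: "b = x + \<i> *\<^sub>C y"
    using cartesian_decomposition by blast
  have sum: "star b * b + b * star b = 2 *\<^sub>R (x * x + y * y)"
    unfolding b star_mult_cartesian[OF xy] by (simp add: scaleR_2)
  define p where "p = b * star b"
  define t where "t = (norm b)\<^sup>2"
  have "npos (star b * b + b * star b + - (star b * b))"
    unfolding sum using k npos_square xy by (intro npos_add npos_scaleR) auto
  then have p: "npos p" by (simp add: p_def)
  have np: "norm p = t" using cstar_identity[of "star b"] by (simp add: p_def t_def star_star)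
  have nk: "norm (- (star b * b)) = t" using cstar_identity[of b] by (simp add: t_def)
  let ?c = "b * (t *\<^sub>R 1 - (- (star b * b)))"
  have t0: "t \<ge> 0" by (simp add: t_def)
  have c: "?c = (t *\<^sub>R 1 + p) * b" by (simp add: p_def algebra_simps)
  have "norm ?c \<le> norm b * t"
    using norm_mult_ineq mult_left_mono[OF npos_le[OF k] norm_ge_zero] nk order.trans by (metis order.refl)
  then have "(norm ?c)\<^sup>2 \<le> t * t\<^sup>2"
    using power_mono[of "norm ?c" "norm b * t" 2] by (simp add: t_def power_mult_distrib)
  moreover have "(norm ?c)\<^sup>2 = norm ((2 * t) *\<^sub>R (p * p) + (t\<^sup>2 *\<^sub>R p + p * p * p))"
  proof -
    have "(norm ?c)\<^sup>2 = norm (?c * star ?c)" using cstar_identity[of "star ?c"] by (simp add: star_star)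
    also have "\<dots> = norm ((t *\<^sub>R 1 + p) * b * star ((t *\<^sub>R 1 + p) * b))" unfolding c ..
    also have "(t *\<^sub>R 1 + p) * b * star ((t *\<^sub>R 1 + p) * b) = (t *\<^sub>R 1 + p) * p * (t *\<^sub>R 1 + p)"
      using npos_star[OF p] by (simp add: star_mult star_add star_scaleR p_def mult.assoc)
    also have "\<dots> = (2 * t) *\<^sub>R (p * p) + (t\<^sup>2 *\<^sub>R p + p * p * p)"
      unfolding mult_2 scaleR_add_left by (simp add: algebra_simps power2_eq_square)
    finally show ?thesis .
  qed
  moreover have "norm ((2 * t) *\<^sub>R (p * p)) \<le> norm ((2 * t) *\<^sub>R (p * p) + (t\<^sup>2 *\<^sub>R p + p * p * p))"
    using p t0 npos_square[OF npos_star[OF p]]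
    by (intro npos_norm_mono npos_add npos_scaleR npos_mult) (auto simp: mult.assoc)
  moreover have "norm ((2 * t) *\<^sub>R (p * p)) = 2 * t * t\<^sup>2"
    using norm_mult_self[OF npos_star[OF p]] t0 np by simp
  ultimately have "2 * (t * t\<^sup>2) \<le> t * t\<^sup>2" by linarith
  then have "t = 0" using t0 by (simp add: mult_le_0_iff)
  then show ?thesis by (simp add: t_def)
qed

text \<open>With \<open>m = \<bar>h\<bar>\<close> and \<open>k = m - h\<close>, the element \<open>b = a k\<close> has \<open>b\<^sup>*b = k h k = - m k\<^sup>2\<close>, so \<open>b = 0\<close>.\<close>

theorem npos_star_mult: "npos (star a * (a::'a::unital_cstar_algebra))"
proof -
  define h where "h = star a * a"
  have h: "star h = h" by (simp add: h_def star_mult star_star)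
  obtain m where m: "npos m" "m * m = h * h" "h * m = m * h" "npos (m - h)"
    using npos_abs[OF h] by blast
  define k where "k = m - h"
  have k: "npos k" "star k = k" using m npos_star by (auto simp: k_def)
  have mk: "m * k = k * m" using m by (simp add: k_def algebra_simps)
  have hk: "h * k = k * h" using m by (simp add: k_def algebra_simps)
  have kk: "k * k = 2 *\<^sub>R (m * k)" using m by (simp add: k_def algebra_simps scaleR_2)
  have hk': "h * k = - (m * k)" using m by (simp add: k_def algebra_simps)
  have e: "star (a * k) * (a * k) = - (m * (k * k))"
  proof -
    have "star (a * k) * (a * k) = k * h * k" by (simp add: star_mult k h_def mult.assoc)
    also have "\<dots> = h * k * k" using hk by simp
    also have "\<dots> = - (m * (k * k))" by (simp add: hk' mult.assoc)
    finally show ?thesis .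
  qed
  have "npos (m * (k * k))"
    by (rule npos_mult[OF m(1) npos_square[OF k(2)] commute_square[OF mk]])
  then have "a * k = 0" using npos_minus_star_mult[of "a * k"] e by simp
  then have "m * (k * k) = 0" using e by simp
  moreover have "k * k * k = 2 *\<^sub>R (m * (k * k))" using kk by (simp add: mult.assoc)
  ultimately have "k * k * k = 0" by simp
  then have "k = 0" using cube_eq_0 k by blast
  then show ?thesis using m(1) by (simp add: k_def h_def)
qed

lemma sqrt_norm_sq_minus:
  obtains c where "star c = c" "c * c = (norm a)\<^sup>2 *\<^sub>R 1 - star a * (a::'a::unital_cstar_algebra)"
proof -
  have "npos ((norm a)\<^sup>2 *\<^sub>R 1 - star a * a)"
    by (rule npos_one_diff) (auto simp: star_mult star_star cstar_identity)
  then show ?thesis using npos_sqrt that npos_star by metis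
qed


section \<open>Norming functionals and states\<close>

definition sublinear :: "('a::real_vector \<Rightarrow> real) \<Rightarrow> bool" where
  "sublinear q \<longleftrightarrow> (\<forall>x y. q (x + y) \<le> q x + q y) \<and> (\<forall>r\<ge>0. \<forall>x. q (r *\<^sub>R x) \<le> r * q x)"

lemma sublinear_0: "sublinear q \<Longrightarrow> q 0 = 0"
  unfolding sublinear_def
  by (metis add.right_neutral add_le_same_cancel1 antisym_conv le_add_same_cancel1 mult_zero_left order_refl scaleR_zero_left)

lemma sublinear_scaleR:
  assumes "sublinear q" "r \<ge> 0"
  shows "q (r *\<^sub>R x) = r * q x"
proof (cases "r = 0")
  case False
  have "q (inverse r *\<^sub>R r *\<^sub>R x) \<le> inverse r * q (r *\<^sub>R x)"
    using assms False unfolding sublinear_def by (metis inverse_nonnegative_iff_nonnegative)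
  then have "r * q x \<le> q (r *\<^sub>R x)" using assms False by (simp add: field_simps)
  then show ?thesis using assms unfolding sublinear_def by (simp add: antisym)
qed (simp add: sublinear_0[OF assms(1)])

lemma sublinear_lower: "sublinear q \<Longrightarrow> - q (- x) \<le> q x"
  using sublinear_0[of q] unfolding sublinear_def
  by (metis add.right_inverse le_add_same_cancel1 minus_le_iff neg_le_iff_le add_le_cancel_left
      diff_0 diff_le_eq add.commute)

text \<open>Lowering a sublinear functional in the direction \<open>y\<close>: the infimum of
  \<open>q (x + t y) - t q y\<close> over \<open>t \<ge> 0\<close>. It serves twice, to prescribe the value of the functional at
  one vector and to show that minimal sublinear functionals are additive.\<close>

lemma sublinear_lowering:
  assumes q: "sublinear q"
  obtains q' where "sublinear q'" "\<And>x. q' x \<le> q x" "\<And>x. q' x \<le> q (x + y) - q y"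
proof -
  define g where "g x t = q (x + t *\<^sub>R y) - t * q y" for x t
  define q' where "q' x = (INF t\<in>{0..}. g x t)" for x
  have low: "- q (- x) \<le> g x t" if "t \<ge> 0" for x t
  proof -
    have "q (t *\<^sub>R y) \<le> q (- x) + q (x + t *\<^sub>R y)"
      using q unfolding sublinear_def by (metis add.assoc add.left_inverse add.left_neutral)
    then show ?thesis using sublinear_scaleR[OF q that, of y] by (simp add: g_def)
  qed
  have bdd: "bdd_below (g x ` {0..})" for x
    using low by (intro bdd_belowI2) auto
  have upper: "q' x \<le> g x t" if "t \<ge> 0" for x t
    unfolding q'_def by (rule cINF_lower[OF bdd]) (use that in auto)
  have great: "c \<le> q' x" if "\<And>t. t \<ge> 0 \<Longrightarrow> c \<le> g x t" for x c
    unfolding q'_def by (rule cINF_greatest) (use that in auto)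
  have "sublinear q'"
    unfolding sublinear_def
  proof (intro conjI allI impI)
    fix x z
    have *: "q' (x + z) \<le> g x s + g z t" if "s \<ge> 0" "t \<ge> 0" for s t
    proof -
      have "q (x + z + (s + t) *\<^sub>R y) \<le> q (x + s *\<^sub>R y) + q (z + t *\<^sub>R y)"
      proof -
        have "x + z + (s + t) *\<^sub>R y = (x + s *\<^sub>R y) + (z + t *\<^sub>R y)" by (simp add: algebra_simps)
        then show ?thesis using q unfolding sublinear_def by metis
      qed
      then have "g (x + z) (s + t) \<le> g x s + g z t" by (simp add: g_def algebra_simps)
      then show ?thesis using upper[of "s + t" "x + z"] that by simp
    qed
    have "q' (x + z) - g x s \<le> q' z" if "s \<ge> 0" for s
      using *[OF that] by (intro great) (simp add: diff_le_eq add.commute)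
    then have "q' (x + z) - q' z \<le> q' x"
      by (intro great) (simp add: diff_le_eq add.commute)
    then show "q' (x + z) \<le> q' x + q' z" by simp
  next
    fix r :: real and x assume r: "r \<ge> 0"
    have *: "q' (r *\<^sub>R x) \<le> r * g x t" if "t \<ge> 0" for t
    proof -
      have "q (r *\<^sub>R x + (r * t) *\<^sub>R y) \<le> r * q (x + t *\<^sub>R y)"
        using sublinear_scaleR[OF q r, of "x + t *\<^sub>R y"] by (simp add: scaleR_add_right)
      then have "g (r *\<^sub>R x) (r * t) \<le> r * g x t" by (simp add: g_def algebra_simps)
      then show ?thesis using upper[of "r * t" "r *\<^sub>R x"] that r by simp
    qed
    show "q' (r *\<^sub>R x) \<le> r * q' x"
    proof (cases "r = 0")
      case True
      then show ?thesis using *[of 0] by simp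
    next
      case False
      then have "inverse r * q' (r *\<^sub>R x) \<le> q' x"
        using * r by (intro great) (simp add: field_simps)
      then show ?thesis using False r by (simp add: field_simps)
    qed
  qed
  moreover have "q' x \<le> q x" for x using upper[of 0 x] by (simp add: g_def)
  moreover have "q' x \<le> q (x + y) - q y" for x using upper[of 1 x] by (simp add: g_def)
  ultimately show ?thesis using that by blast
qed

text \<open>A chain of sublinear functionals below \<open>p\<close> has its pointwise infimum as a lower bound, because all
  of them are at least \<open>- p (- x)\<close> at \<open>x\<close>.\<close>

lemma sublinear_minimal:
  assumes p: "sublinear p"
  obtains q where "sublinear q" "\<And>x. q x \<le> p x"
    "\<And>q'. sublinear q' \<Longrightarrow> (\<And>x. q' x \<le> q x) \<Longrightarrow> q' = q"
proof -
  define A where "A = {q. sublinear q \<and> (\<forall>x. q x \<le> p x)}"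
  define P where "P = (\<lambda>a b :: 'a \<Rightarrow> real. \<forall>x. b x \<le> a x)"
  have "\<exists>m\<in>A. \<forall>a\<in>A. P m a \<longrightarrow> a = m"
  proof (rule predicate_Zorn)
    show "partial_order_on A (relation_of P A)"
      by (rule partial_order_on_relation_ofI) (auto simp: P_def fun_eq_iff intro: order_trans antisym)
  next
    fix C assume C: "C \<in> Chains (relation_of P A)"
    then have CA: "C \<subseteq> A" and chain: "\<And>a b. a \<in> C \<Longrightarrow> b \<in> C \<Longrightarrow> P a b \<or> P b a"
      unfolding Chains_def relation_of_def by auto
    show "\<exists>u\<in>A. \<forall>a\<in>C. P a u"
    proof (cases "C = {}")
      case True
      then show ?thesis using p by (auto simp: A_def)
    next
      case False
      define u where "u x = (INF q\<in>C. q x)" for x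
      have bdd: "bdd_below ((\<lambda>q. q x) ` C)" for x
      proof (rule bdd_belowI2)
        fix q assume "q \<in> C"
        then have "q \<in> A" using CA by auto
        then show "- p (- x) \<le> q x"
          using sublinear_lower[of q x] unfolding A_def by (smt (verit) mem_Collect_eq)
      qed
      have upper: "u x \<le> q x" if "q \<in> C" for x q
        unfolding u_def by (rule cINF_lower[OF bdd that])
      have great: "c \<le> u x" if "\<And>q. q \<in> C \<Longrightarrow> c \<le> q x" for x c
        unfolding u_def by (rule cINF_greatest) (use False that in auto)
      have "sublinear u"
        unfolding sublinear_def
      proof (intro conjI allI impI)
        fix x y
        have *: "u (x + y) \<le> a x + b y" if ab: "a \<in> C" "b \<in> C" for a b
        proof -
          obtain q where q: "q \<in> C" "P a q" "P b q"
            using chain[OF ab] ab unfolding P_def by blast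
          have "u (x + y) \<le> q (x + y)" using upper q by blast
          also have "\<dots> \<le> q x + q y" using q CA unfolding A_def sublinear_def by blast
          also have "\<dots> \<le> a x + b y" using q unfolding P_def by (simp add: add_mono)
          finally show ?thesis .
        qed
        have "u (x + y) - a x \<le> u y" if "a \<in> C" for a
          using *[OF that] by (intro great) (simp add: diff_le_eq add.commute)
        then have "u (x + y) - u y \<le> u x"
          by (intro great) (simp add: diff_le_eq add.commute)
        then show "u (x + y) \<le> u x + u y" by simp
      next
        fix r :: real and x assume r: "r \<ge> 0"
        have *: "u (r *\<^sub>R x) \<le> r * q x" if "q \<in> C" for q
          using upper[OF that, of "r *\<^sub>R x"] that CA r unfolding A_def sublinear_def
          by (smt (verit) mem_Collect_eq subsetD)
        show "u (r *\<^sub>R x) \<le> r * u x"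
        proof (cases "r = 0")
          case True
          then show ?thesis using * False by auto
        next
          case False
          then have "inverse r * u (r *\<^sub>R x) \<le> u x"
            using * r by (intro great) (simp add: field_simps)
          then show ?thesis using False r by (simp add: field_simps)
        qed
      qed
      moreover have "u x \<le> p x" for x
        using False upper CA unfolding A_def by (smt (verit) equals0I mem_Collect_eq subsetD)
      ultimately show ?thesis using upper by (auto simp: A_def P_def intro!: bexI[of _ u])
    qed
  qed
  then obtain m where m: "m \<in> A" "\<And>a. a \<in> A \<Longrightarrow> P m a \<Longrightarrow> a = m" by blast
  show ?thesis
  proof (rule that[of m])
    fix q' assume "sublinear q'" "\<And>x. q' x \<le> m x"
    then show "q' = m" using m(1) by (intro m(2)) (auto simp: A_def P_def intro: order_trans)
  qed (use m in \<open>auto simp: A_def\<close>)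
qed

text \<open>A minimal sublinear functional \<open>q\<close> equals its lowering in every direction \<open>y\<close>, so that
  \<open>q x \<le> q (x + y) - q y\<close>; hence it is additive. Starting from the norm lowered in the direction \<open>v\<close>
  forces \<open>q v = \<parallel>v\<parallel>\<close>.\<close>

theorem norming_functional:
  fixes v :: "'a::real_normed_vector"
  obtains \<phi> where "linear \<phi>" "\<And>x. \<phi> x \<le> norm x" "\<phi> v = norm v"
proof -
  have "sublinear (norm :: 'a \<Rightarrow> real)"
    unfolding sublinear_def by (auto simp: norm_triangle_ineq)
  then obtain p where p: "sublinear p" "\<And>x. p x \<le> norm x" "\<And>x. p x \<le> norm (x + v) - norm v"
    using sublinear_lowering by blast
  obtain q where q: "sublinear q" "\<And>x. q x \<le> p x"
    and qmin: "\<And>q'. sublinear q' \<Longrightarrow> (\<And>x. q' x \<le> q x) \<Longrightarrow> q' = q"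
    using sublinear_minimal[OF p(1)] by blast
  have add: "q (x + y) = q x + q y" for x y
  proof (rule antisym)
    obtain q' where q': "sublinear q'" "\<And>x. q' x \<le> q x" "\<And>x. q' x \<le> q (x + y) - q y"
      using sublinear_lowering[OF q(1)] by blast
    then have "q' = q" using qmin by blast
    then show "q x + q y \<le> q (x + y)" using q'(3)[of x] by simp
  qed (use q in \<open>simp add: sublinear_def\<close>)
  have minus: "q (- x) = - q x" for x
    using add[of x "- x"] sublinear_0[OF q(1)] by simp
  have "linear q"
  proof (rule linearI)
    fix r x
    show "q (r *\<^sub>R x) = r *\<^sub>R q x"
    proof (cases "r \<ge> 0")
      case False
      then have "q ((- r) *\<^sub>R x) = - r * q x" by (intro sublinear_scaleR[OF q(1)]) auto
      then show ?thesis using minus[of "r *\<^sub>R x"] by simp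
    qed (simp add: sublinear_scaleR[OF q(1)])
  qed (rule add)
  moreover have "q x \<le> norm x" for x using q(2) p(2) order_trans by blast
  moreover have "q v = norm v"
    using q(2)[of "- v"] p(3)[of "- v"] minus[of v] \<open>q v \<le> norm v\<close> by simp
  ultimately show ?thesis using that by blast
qed


subsection \<open>Positive functionals\<close>

lemma vector_space_scaleC: "vector_space (scaleC :: complex \<Rightarrow> 'a::unital_cstar_algebra \<Rightarrow> 'a)"
  by unfold_locales (auto simp: scaleC_add_right scaleC_add_left scaleC_scaleC)

lemma vector_space_complex: "vector_space ((*) :: complex \<Rightarrow> complex \<Rightarrow> complex)"
  by unfold_locales (auto simp: algebra_simps)

lemma pf_add: "f \<in> positive_functionals \<Longrightarrow> f (x + y) = f x + f y"
  by (auto simp: positive_functionals_def Vector_Spaces.linear_iff)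

lemma pf_scaleC: "f \<in> positive_functionals \<Longrightarrow> f (c *\<^sub>C x) = c * f x"
  by (auto simp: positive_functionals_def Vector_Spaces.linear_iff)

lemma pf_pos: "f \<in> positive_functionals \<Longrightarrow> f (star x * x) \<in> \<real>\<^sub>\<ge>\<^sub>0"
  by (auto simp: positive_functionals_def positive_elem_def)

lemma pf_Re_pos: "f \<in> positive_functionals \<Longrightarrow> 0 \<le> Re (f (star x * x))"
  using pf_pos by (metis complex_nonneg_Reals_iff)

lemma pf_zero: "f \<in> positive_functionals \<Longrightarrow> f 0 = 0"
  using pf_scaleC[of f 0 0] by simp

lemma pf_minus: "f \<in> positive_functionals \<Longrightarrow> f (- x) = - f x"
  using pf_scaleC[of f "- 1" x] by (simp add: scaleC_minus_left)

lemma pf_diff: "f \<in> positive_functionals \<Longrightarrow> f (x - y) = f x - f y"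
  using pf_add[of f x "- y"] by (simp add: pf_minus)

lemma pf_scaleR: "f \<in> positive_functionals \<Longrightarrow> f (r *\<^sub>R x) = r * f x"
  by (simp add: scaleR_scaleC pf_scaleC)

lemma npos_imp_positive_elem: "npos h \<Longrightarrow> positive_elem h"
  by (metis npos_sqrt npos_star positive_elem_def)

lemma self_adjoint_difference:
  fixes h :: "'a::unital_cstar_algebra"
  assumes "star h = h"
  obtains p q where "positive_elem p" "positive_elem q" "h = p - q"
proof -
  have "positive_elem (norm h *\<^sub>R (1::'a))" "positive_elem (norm h *\<^sub>R 1 - h)"
    using assms by (auto intro!: npos_imp_positive_elem npos_one_diff npos_scale_one)
  then show ?thesis using that[of "norm h *\<^sub>R 1" "norm h *\<^sub>R 1 - h"] by simp
qed

lemma pf_star: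
  assumes f: "f \<in> positive_functionals"
  shows "f (star x) = cnj (f x)"
proof -
  have real: "f h \<in> \<real>" if h: "star h = h" for h
  proof -
    obtain p q where "positive_elem p" "positive_elem q" "h = p - q"
      using self_adjoint_difference[OF h] by blast
    then have "f p \<in> \<real>\<^sub>\<ge>\<^sub>0" "f q \<in> \<real>\<^sub>\<ge>\<^sub>0" "f h = f p - f q"
      using f by (auto simp: positive_functionals_def pf_diff[OF f])
    then show ?thesis by (metis Reals_diff nonneg_Reals_subset_Reals subsetD)
  qed
  obtain h k where hk: "star h = h" "star k = k" "x = h + \<i> *\<^sub>C k"
    using cartesian_decomposition by blast
  then have "f (star x) = f h - \<i> * f k"
    by (simp add: star_add star_scaleC pf_add[OF f] pf_scaleC[OF f])
  also have "\<dots> = cnj (f x)"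
    using hk real[of h] real[of k]
    by (simp add: pf_add[OF f] pf_scaleC[OF f] Reals_cnj_iff)
  finally show ?thesis .
qed

text \<open>With \<open>c\<^sup>2 = \<parallel>a\<parallel>\<^sup>2 - a\<^sup>*a\<close>, the difference of the two sides is the value of \<open>f\<close> at \<open>(cv)\<^sup>*(cv)\<close>.\<close>

lemma pf_mult_le:
  assumes f: "f \<in> positive_functionals"
  shows "Re (f (star (a * v) * (a * v))) \<le> (norm a)\<^sup>2 * Re (f (star v * v))"
proof -
  obtain c where c: "star c = c" "c * c = (norm a)\<^sup>2 *\<^sub>R 1 - star a * a"
    using sqrt_norm_sq_minus by blast
  have "star (c * v) * (c * v) = star v * (c * c) * v" by (simp add: star_mult c(1) mult.assoc)
  also have "\<dots> = (norm a)\<^sup>2 *\<^sub>R (star v * v) - star (a * v) * (a * v)"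
    by (simp add: c(2) star_mult mult.assoc algebra_simps)
  finally show ?thesis
    using pf_Re_pos[OF f, of "c * v"] by (simp add: pf_diff[OF f] pf_scaleR[OF f])
qed

text \<open>A functional \<open>\<phi>\<close> of norm at most 1 that attains its norm at \<open>v = \<parallel>h\<parallel> + h\<close>, where \<open>h = a\<^sup>*a\<close>, has
  \<open>\<phi> 1 = 1\<close> and \<open>\<phi> h = \<parallel>h\<parallel>\<close>, because \<open>\<parallel>v\<parallel> = 2\<parallel>h\<parallel>\<close>. The first equation makes it positive.\<close>

theorem state_attaining_norm:
  fixes a :: "'a::unital_cstar_algebra"
  obtains f where "f \<in> positive_functionals" "f (star a * a) = (norm a)\<^sup>2" "Re (f 1) \<le> 1"
proof (cases "a = 0")
  case True
  have "(\<lambda>_::'a. 0) \<in> positive_functionals"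
    by (simp add: positive_functionals_def Vector_Spaces.linear_iff vector_space_scaleC vector_space_complex)
  then show ?thesis using that[of "\<lambda>_. 0"] True by simp
next
  case False
  define h where "h = star a * a"
  have h: "npos h" "star h = h" by (auto simp: h_def npos_star_mult star_mult star_star)
  have nh: "norm h = (norm a)\<^sup>2" by (simp add: h_def cstar_identity)
  have nh0: "norm h > 0" using False by (simp add: nh)
  define v where "v = norm h *\<^sub>R 1 + h"
  have "norm h * 1 \<le> norm (norm h *\<^sub>R (1::'a))"
  proof -
    have "norm h \<le> norm h * norm (1::'a)" using norm_mult_ineq[of h 1] by simp
    then show ?thesis by simp
  qed
  then have "norm h \<le> norm v"
    unfolding v_def using npos_norm_mono[OF npos_scale_one h(1), of "norm h"] by simp
  moreover have "norm h \<le> \<bar>norm v - norm h\<bar>"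
  proof (rule npos_norm_bound[OF h(1)])
    have "npos (norm v *\<^sub>R 1 - v)"
      by (rule npos_one_diff) (auto simp: v_def star_add star_scaleR h)
    then show "npos ((norm v - norm h) *\<^sub>R 1 - h)" by (simp add: v_def algebra_simps)
  qed
  ultimately have nv: "norm v \<ge> 2 * norm h" by linarith
  obtain \<phi> where \<phi>: "linear \<phi>" "\<And>x. \<phi> x \<le> norm x" "\<phi> v = norm v"
    using norming_functional by blast
  have "\<phi> v = norm h * \<phi> 1 + \<phi> h" by (simp add: v_def linear_add[OF \<phi>(1)] linear_scale[OF \<phi>(1)])
  moreover have "\<phi> 1 \<le> 1" using \<phi>(2)[of 1] norm_one_le order_trans by blast
  then have "norm h * \<phi> 1 \<le> norm h" using nh0 by simp
  ultimately have "norm h * \<phi> 1 = norm h" "\<phi> h = norm h"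
    using \<phi>(2)[of h] \<phi>(3) nv by linarith+
  then have \<phi>1: "\<phi> 1 = 1" using nh0 by simp
  have pos: "0 \<le> \<phi> k" if k: "npos k" for k
  proof -
    have "\<phi> (norm k *\<^sub>R 1 - k) \<le> norm k" using \<phi>(2) npos_le[OF k order_refl] order_trans by blast
    then show ?thesis by (simp add: linear_diff[OF \<phi>(1)] linear_scale[OF \<phi>(1)] \<phi>1)
  qed
  define \<psi> where "\<psi> x = \<phi> ((1/2) *\<^sub>R (x + star x))" for x
  have \<psi>_add: "\<psi> (x + y) = \<psi> x + \<psi> y" for x y
    unfolding \<psi>_def by (simp add: star_add algebra_simps flip: linear_add[OF \<phi>(1)] scaleR_add_right)
  have \<psi>_scaleR: "\<psi> (r *\<^sub>R x) = r * \<psi> x" for r x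
  proof -
    have "(1/2) *\<^sub>R (r *\<^sub>R x + star (r *\<^sub>R x)) = r *\<^sub>R ((1/2) *\<^sub>R (x + star x))"
      by (simp add: star_scaleR scaleR_add_right mult.commute)
    then show ?thesis unfolding \<psi>_def by (simp add: linear_scale[OF \<phi>(1)])
  qed
  have \<psi>_sa: "\<psi> x = \<phi> x" "\<psi> (\<i> *\<^sub>C x) = 0" if "star x = x" for x
    using that linear_0[OF \<phi>(1)] by (simp_all add: \<psi>_def star_scaleC scaleC_minus_left flip: scaleR_2)
  define f where "f x = Complex (\<psi> x) (- \<psi> (\<i> *\<^sub>C x))" for x
  have f_add: "f (x + y) = f x + f y" for x y
    by (simp add: f_def complex_eq_iff \<psi>_add scaleC_add_right)
  have f_real: "f (of_real r *\<^sub>C x) = of_real r * f x" for r x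
  proof -
    have "\<i> *\<^sub>C (of_real r *\<^sub>C x) = r *\<^sub>R (\<i> *\<^sub>C x)" by (simp add: scaleR_scaleC scaleC_scaleC mult.commute)
    then show ?thesis by (simp add: f_def complex_eq_iff \<psi>_scaleR flip: scaleR_scaleC)
  qed
  have f_i: "f (\<i> *\<^sub>C x) = \<i> * f x" for x
    using \<psi>_scaleR[of "- 1" x] by (simp add: f_def complex_eq_iff scaleC_scaleC scaleC_minus_left)
  have f_scaleC: "f (c *\<^sub>C x) = c * f x" for c x
  proof -
    have "c *\<^sub>C x = of_real (Re c) *\<^sub>C x + of_real (Im c) *\<^sub>C (\<i> *\<^sub>C x)"
      unfolding scaleC_scaleC scaleC_add_left[symmetric] by (metis complex_eq mult.commute)
    then have "f (c *\<^sub>C x) = (of_real (Re c) + of_real (Im c) * \<i>) * f x"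
      by (simp only: f_add f_real f_i) (simp add: algebra_simps)
    then show ?thesis by (metis complex_eq mult.commute)
  qed
  have f_sa: "f x = of_real (\<phi> x)" if "star x = x" for x
    using \<psi>_sa[OF that] by (simp add: f_def complex_eq_iff)
  have "f \<in> positive_functionals"
    unfolding positive_functionals_def Vector_Spaces.linear_iff positive_elem_def
    using pos[OF npos_star_mult]
    by (auto simp: vector_space_scaleC vector_space_complex f_add f_scaleC f_sa star_mult star_star)
  then show ?thesis
    using that[of f] f_sa[OF h(2)] f_sa[of 1] \<phi>1 \<open>\<phi> h = norm h\<close> nh by (simp add: h_def)
qed


section \<open>Endomorphisms with a complete transfer operator\<close>

locale transfer_system =
  fixes \<delta> \<delta>s :: "'a::unital_cstar_algebra \<Rightarrow> 'a"
  assumes endo: "star_endomorphism \<delta>" and transfer: "complete_transfer_operator \<delta> \<delta>s"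
begin

lemma delta_add: "\<delta> (x + y) = \<delta> x + \<delta> y"
  and delta_scaleC: "\<delta> (c *\<^sub>C x) = c *\<^sub>C \<delta> x"
  and delta_mult: "\<delta> (x * y) = \<delta> x * \<delta> y"
  and delta_star: "\<delta> (star x) = star (\<delta> x)"
  using endo by (auto simp: star_endomorphism_def Vector_Spaces.linear_iff)

lemma ds_add: "\<delta>s (x + y) = \<delta>s x + \<delta>s y"
  and ds_scaleC: "\<delta>s (c *\<^sub>C x) = c *\<^sub>C \<delta>s x"
  and ds_pos: "positive_elem x \<Longrightarrow> positive_elem (\<delta>s x)"
  and ds_delta: "\<delta>s (\<delta> x * y) = x * \<delta>s y"
  and delta_ds: "\<delta> (\<delta>s x) = \<delta> 1 * x * \<delta> 1"
  using transfer
  by (auto simp: complete_transfer_operator_def transfer_operator_def Vector_Spaces.linear_iff)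

lemma delta_minus: "\<delta> (- x) = - \<delta> x"
  using delta_scaleC[of "- 1" x] by (simp add: scaleC_minus_left)

lemma delta_diff: "\<delta> (x - y) = \<delta> x - \<delta> y"
  using delta_add[of x "- y"] by (simp add: delta_minus)

lemma ds_minus: "\<delta>s (- x) = - \<delta>s x"
  using ds_scaleC[of "- 1" x] by (simp add: scaleC_minus_left)

lemma ds_diff: "\<delta>s (x - y) = \<delta>s x - \<delta>s y"
  using ds_add[of x "- y"] by (simp add: ds_minus)

lemma ds_zero [simp]: "\<delta>s 0 = 0"
  using ds_diff[of 0 0] by simp

text \<open>Self-adjoint elements are differences of positive ones, and these are mapped to positive ones.\<close>

lemma ds_star: "\<delta>s (star x) = star (\<delta>s x)"
proof -
  have sa: "star (\<delta>s h) = \<delta>s h" if h: "star h = h" for h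
  proof -
    have pos: "star p = p" if "positive_elem p" for p :: 'a
      using that by (auto simp: positive_elem_def star_mult star_star)
    obtain p q where "positive_elem p" "positive_elem q" "h = p - q"
      using self_adjoint_difference[OF h] by blast
    then show ?thesis using pos ds_pos by (simp add: ds_diff star_diff)
  qed
  obtain h k where hk: "star h = h" "star k = k" "x = h + \<i> *\<^sub>C k"
    using cartesian_decomposition by blast
  then show ?thesis
    using sa[of h] sa[of k] by (simp add: star_add star_scaleC ds_add ds_scaleC)
qed

lemma ds_delta_right: "\<delta>s (y * \<delta> x) = \<delta>s y * x"
proof -
  have "star (\<delta>s (y * \<delta> x)) = star (\<delta>s y * x)"
    using ds_delta[of "star x" "star y"] by (simp add: delta_star star_mult flip: ds_star)
  then show ?thesis by (metis star_star)
qed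

lemma ds_one_idem: "\<delta>s 1 * \<delta>s 1 = \<delta>s 1"
  using ds_delta[of "\<delta>s 1" 1] ds_delta[of 1 1] by (simp add: delta_ds flip: delta_mult)

lemma ds_delta_one: "\<delta>s (\<delta> x) = \<delta>s 1 * x" "\<delta>s (\<delta> x) = x * \<delta>s 1"
  using ds_delta_right[of 1 x] ds_delta[of x 1] by simp_all

lemma ds_cut: "\<delta>s (\<delta> 1 * x) = \<delta>s x" "\<delta>s (x * \<delta> 1) = \<delta>s x"
  using ds_delta[of 1 x] ds_delta_right[of x 1] by simp_all


subsection \<open>Iterates\<close>

definition e :: "nat \<Rightarrow> 'a" where "e n = (\<delta> ^^ n) 1"

lemma dn_add: "(\<delta> ^^ n) (x + y) = (\<delta> ^^ n) x + (\<delta> ^^ n) y"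
  by (induction n) (auto simp: delta_add)

lemma dn_scaleC: "(\<delta> ^^ n) (c *\<^sub>C x) = c *\<^sub>C (\<delta> ^^ n) x"
  by (induction n) (auto simp: delta_scaleC)

lemma dn_mult: "(\<delta> ^^ n) (x * y) = (\<delta> ^^ n) x * (\<delta> ^^ n) y"
  by (induction n) (auto simp: delta_mult)

lemma dn_star: "(\<delta> ^^ n) (star x) = star ((\<delta> ^^ n) x)"
  by (induction n) (auto simp: delta_star)

lemma e_0 [simp]: "e 0 = 1"
  by (simp add: e_def)

lemma star_e [simp]: "star (e n) = e n"
  by (simp add: e_def flip: dn_star)

lemma e_dn: "e n * (\<delta> ^^ n) x = (\<delta> ^^ n) x" "(\<delta> ^^ n) x * e n = (\<delta> ^^ n) x"
  by (simp_all add: e_def flip: dn_mult)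

lemma e_e: "m \<le> n \<Longrightarrow> e m * e n = e n" "m \<le> n \<Longrightarrow> e n * e m = e n"
proof -
  assume "m \<le> n"
  then have "e n = (\<delta> ^^ m) (e (n - m))" by (simp add: e_def flip: funpow_add comp_apply[of "\<delta> ^^ m"])
  then show "e m * e n = e n" "e n * e m = e n" using e_dn[of m] by simp_all
qed

lemma e_idem [simp]: "e n * e n = e n"
  by (rule e_e) simp

lemma e_idem_left [simp]: "e n * (e n * x) = e n * x"
  by (simp flip: mult.assoc)

lemma norm_projection_le:
  fixes p :: 'a
  assumes "star p = p" "p * p = p"
  shows "norm p \<le> 1"
proof -
  have "(norm p)\<^sup>2 = norm p" using norm_mult_self[OF assms(1)] assms(2) by simp
  then have "norm p = 0 \<or> norm p = 1" by (simp add: power2_eq_square)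
  then show ?thesis by auto
qed

text \<open>If \<open>\<parallel>a\<parallel>\<^sup>2 - a\<^sup>*a = c\<^sup>2\<close>, then \<open>\<delta>(a)\<^sup>*\<delta>(a)\<close> and \<open>\<delta>(c)\<^sup>2\<close> are positive with sum \<open>\<parallel>a\<parallel>\<^sup>2 \<delta>(1)\<close>.\<close>

lemma norm_delta_le: "norm (\<delta> a) \<le> norm a"
proof -
  obtain c where c: "star c = c" "c * c = (norm a)\<^sup>2 *\<^sub>R 1 - star a * a"
    using sqrt_norm_sq_minus by blast
  have "star (\<delta> c) * \<delta> c = \<delta> (c * c)" by (simp add: delta_mult c(1) flip: delta_star)
  also have "\<dots> = (norm a)\<^sup>2 *\<^sub>R \<delta> 1 - star (\<delta> a) * \<delta> a"
    by (simp add: c(2) delta_diff delta_mult delta_star scaleR_scaleC delta_scaleC)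
  finally have eq: "star (\<delta> a) * \<delta> a + star (\<delta> c) * \<delta> c = (norm a)\<^sup>2 *\<^sub>R \<delta> 1" by simp
  have "(norm (\<delta> a))\<^sup>2 = norm (star (\<delta> a) * \<delta> a)" by (simp add: cstar_identity)
  also have "\<dots> \<le> norm (star (\<delta> a) * \<delta> a + star (\<delta> c) * \<delta> c)"
    by (intro npos_norm_mono npos_star_mult)
  also have "\<dots> \<le> (norm a)\<^sup>2"
    unfolding eq
    using norm_projection_le[of "\<delta> 1"] mult_left_le[of "norm (\<delta> 1)" "(norm a)\<^sup>2"]
    by (simp flip: delta_star delta_mult)
  finally show ?thesis by (rule power2_le_imp_le) simp
qed

lemma norm_dn_le: "norm ((\<delta> ^^ n) a) \<le> norm a"
  by (induction n) (auto intro: order_trans[OF norm_delta_le])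

lemma dsn_add: "(\<delta>s ^^ n) (x + y) = (\<delta>s ^^ n) x + (\<delta>s ^^ n) y"
  by (induction n) (auto simp: ds_add)

lemma dsn_scaleC: "(\<delta>s ^^ n) (c *\<^sub>C x) = c *\<^sub>C (\<delta>s ^^ n) x"
  by (induction n) (auto simp: ds_scaleC)

lemma dsn_pos: "positive_elem x \<Longrightarrow> positive_elem ((\<delta>s ^^ n) x)"
  by (induction n) (auto simp: ds_pos)

lemma pf_dsn:
  assumes "f \<in> positive_functionals"
  shows "(\<lambda>x. f ((\<delta>s ^^ n) x)) \<in> positive_functionals"
  using assms dsn_pos
  by (auto simp: positive_functionals_def Vector_Spaces.linear_iff dsn_add dsn_scaleC)


subsection \<open>The inner products of the regular representation\<close>

definition ip :: "('a \<Rightarrow> complex) \<Rightarrow> int \<Rightarrow> 'a \<Rightarrow> 'a \<Rightarrow> complex" where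
  "ip f n = reg_inner \<delta> \<delta>s f n"

lemma ip_nonneg: "n \<ge> 0 \<Longrightarrow> ip f n v u = f ((\<delta>s ^^ nat n) (star u * v))"
  by (simp add: ip_def reg_inner_def)

lemma ip_nonpos: "n \<le> 0 \<Longrightarrow> ip f n v u = f (star u * e (nat (- n)) * v)"
  by (auto simp: ip_def reg_inner_def e_def)

text \<open>Writing the diagonal as a positive functional at some \<open>w\<^sup>*w\<close> gives positivity and all bounds below.\<close>

lemma ip_diag:
  "n \<ge> 0 \<Longrightarrow> ip f n v v = f ((\<delta>s ^^ nat n) (star v * v))"
  "n \<le> 0 \<Longrightarrow> ip f n v v = f (star (e (nat (- n)) * v) * (e (nat (- n)) * v))"
  by (simp_all add: ip_nonneg ip_nonpos star_mult mult.assoc)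

context
  fixes f :: "'a \<Rightarrow> complex" assumes f: "f \<in> positive_functionals"
begin

lemma ip_add_left: "ip f n (v + w) u = ip f n v u + ip f n w u"
  by (cases "n \<ge> 0") (simp_all add: ip_nonneg ip_nonpos distrib_left dsn_add pf_add[OF f])

lemma ip_scale_left: "ip f n (c *\<^sub>C v) u = c * ip f n v u"
  by (cases "n \<ge> 0") (simp_all add: ip_nonneg ip_nonpos mult_scaleC_right dsn_scaleC pf_scaleC[OF f])

lemma ip_cnj: "ip f n u v = cnj (ip f n v u)"
proof (cases "n \<ge> 0")
  case True
  then show ?thesis using pf_star[OF pf_dsn[OF f, of "nat n"], of "star u * v"]
    by (simp add: ip_nonneg star_mult star_star)
next
  case False
  then show ?thesis using pf_star[OF f, of "star u * e (nat (- n)) * v"]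
    by (simp add: ip_nonpos star_mult star_star mult.assoc)
qed

lemma ip_pos: "0 \<le> Re (ip f n v v)"
  using pf_Re_pos[OF f] pf_Re_pos[OF pf_dsn[OF f]] by (cases "n \<ge> 0") (simp_all add: ip_diag)

end

text \<open>The action of \<open>U\<close>, \<open>U\<^sup>*\<close> and \<open>\<pi>(a)\<close> on representatives, indexed by the degree \<open>n\<close> of the image; the
  argument has degree \<open>n - 1\<close>, \<open>n + 1\<close> and \<open>n\<close>, respectively.\<close>

definition uc :: "int \<Rightarrow> 'a \<Rightarrow> 'a" where
  "uc n v = (if n > 0 then \<delta> v else e (Suc (nat (- n))) * v)"

definition usc :: "int \<Rightarrow> 'a \<Rightarrow> 'a" where
  "usc n v = (if n \<ge> 0 then \<delta>s v else e (nat (- n)) * v)"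

definition pc :: "'a \<Rightarrow> int \<Rightarrow> 'a \<Rightarrow> 'a" where
  "pc a n v = (if n \<ge> 0 then a * v else (\<delta> ^^ nat (- n)) a * v)"

lemma pc_nonpos: "n \<le> 0 \<Longrightarrow> pc a n v = (\<delta> ^^ nat (- n)) a * v"
  by (auto simp: pc_def)

lemma U_formula_uc: "U_formula \<delta> h n = uc n (h (n - 1))"
  by (auto simp: U_formula_def uc_def e_def)

lemma Ustar_formula_usc: "Ustar_formula \<delta> \<delta>s h n = usc n (h (n + 1))"
  by (auto simp: Ustar_formula_def usc_def e_def)

lemma pi_formula_pc: "pi_formula \<delta> a h n = pc a n (h n)"
  by (auto simp: pi_formula_def pc_def)

lemma uc_linear: "uc n (v + w) = uc n v + uc n w" "uc n (c *\<^sub>C v) = c *\<^sub>C uc n v"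
  by (auto simp: uc_def delta_add delta_scaleC distrib_left mult_scaleC_right)

lemma usc_linear: "usc n (v + w) = usc n v + usc n w" "usc n (c *\<^sub>C v) = c *\<^sub>C usc n v"
  by (auto simp: usc_def ds_add ds_scaleC distrib_left mult_scaleC_right)

lemma pc_linear: "pc a n (v + w) = pc a n v + pc a n w" "pc a n (c *\<^sub>C v) = c *\<^sub>C pc a n v"
  by (auto simp: pc_def distrib_left mult_scaleC_right)

lemma dsn_Suc: "n > 0 \<Longrightarrow> (\<delta>s ^^ nat n) x = (\<delta>s ^^ nat (n - 1)) (\<delta>s x)"
proof -
  assume "n > 0"
  then have "nat n = Suc (nat (n - 1))" by simp
  then show ?thesis by (simp only: funpow_Suc_right comp_apply)
qed

lemma nat_minus_pred: "n \<le> 0 \<Longrightarrow> nat (1 - n) = Suc (nat (- n))"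
  by simp

lemma uc_adjoint: "ip f n (uc n v) u = ip f (n - 1) v (usc (n - 1) u)"
proof (cases "n > 0")
  case True
  then show ?thesis
    by (simp add: ip_nonneg uc_def usc_def dsn_Suc ds_delta_right ds_star[symmetric])
next
  case False
  then show ?thesis
    using e_e(1)[of "nat (- n)" "Suc (nat (- n))"]
    by (simp add: ip_nonpos uc_def usc_def nat_minus_pred star_mult mult.assoc
        del: e_idem e_idem_left)
      (simp flip: mult.assoc)
qed

lemma pc_adjoint: "ip f n (pc a n v) u = ip f n v (pc (star a) n u)"
  using e_dn[of "nat (- n)" a]
  by (cases "n \<ge> 0")
    (simp_all add: ip_nonneg ip_nonpos pc_def star_mult star_star dn_star mult.assoc,
      metis mult.assoc)

text \<open>In positive degrees \<open>\<delta>\<^sub>*(\<delta>(v)\<^sup>*\<delta>(v)) = v\<^sup>*v \<delta>\<^sub>*(1)\<close>, and \<open>\<delta>\<^sub>*(1)\<close> is a central projection.\<close>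

lemma uc_bound:
  assumes f: "f \<in> positive_functionals"
  shows "Re (ip f n (uc n v) (uc n v)) \<le> Re (ip f (n - 1) v v)"
proof (cases "n > 0")
  case True
  let ?d = "\<delta>s 1"
  have d: "star ?d = ?d" by (simp flip: ds_star)
  have "ip f n (uc n v) (uc n v) = f ((\<delta>s ^^ nat (n - 1)) (star v * v * ?d))"
    using True by (simp add: ip_nonneg uc_def dsn_Suc ds_delta_one(2) flip: delta_star delta_mult)
  also have "star v * v * ?d = star (?d * v) * (?d * v)"
  proof -
    have "star (?d * v) * (?d * v) = star v * ((?d * ?d) * v)"
      by (simp add: star_mult d mult.assoc)
    also have "\<dots> = star v * (v * ?d)" using ds_one_idem ds_delta_one[of v] by simp
    finally show ?thesis by (simp add: mult.assoc)
  qed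
  finally have "Re (ip f n (uc n v) (uc n v)) \<le> (norm ?d)\<^sup>2 * Re (ip f (n - 1) v v)"
    using pf_mult_le[OF pf_dsn[OF f], of "nat (n - 1)" ?d v] True by (simp add: ip_nonneg)
  also have "\<dots> \<le> 1 * Re (ip f (n - 1) v v)"
    using norm_projection_le[OF d ds_one_idem] ip_pos[OF f]
    by (intro mult_right_mono) (auto simp: power_le_one)
  finally show ?thesis by simp
next
  case False
  then show ?thesis
    using e_e(1)[of "nat (- n)" "Suc (nat (- n))"]
    by (simp add: ip_diag uc_def nat_minus_pred flip: mult.assoc)
qed

text \<open>In degrees \<open>n \<ge> 0\<close>, \<open>\<delta>\<^sub>*(v)\<^sup>*\<delta>\<^sub>*(v) = \<delta>\<^sub>*((\<delta>(1)v)\<^sup>*(\<delta>(1)v))\<close> by completeness of the transfer operator.\<close>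

lemma usc_bound:
  assumes f: "f \<in> positive_functionals"
  shows "Re (ip f n (usc n v) (usc n v)) \<le> Re (ip f (n + 1) v v)"
proof (cases "n \<ge> 0")
  case True
  have p: "star (\<delta> 1) = \<delta> 1" "\<delta> 1 * \<delta> 1 = \<delta> 1" by (simp_all flip: delta_star delta_mult)
  have "star (\<delta>s v) * \<delta>s v = \<delta>s (star v * (\<delta> 1 * v * \<delta> 1))"
    by (simp add: ds_delta_right flip: ds_star delta_ds)
  also have "\<dots> = \<delta>s (star (\<delta> 1 * v) * (\<delta> 1 * v))"
  proof -
    have "star (\<delta> 1 * v) * (\<delta> 1 * v) = star v * ((\<delta> 1 * \<delta> 1) * v)"
      by (simp only: star_mult p(1) mult.assoc)
    then show ?thesis using ds_cut(2)[of "star v * (\<delta> 1 * v)"] p(2) by (simp add: mult.assoc)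
  qed
  finally have "ip f n (usc n v) (usc n v) = f ((\<delta>s ^^ nat (n + 1)) (star (\<delta> 1 * v) * (\<delta> 1 * v)))"
    using True by (simp add: ip_nonneg usc_def dsn_Suc)
  then have "Re (ip f n (usc n v) (usc n v)) \<le> (norm (\<delta> 1))\<^sup>2 * Re (ip f (n + 1) v v)"
    using pf_mult_le[OF pf_dsn[OF f], of "nat (n + 1)" "\<delta> 1" v] True by (simp add: ip_nonneg)
  also have "\<dots> \<le> 1 * Re (ip f (n + 1) v v)"
    using norm_projection_le[OF p] ip_pos[OF f]
    by (intro mult_right_mono) (auto simp: power_le_one)
  finally show ?thesis by simp
next
  case False
  then have n: "nat (- n) = Suc (nat (- (n + 1)))" by simp
  let ?k = "nat (- (n + 1))"
  have ee: "e (Suc ?k) * (e ?k * v) = e (Suc ?k) * v" using e_e(2)[of ?k "Suc ?k"] by (simp flip: mult.assoc)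
  have "ip f n (usc n v) (usc n v) = f (star (e (Suc ?k) * (e ?k * v)) * (e (Suc ?k) * (e ?k * v)))"
    using False unfolding ee by (simp add: ip_diag usc_def n)
  then have "Re (ip f n (usc n v) (usc n v)) \<le> (norm (e (Suc ?k)))\<^sup>2 * Re (ip f (n + 1) v v)"
    using pf_mult_le[OF f, of "e (Suc ?k)" "e ?k * v"] False by (simp add: ip_diag)
  also have "\<dots> \<le> 1 * Re (ip f (n + 1) v v)"
    using norm_projection_le[of "e (Suc ?k)"] ip_pos[OF f]
    by (intro mult_right_mono) (auto simp: power_le_one)
  finally show ?thesis by simp
qed

lemma pc_bound:
  assumes f: "f \<in> positive_functionals"
  shows "Re (ip f n (pc a n v) (pc a n v)) \<le> (norm a)\<^sup>2 * Re (ip f n v v)"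
proof (cases "n \<ge> 0")
  case True
  then show ?thesis
    using pf_mult_le[OF pf_dsn[OF f], of "nat n" a v] by (simp add: ip_nonneg pc_def)
next
  case False
  let ?k = "nat (- n)"
  have "e ?k * ((\<delta> ^^ ?k) a * v) = (\<delta> ^^ ?k) a * (e ?k * v)"
    using e_dn[of ?k a] by (simp flip: mult.assoc)
  then have "Re (ip f n (pc a n v) (pc a n v)) \<le> (norm ((\<delta> ^^ ?k) a))\<^sup>2 * Re (ip f n v v)"
    using False pf_mult_le[OF f, of "(\<delta> ^^ ?k) a" "e ?k * v"] by (simp add: ip_diag pc_def)
  also have "\<dots> \<le> (norm a)\<^sup>2 * Re (ip f n v v)"
    using norm_dn_le ip_pos[OF f] by (intro mult_right_mono power_mono) auto
  finally show ?thesis .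
qed


subsection \<open>The covariance relations on representatives\<close>

definition null :: "('a \<Rightarrow> complex) \<Rightarrow> int \<Rightarrow> 'a \<Rightarrow> bool" where
  "null f n v \<longleftrightarrow> Re (ip f n v v) = 0"

lemma pc_mult: "pc (a * b) n v = pc a n (pc b n v)"
  by (simp add: pc_def dn_mult mult.assoc)

lemma pc_add: "pc (a + b) n v = pc a n v + pc b n v"
  by (simp add: pc_def dn_add distrib_right)

lemma pc_scaleC: "pc (c *\<^sub>C a) n v = c *\<^sub>C pc a n v"
  by (simp add: pc_def dn_scaleC mult_scaleC_left)

lemma pc_one_null: "f \<in> positive_functionals \<Longrightarrow> null f n (pc 1 n v - v)"
  by (cases "n \<ge> 0")
    (auto simp: null_def pc_def ip_diag algebra_simps pf_zero e_def[symmetric] ip_nonneg dsn_scaleC[of _ 0, simplified])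

text \<open>\<open>U \<pi>(a) U\<^sup>* = \<pi>(\<delta>(a))\<close> holds only up to null vectors: in positive degrees the left side
  multiplies by \<open>\<delta>(1)\<close> on the right, which the inner product does not see.\<close>

lemma uc_pc_usc_null:
  assumes f: "f \<in> positive_functionals"
  shows "null f n (uc n (pc a (n - 1) (usc (n - 1) v)) - pc (\<delta> a) n v)"
proof (cases "n > 0")
  case True
  let ?w = "\<delta> a * v"
  have "uc n (pc a (n - 1) (usc (n - 1) v)) = \<delta> (a * \<delta>s v)"
    using True by (simp add: uc_def pc_def usc_def)
  also have "\<dots> = \<delta> a * \<delta> 1 * v * \<delta> 1" by (simp add: delta_mult delta_ds mult.assoc)
  also have "\<dots> = ?w * \<delta> 1" by (simp flip: delta_mult)
  finally have eq: "uc n (pc a (n - 1) (usc (n - 1) v)) - pc (\<delta> a) n v = ?w * \<delta> 1 - ?w"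
    using True by (simp add: pc_def)
  have "\<delta>s (star (?w * \<delta> 1 - ?w) * (?w * \<delta> 1 - ?w)) = 0"
  proof -
    have "\<delta>s (x * (?w * \<delta> 1 - ?w)) = 0" for x
      using ds_cut(2)[of "x * ?w"] by (simp add: right_diff_distrib ds_diff mult.assoc)
    then show ?thesis .
  qed
  then show ?thesis
    using True unfolding null_def eq
    by (simp add: ip_nonneg dsn_Suc dsn_scaleC[of _ 0, simplified] pf_zero[OF f])
next
  case False
  let ?k = "nat (- n)"
  have "uc n (pc a (n - 1) (usc (n - 1) v)) = e (Suc ?k) * ((\<delta> ^^ Suc ?k) a * (e (Suc ?k) * v))"
    using False by (simp add: uc_def pc_def usc_def nat_minus_pred del: funpow.simps)
  also have "\<dots> = (\<delta> ^^ Suc ?k) a * v"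
    using e_dn[of "Suc ?k" a] by (metis mult.assoc)
  also have "\<dots> = pc (\<delta> a) n v"
    using False by (simp add: pc_nonpos funpow_swap1)
  finally have "uc n (pc a (n - 1) (usc (n - 1) v)) - pc (\<delta> a) n v = 0" by simp
  then show ?thesis by (simp add: null_def ip_nonneg ip_nonpos ip_add_left[OF f] ip_scale_left[OF f, of n 0 0, simplified])
qed

lemma usc_pc_uc: "usc n (pc a (n + 1) (uc (n + 1) v)) = pc (\<delta>s a) n v"
proof (cases "n \<ge> 0")
  case True
  then show ?thesis by (simp add: usc_def pc_def uc_def ds_delta_right)
next
  case False
  define k where "k = nat (- n - 1)"
  have n: "nat (- n) = Suc k" "n + 1 \<le> 0" using False by (auto simp: k_def)
  have "usc n (pc a (n + 1) (uc (n + 1) v)) = (e (Suc k) * (\<delta> ^^ k) a * e (Suc k)) * v"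
    using False n by (simp add: usc_def pc_nonpos uc_def mult.assoc flip: k_def)
  also have "e (Suc k) * (\<delta> ^^ k) a * e (Suc k) = (\<delta> ^^ k) (\<delta> 1 * a * \<delta> 1)"
    by (simp add: e_def dn_mult funpow_swap1)
  also have "\<dots> = (\<delta> ^^ Suc k) (\<delta>s a)" by (simp add: funpow_swap1 flip: delta_ds)
  finally show ?thesis using False by (simp add: pc_def n)
qed

lemma uc_pc: "uc n (pc a (n - 1) v) = pc (\<delta> a) n (uc n v)"
proof (cases "n > 0")
  case True
  then show ?thesis by (simp add: uc_def pc_def delta_mult)
next
  case False
  let ?k = "nat (- n)"
  have "uc n (pc a (n - 1) v) = e (Suc ?k) * ((\<delta> ^^ Suc ?k) a * v)"
    using False by (simp add: uc_def pc_def nat_minus_pred del: funpow.simps)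
  also have "\<dots> = (\<delta> ^^ Suc ?k) a * (e (Suc ?k) * v)"
    using e_dn[of "Suc ?k" a] by (metis mult.assoc)
  also have "\<dots> = pc (\<delta> a) n (uc n v)"
    using False by (simp add: pc_nonpos uc_def funpow_swap1)
  finally show ?thesis .
qed

end


section \<open>Completions of seminormed groups\<close>

locale seminormed =
  fixes p :: "'v::ab_group_add \<Rightarrow> real"
  assumes p_zero: "p 0 = 0" and p_minus: "p (- x) = p x" and p_triangle: "p (x + y) \<le> p x + p y"
begin

lemma p_nonneg: "0 \<le> p x"
  using p_triangle[of x "- x"] by (simp add: p_zero p_minus)

lemma p_diff_commute: "p (x - y) = p (y - x)"
  using p_minus[of "x - y"] by simp

lemma p_diff_triangle: "p (x - z) \<le> p (x - y) + p (y - z)"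
  using p_triangle[of "x - y" "y - z"] by simp

lemma p_diff_le: "p (x - y) \<le> p x + p y"
  using p_triangle[of x "- y"] by (simp add: p_minus)

lemma abs_p_diff: "\<bar>p x - p y\<bar> \<le> p (x - y)"
  using p_triangle[of "x - y" y] p_triangle[of "y - x" x] p_diff_commute[of x y] by simp

lemma p_add_diff: "p ((x + y) - (x' + y')) \<le> p (x - x') + p (y - y')"
  using p_triangle[of "x - x'" "y - y'"] by (simp add: algebra_simps)

definition equi :: "(nat \<Rightarrow> 'v) \<Rightarrow> (nat \<Rightarrow> 'v) \<Rightarrow> bool" where
  "equi X Y \<longleftrightarrow> (\<lambda>n. p (X n - Y n)) \<longlonglongrightarrow> 0"

lemma equi_refl [simp]: "equi X X"
  by (simp add: equi_def p_zero)

lemma equi_sym: "equi X Y \<Longrightarrow> equi Y X"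
  by (simp add: equi_def p_diff_commute)

lemma null_le: "a \<longlonglongrightarrow> 0 \<Longrightarrow> (\<And>n. p (X n) \<le> a n) \<Longrightarrow> (\<lambda>n. p (X n)) \<longlonglongrightarrow> 0"
  by (rule tendsto_sandwich[of "\<lambda>_. 0" _ _ a]) (auto simp: p_nonneg)

lemma equi_trans: "equi X Y \<Longrightarrow> equi Y Z \<Longrightarrow> equi X Z"
  unfolding equi_def
  by (rule null_le[where a = "\<lambda>n. p (X n - Y n) + p (Y n - Z n)"])
    (auto intro: tendsto_add_zero p_diff_triangle)

lemma cauchyD: "cauchy_wrt p X \<Longrightarrow> e > 0 \<Longrightarrow> \<exists>N. \<forall>m\<ge>N. \<forall>n\<ge>N. p (X m - X n) < e"
  by (simp add: cauchy_wrt_def)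

lemma cauchyI: "(\<And>e. e > 0 \<Longrightarrow> \<exists>N. \<forall>m\<ge>N. \<forall>n\<ge>N. p (X m - X n) < e) \<Longrightarrow> cauchy_wrt p X"
  by (simp add: cauchy_wrt_def)

lemma cauchy_const [simp]: "cauchy_wrt p (\<lambda>_. x)"
  by (simp add: cauchy_wrt_def p_zero)

lemma seq_class_eq_iff:
  assumes "cauchy_wrt p X" "cauchy_wrt p Y"
  shows "seq_class p X = seq_class p Y \<longleftrightarrow> equi X Y"
proof
  assume "seq_class p X = seq_class p Y"
  moreover have "Y \<in> seq_class p Y" using assms by (simp add: seq_class_def p_zero)
  ultimately have "Y \<in> seq_class p X" by simp
  then show "equi X Y" by (simp add: seq_class_def equi_def)
next
  assume "equi X Y"
  then have "equi X Z \<longleftrightarrow> equi Y Z" for Z using equi_sym equi_trans by blast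
  then show "seq_class p X = seq_class p Y" by (simp add: seq_class_def flip: equi_def)
qed

lemma seq_class_in: "cauchy_wrt p X \<Longrightarrow> seq_class p X \<in> completion p"
  by (auto simp: completion_def)

lemma rep_seq_class:
  assumes "cauchy_wrt p X"
  shows "cauchy_wrt p (rep_seq (seq_class p X))" "equi X (rep_seq (seq_class p X))"
proof -
  have "X \<in> seq_class p X" using assms by (simp add: seq_class_def p_zero)
  then have "rep_seq (seq_class p X) \<in> seq_class p X" unfolding rep_seq_def by (rule someI[where P = "\<lambda>Y. Y \<in> seq_class p X"])
  then show "cauchy_wrt p (rep_seq (seq_class p X))" "equi X (rep_seq (seq_class p X))"
    by (auto simp: seq_class_def equi_def)
qed

lemma rep_seq:
  assumes "C \<in> completion p"
  shows "cauchy_wrt p (rep_seq C)" "seq_class p (rep_seq C) = C"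
proof -
  obtain X where X: "cauchy_wrt p X" "C = seq_class p X" using assms by (auto simp: completion_def)
  then show "cauchy_wrt p (rep_seq C)" "seq_class p (rep_seq C) = C"
    using rep_seq_class[OF X(1)] seq_class_eq_iff[OF X(1)] by auto
qed

lemma embed_in: "embed p v \<in> completion p"
  by (simp add: embed_def seq_class_in)

lemma embed_eq_iff: "embed p v = embed p w \<longleftrightarrow> p (v - w) = 0"
  by (simp add: embed_def seq_class_eq_iff equi_def LIMSEQ_const_iff)

lemma cauchy_p_convergent: "cauchy_wrt p X \<Longrightarrow> convergent (\<lambda>n. p (X n))"
  unfolding Cauchy_convergent_iff[symmetric]
  by (rule metric_CauchyI) (metis abs_p_diff cauchyD dist_real_def order_le_less_trans)

lemma cauchy_bounded:
  assumes "cauchy_wrt p X"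
  obtains B where "B > 0" "\<And>n. p (X n) \<le> B"
proof -
  have "Bseq (\<lambda>n. p (X n))" using cauchy_p_convergent[OF assms] by (rule convergent_imp_Bseq)
  then show ?thesis using that by (auto simp: Bseq_def p_nonneg)
qed

lemma cauchy_add: "cauchy_wrt p X \<Longrightarrow> cauchy_wrt p Y \<Longrightarrow> cauchy_wrt p (\<lambda>n. X n + Y n)"
proof (rule cauchyI)
  fix e :: real assume X: "cauchy_wrt p X" and Y: "cauchy_wrt p Y" and e: "e > 0"
  obtain N where N: "\<And>m n. m \<ge> N \<Longrightarrow> n \<ge> N \<Longrightarrow> p (X m - X n) < e/2"
    using cauchyD[OF X, of "e/2"] e by auto
  obtain M where M: "\<And>m n. m \<ge> M \<Longrightarrow> n \<ge> M \<Longrightarrow> p (Y m - Y n) < e/2"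
    using cauchyD[OF Y, of "e/2"] e by auto
  have "p (X m + Y m - (X n + Y n)) < e" if "m \<ge> max N M" "n \<ge> max N M" for m n
    using p_add_diff[of "X m" "Y m" "X n" "Y n"] N[of m n] M[of m n] that by simp
  then show "\<exists>N. \<forall>m\<ge>N. \<forall>n\<ge>N. p (X m + Y m - (X n + Y n)) < e" by blast
qed

lemma equi_add: "equi X X' \<Longrightarrow> equi Y Y' \<Longrightarrow> equi (\<lambda>n. X n + Y n) (\<lambda>n. X' n + Y' n)"
  unfolding equi_def
  by (rule null_le[where a = "\<lambda>n. p (X n - X' n) + p (Y n - Y' n)"])
    (auto intro: tendsto_add_zero p_add_diff)

lemma lift2_add:
  assumes "cauchy_wrt p X" "cauchy_wrt p Y"
  shows "lift2 p (+) (seq_class p X) (seq_class p Y) = seq_class p (\<lambda>n. X n + Y n)"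
  unfolding lift2_def
  by (rule seq_class_eq_iff[THEN iffD2])
    (intro cauchy_add equi_add equi_sym[OF rep_seq_class(2)] rep_seq_class(1) assms)+

end

lemma seminormed_cauchy_map:
  assumes "seminormed p" "seminormed q" "\<And>x y. q (g x - g y) \<le> K * p (x - y)"
    and X: "cauchy_wrt p X"
  shows "cauchy_wrt q (\<lambda>n. g (X n))"
proof (rule seminormed.cauchyI[OF assms(2)])
  interpret p: seminormed p by fact
  interpret q: seminormed q by fact
  fix e :: real assume e: "e > 0"
  define K' where "K' = max K 1"
  have K'1: "K' > 0" and "K \<le> K'" by (auto simp: K'_def)
  have K'2: "q (g x - g y) \<le> K' * p (x - y)" for x y
    by (rule order_trans[OF assms(3) mult_right_mono[OF \<open>K \<le> K'\<close> p.p_nonneg]])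
  obtain N where N: "\<And>m n. m \<ge> N \<Longrightarrow> n \<ge> N \<Longrightarrow> p (X m - X n) < e / K'"
    using p.cauchyD[OF X, of "e / K'"] e K'1 by (meson divide_pos_pos)
  have "q (g (X m) - g (X n)) < e" if "m \<ge> N" "n \<ge> N" for m n
    using N[OF that] K'2[of "X m" "X n"] K'1 by (simp add: field_simps)
  then show "\<exists>N. \<forall>m\<ge>N. \<forall>n\<ge>N. q (g (X m) - g (X n)) < e" by blast
qed

lemma seminormed_equi_map:
  assumes "seminormed p" "seminormed q" "\<And>x y. q (g x - g y) \<le> K * p (x - y)"
    and X: "seminormed.equi p X Y"
  shows "seminormed.equi q (\<lambda>n. g (X n)) (\<lambda>n. g (Y n))"
proof -
  interpret p: seminormed p by fact
  interpret q: seminormed q by fact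
  show ?thesis
    unfolding q.equi_def
    by (rule q.null_le[where a = "\<lambda>n. K * p (X n - Y n)"])
      (use X in \<open>auto simp: p.equi_def intro: tendsto_mult_right_zero assms(3)\<close>)
qed

definition cmap :: "('w::ab_group_add \<Rightarrow> real) \<Rightarrow> ('v::ab_group_add \<Rightarrow> 'w) \<Rightarrow> (nat \<Rightarrow> 'v) set \<Rightarrow> (nat \<Rightarrow> 'w) set" where
  "cmap q g C = seq_class q (\<lambda>n. g (rep_seq C n))"

lemma lift1_eq_cmap: "lift1 p g = cmap p g"
  by (rule ext) (simp add: lift1_def cmap_def)

lemma cmap_class:
  assumes "seminormed p" "seminormed q" "\<And>x y. q (g x - g y) \<le> K * p (x - y)"
    and X: "cauchy_wrt p X"
  shows "cmap q g (seq_class p X) = seq_class q (\<lambda>n. g (X n))"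
proof -
  interpret p: seminormed p by fact
  interpret q: seminormed q by fact
  note rX = p.rep_seq_class[OF X]
  show ?thesis
    unfolding cmap_def
    by (subst q.seq_class_eq_iff)
      (auto intro: seminormed_cauchy_map[OF assms(1-3)] seminormed_equi_map[OF assms(1-3)] rX X p.equi_sym)
qed

lemma cmap_embed:
  assumes "seminormed p" "seminormed q" "\<And>x y. q (g x - g y) \<le> K * p (x - y)"
  shows "cmap q g (embed p v) = embed q (g v)"
  unfolding embed_def by (rule cmap_class[OF assms seminormed.cauchy_const[OF assms(1)]])


section \<open>Hilbert spaces\<close>

text \<open>The discriminant argument for the Cauchy--Schwarz inequality, separated from the spaces because it
  serves both for semi-inner products on a type and for inner products on a carrier set.\<close>

lemma discriminant_complex:
  assumes "\<And>z. 0 \<le> a + 2 * Re (z * c) + (cmod z)\<^sup>2 * b" and a: "a \<ge> 0"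
  shows "(cmod c)\<^sup>2 \<le> a * b"
proof (cases "b = 0")
  case True
  show ?thesis
  proof (rule ccontr)
    assume "\<not> (cmod c)\<^sup>2 \<le> a * b"
    then have c: "(cmod c)\<^sup>2 > 0" using True by simp
    have "0 \<le> a + 2 * Re (of_real (- (a + 1) / (cmod c)\<^sup>2) * cnj c * c)"
      using assms(1)[of "of_real (- (a + 1) / (cmod c)\<^sup>2) * cnj c"] True by simp
    also have "of_real (- (a + 1) / (cmod c)\<^sup>2) * cnj c * c = of_real (- (a + 1))"
      using c by (simp add: mult.assoc complex_norm_square[symmetric] mult.commute[of "cnj c"])
    finally show False using a by simp
  qed
next
  case False
  have b: "b > 0"
  proof (rule ccontr)
    assume "\<not> b > 0"
    then have b0: "b < 0" using False by simp
    define r where "r = sqrt ((a + 1) / - b)"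
    have r2: "r\<^sup>2 * b = - (a + 1)" using b0 a by (simp add: r_def field_simps)
    have "0 \<le> a + 2 * Re (of_real r * c) + r\<^sup>2 * b" "0 \<le> a + 2 * Re (of_real (- r) * c) + r\<^sup>2 * b"
      using assms(1)[of "of_real r"] assms(1)[of "of_real (- r)"] by simp_all
    then show False using r2 by simp
  qed
  have "0 \<le> a + 2 * Re (- of_real (1 / b) * cnj c * c) + (cmod (- of_real (1 / b) * cnj c))\<^sup>2 * b"
    by (rule assms(1))
  also have "- of_real (1 / b) * cnj c * c = of_real (- ((cmod c)\<^sup>2 / b))"
    by (simp add: mult.assoc complex_norm_square[symmetric] mult.commute[of "cnj c"])
  also have "(cmod (- of_real (1 / b) * cnj c))\<^sup>2 * b = (cmod c)\<^sup>2 / b"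
    using b by (simp add: norm_mult norm_divide power_mult_distrib power2_eq_square)
  finally have "(cmod c)\<^sup>2 / b \<le> a" by simp
  then show ?thesis using b by (simp add: field_simps)
qed

abbreviation hsub :: "'h hilbert \<Rightarrow> 'h \<Rightarrow> 'h \<Rightarrow> 'h" where
  "hsub H x y \<equiv> hplus H x (hscale H (- 1) y)"

text \<open>Vector space axioms need not be listed: by definiteness, vectors are equal if their inner products
  with all vectors agree (lemma \<open>ext\<close>), and this reduces their proofs to identities of complex numbers.\<close>

locale hilb =
  fixes H :: "'h hilbert"
  assumes nonempty: "hcarrier H \<noteq> {}"
    and plus_closed [simp, intro]: "x \<in> hcarrier H \<Longrightarrow> y \<in> hcarrier H \<Longrightarrow> hplus H x y \<in> hcarrier H"
    and scale_closed [simp, intro]: "x \<in> hcarrier H \<Longrightarrow> hscale H c x \<in> hcarrier H"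
    and inner_plus [simp]: "x \<in> hcarrier H \<Longrightarrow> y \<in> hcarrier H \<Longrightarrow> z \<in> hcarrier H \<Longrightarrow>
      hinner H (hplus H x y) z = hinner H x z + hinner H y z"
    and inner_scale [simp]: "x \<in> hcarrier H \<Longrightarrow> z \<in> hcarrier H \<Longrightarrow>
      hinner H (hscale H c x) z = c * hinner H x z"
    and inner_cnj: "x \<in> hcarrier H \<Longrightarrow> y \<in> hcarrier H \<Longrightarrow> hinner H y x = cnj (hinner H x y)"
    and inner_pos: "x \<in> hcarrier H \<Longrightarrow> 0 \<le> Re (hinner H x x)"
    and definite: "x \<in> hcarrier H \<Longrightarrow> y \<in> hcarrier H \<Longrightarrow> hnorm H (hsub H x y) = 0 \<Longrightarrow> x = y"
    and complete: "(\<And>n. X n \<in> hcarrier H) \<Longrightarrow>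
      (\<And>e. e > 0 \<Longrightarrow> \<exists>N. \<forall>m\<ge>N. \<forall>n\<ge>N. hnorm H (hsub H (X m) (X n)) < e) \<Longrightarrow>
      \<exists>x\<in>hcarrier H. (\<lambda>n. hnorm H (hsub H (X n) x)) \<longlonglongrightarrow> 0"
begin

lemma inner_plus_right [simp]:
  "x \<in> hcarrier H \<Longrightarrow> y \<in> hcarrier H \<Longrightarrow> z \<in> hcarrier H \<Longrightarrow>
    hinner H z (hplus H x y) = hinner H z x + hinner H z y"
  by (simp add: inner_cnj[of _ z])

lemma inner_scale_right [simp]:
  "x \<in> hcarrier H \<Longrightarrow> z \<in> hcarrier H \<Longrightarrow> hinner H z (hscale H c x) = cnj c * hinner H z x"
  by (simp add: inner_cnj[of _ z])

lemma inner_self: "x \<in> hcarrier H \<Longrightarrow> hinner H x x = of_real ((hnorm H x)\<^sup>2)"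
  using inner_cnj[of x x] inner_pos[of x] by (simp add: hnorm_def complex_eq_iff)

lemma hnorm_sq: "x \<in> hcarrier H \<Longrightarrow> (hnorm H x)\<^sup>2 = Re (hinner H x x)"
  using inner_pos[of x] by (simp add: hnorm_def)

lemma hnorm_nonneg [simp]: "x \<in> hcarrier H \<Longrightarrow> 0 \<le> hnorm H x"
  using inner_pos[of x] by (simp add: hnorm_def)

lemma ext:
  assumes "x \<in> hcarrier H" "y \<in> hcarrier H" "\<And>z. z \<in> hcarrier H \<Longrightarrow> hinner H x z = hinner H y z"
  shows "x = y"
proof (rule definite)
  have "hinner H (hsub H x y) (hsub H x y) = 0" using assms by simp
  then show "hnorm H (hsub H x y) = 0" by (simp add: hnorm_def)
qed (use assms in auto)

lemma hnorm_scale: "x \<in> hcarrier H \<Longrightarrow> hnorm H (hscale H c x) = cmod c * hnorm H x"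
proof -
  assume x: "x \<in> hcarrier H"
  have "hinner H (hscale H c x) (hscale H c x) = of_real ((cmod c)\<^sup>2 * (hnorm H x)\<^sup>2)"
    using x by (simp add: inner_self[OF x] complex_norm_square[symmetric] mult.commute[of "cnj c"] mult.assoc[symmetric])
  then show ?thesis using x by (simp add: hnorm_def[of H "hscale H c x"] real_sqrt_mult)
qed

lemma cauchy_schwarz:
  assumes x: "x \<in> hcarrier H" and y: "y \<in> hcarrier H"
  shows "cmod (hinner H x y) \<le> hnorm H x * hnorm H y"
proof -
  have "(cmod (hinner H y x))\<^sup>2 \<le> (hnorm H x)\<^sup>2 * (hnorm H y)\<^sup>2"
  proof (rule discriminant_complex)
    fix z
    have "0 \<le> Re (hinner H (hplus H x (hscale H z y)) (hplus H x (hscale H z y)))"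
      using x y by (intro inner_pos) auto
    also have "hinner H (hplus H x (hscale H z y)) (hplus H x (hscale H z y)) =
        of_real ((hnorm H x)\<^sup>2) + (z * hinner H y x + cnj (z * hinner H y x)) + z * cnj z * of_real ((hnorm H y)\<^sup>2)"
      using x y by (simp add: inner_self[OF x] inner_self[OF y] inner_cnj[OF y x] algebra_simps)
    also have "z * cnj z = of_real ((cmod z)\<^sup>2)" by (simp only: complex_norm_square)
    finally show "0 \<le> (hnorm H x)\<^sup>2 + 2 * Re (z * hinner H y x) + (cmod z)\<^sup>2 * (hnorm H y)\<^sup>2"
      by simp
  qed simp
  then have "(cmod (hinner H x y))\<^sup>2 \<le> (hnorm H x * hnorm H y)\<^sup>2"
    by (simp add: inner_cnj[OF y x] power_mult_distrib)
  then show ?thesis using x y by (rule_tac power2_le_imp_le) auto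
qed

lemma hnorm_triangle:
  assumes x: "x \<in> hcarrier H" and y: "y \<in> hcarrier H"
  shows "hnorm H (hplus H x y) \<le> hnorm H x + hnorm H y"
proof (rule power2_le_imp_le)
  have "Re (hinner H x y) \<le> hnorm H x * hnorm H y" "Re (hinner H y x) \<le> hnorm H x * hnorm H y"
    using cauchy_schwarz[OF x y] cauchy_schwarz[OF y x] complex_Re_le_cmod order_trans
    by (auto simp: mult.commute)
  then show "(hnorm H (hplus H x y))\<^sup>2 \<le> (hnorm H x + hnorm H y)\<^sup>2"
    using x y by (simp add: hnorm_sq power2_sum algebra_simps)
qed (use x y in simp)

definition hzero :: 'h where "hzero = hscale H 0 (SOME x. x \<in> hcarrier H)"

lemma hzero_in [simp, intro]: "hzero \<in> hcarrier H"
  unfolding hzero_def using nonempty some_in_eq by (metis scale_closed)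

lemma inner_hzero [simp]: "z \<in> hcarrier H \<Longrightarrow> hinner H hzero z = 0" "z \<in> hcarrier H \<Longrightarrow> hinner H z hzero = 0"
proof -
  assume z: "z \<in> hcarrier H"
  have "(SOME x. x \<in> hcarrier H) \<in> hcarrier H" using nonempty some_in_eq by metis
  then show *: "hinner H hzero z = 0" using z by (simp add: hzero_def)
  show "hinner H z hzero = 0" using inner_cnj[of hzero z] z * by simp
qed

lemma hnorm_hzero [simp]: "hnorm H hzero = 0"
  by (simp add: hnorm_def)

lemma plus_hzero [simp]: "x \<in> hcarrier H \<Longrightarrow> hplus H x hzero = x" "x \<in> hcarrier H \<Longrightarrow> hplus H hzero x = x"
  by (auto intro!: ext)

lemma scale_zero [simp]: "x \<in> hcarrier H \<Longrightarrow> hscale H 0 x = hzero"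
  by (auto intro!: ext)

lemma scale_hzero [simp]: "hscale H c hzero = hzero"
  by (auto intro!: ext)

lemma scale_one [simp]: "x \<in> hcarrier H \<Longrightarrow> hscale H 1 x = x"
  by (auto intro!: ext)

lemma hnorm_eq_0: "x \<in> hcarrier H \<Longrightarrow> hnorm H x = 0 \<Longrightarrow> x = hzero"
  by (rule definite) (auto simp: hnorm_def)

lemma hsub_triangle:
  assumes "x \<in> hcarrier H" "y \<in> hcarrier H" "z \<in> hcarrier H"
  shows "hnorm H (hsub H x z) \<le> hnorm H (hsub H x y) + hnorm H (hsub H y z)"
proof -
  have "hsub H x z = hplus H (hsub H x y) (hsub H y z)" using assms by (auto intro!: ext)
  then show ?thesis using assms by (simp add: hnorm_triangle)
qed

lemma hsub_commute:
  assumes "x \<in> hcarrier H" "y \<in> hcarrier H"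
  shows "hnorm H (hsub H x y) = hnorm H (hsub H y x)"
proof -
  have "hsub H x y = hscale H (- 1) (hsub H y x)" using assms by (auto intro!: ext)
  then show ?thesis using assms by (simp add: hnorm_scale)
qed

lemma hsub_self [simp]: "x \<in> hcarrier H \<Longrightarrow> hsub H x x = hzero"
  by (auto intro!: ext)

lemma abs_hnorm_diff:
  assumes "x \<in> hcarrier H" "y \<in> hcarrier H"
  shows "\<bar>hnorm H x - hnorm H y\<bar> \<le> hnorm H (hsub H x y)"
proof -
  have "x = hplus H (hsub H x y) y" "y = hplus H (hsub H y x) x" using assms by (auto intro!: ext)
  then have "hnorm H x \<le> hnorm H (hsub H x y) + hnorm H y" "hnorm H y \<le> hnorm H (hsub H y x) + hnorm H x"
    using hnorm_triangle[of "hsub H x y" y] hnorm_triangle[of "hsub H y x" x] assms by auto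
  then show ?thesis using hsub_commute[OF assms] by simp
qed

definition conv :: "(nat \<Rightarrow> 'h) \<Rightarrow> 'h \<Rightarrow> bool" where
  "conv X x \<longleftrightarrow> (\<forall>n. X n \<in> hcarrier H) \<and> x \<in> hcarrier H \<and> (\<lambda>n. hnorm H (hsub H (X n) x)) \<longlonglongrightarrow> 0"

lemma conv_inner:
  assumes "conv X x" "z \<in> hcarrier H"
  shows "(\<lambda>n. hinner H (X n) z) \<longlonglongrightarrow> hinner H x z"
proof (rule LIM_zero_cancel, rule Lim_null_comparison)
  show "\<forall>\<^sub>F n in sequentially. norm (hinner H (X n) z - hinner H x z) \<le> hnorm H (hsub H (X n) x) * hnorm H z"
    using assms cauchy_schwarz[of "hsub H (X _) x" z] by (auto simp: conv_def)
  show "(\<lambda>n. hnorm H (hsub H (X n) x) * hnorm H z) \<longlonglongrightarrow> 0"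
    using assms by (auto simp: conv_def intro: tendsto_mult_left_zero)
qed

lemma conv_unique:
  assumes "conv X x" "conv X y"
  shows "x = y"
proof (rule ext)
  show "x \<in> hcarrier H" "y \<in> hcarrier H" using assms by (auto simp: conv_def)
  fix z assume "z \<in> hcarrier H"
  then show "hinner H x z = hinner H y z"
    using LIMSEQ_unique[OF conv_inner[OF assms(1)] conv_inner[OF assms(2)]] by blast
qed

lemma conv_hnorm: "conv X x \<Longrightarrow> (\<lambda>n. hnorm H (X n)) \<longlonglongrightarrow> hnorm H x"
proof (rule LIM_zero_cancel, rule Lim_null_comparison)
  assume "conv X x"
  then show "(\<lambda>n. hnorm H (hsub H (X n) x)) \<longlonglongrightarrow> 0"
    "\<forall>\<^sub>F n in sequentially. norm (hnorm H (X n) - hnorm H x) \<le> hnorm H (hsub H (X n) x)"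
    using abs_hnorm_diff by (auto simp: conv_def)
qed

end


subsection \<open>Bounded maps\<close>

definition bdd_map :: "'g hilbert \<Rightarrow> 'h hilbert \<Rightarrow> real \<Rightarrow> ('g \<Rightarrow> 'h) \<Rightarrow> bool" where
  "bdd_map G H K T \<longleftrightarrow> T \<in> hcarrier G \<rightarrow> hcarrier H \<and>
     (\<forall>x\<in>hcarrier G. \<forall>y\<in>hcarrier G. T (hplus G x y) = hplus H (T x) (T y)) \<and>
     (\<forall>c. \<forall>x\<in>hcarrier G. T (hscale G c x) = hscale H c (T x)) \<and>
     (\<forall>x\<in>hcarrier G. hnorm H (T x) \<le> K * hnorm G x)"

lemma bounded_ops_iff: "T \<in> bounded_ops H \<longleftrightarrow> T \<in> extensional (hcarrier H) \<and> (\<exists>K. bdd_map H H K T)"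
  by (auto simp: bounded_ops_def bdd_map_def PiE_def)

lemma bdd_mapD:
  assumes "bdd_map G H K T" "x \<in> hcarrier G"
  shows "T x \<in> hcarrier H" "hnorm H (T x) \<le> K * hnorm G x" "T (hscale G c x) = hscale H c (T x)"
    "y \<in> hcarrier G \<Longrightarrow> T (hplus G x y) = hplus H (T x) (T y)"
  using assms by (auto simp: bdd_map_def)

lemma bdd_map_cong: "(\<And>x. x \<in> hcarrier G \<Longrightarrow> S x = T x) \<Longrightarrow> hilb G \<Longrightarrow> bdd_map G H K S \<longleftrightarrow> bdd_map G H K T"
  by (auto simp: bdd_map_def hilb.plus_closed hilb.scale_closed Pi_def)

lemma bounded_ops_bound:
  assumes "hilb H" "T \<in> bounded_ops H"
  obtains K where "K \<ge> 0" "bdd_map H H K T"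
proof -
  interpret hilb H by fact
  obtain K where K: "bdd_map H H K T" using assms by (auto simp: bounded_ops_iff)
  have "hnorm H (T x) \<le> \<bar>K\<bar> * hnorm H x" if "x \<in> hcarrier H" for x
    using bdd_mapD(2)[OF K that] mult_right_mono[OF abs_ge_self[of K] hnorm_nonneg[OF that]] by linarith
  then show ?thesis using that[of "\<bar>K\<bar>"] K by (simp add: bdd_map_def)
qed

context hilb
begin

lemma bounded_opsD:
  assumes "T \<in> bounded_ops H"
  shows "x \<in> hcarrier H \<Longrightarrow> T x \<in> hcarrier H"
    "x \<in> hcarrier H \<Longrightarrow> y \<in> hcarrier H \<Longrightarrow> T (hplus H x y) = hplus H (T x) (T y)"
    "x \<in> hcarrier H \<Longrightarrow> T (hscale H c x) = hscale H c (T x)"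
  using assms by (auto simp: bounded_ops_def)

lemma conv_bdd:
  assumes "bdd_map H G K T" "hilb G" "conv X x"
  shows "hilb.conv G (\<lambda>n. T (X n)) (T x)"
proof -
  interpret G: hilb G by fact
  have X: "X n \<in> hcarrier H" "x \<in> hcarrier H" for n using assms(3) by (auto simp: conv_def)
  have eq: "hsub G (T (X n)) (T x) = T (hsub H (X n) x)" for n
    using X assms(1) by (auto simp: bdd_map_def)
  have "hnorm G (hsub G (T (X n)) (T x)) \<le> K * hnorm H (hsub H (X n) x)" for n
    unfolding eq using X by (intro bdd_mapD(2)[OF assms(1)]) auto
  then have "norm (hnorm G (hsub G (T (X n)) (T x))) \<le> K * hnorm H (hsub H (X n) x)" for n
    using X bdd_mapD(1)[OF assms(1)] by simp
  moreover have "(\<lambda>n. hnorm H (hsub H (X n) x)) \<longlonglongrightarrow> 0"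
    using assms(3) unfolding conv_def by (elim conjE)
  ultimately have "(\<lambda>n. hnorm G (hsub G (T (X n)) (T x))) \<longlonglongrightarrow> 0"
    by (rule Lim_null_comparison[OF always_eventually[OF allI] tendsto_mult_right_zero])
  then show ?thesis
    using X bdd_mapD(1)[OF assms(1)] by (simp add: G.conv_def)
qed

text \<open>Identities between bounded operators, and adjointness, need only be checked on a total set.\<close>

definition total :: "'h set \<Rightarrow> bool" where
  "total D \<longleftrightarrow> D \<subseteq> hcarrier H \<and> (\<forall>M. closed_subspace H M \<and> D \<subseteq> M \<longrightarrow> M = hcarrier H)"

lemma closed_subspaceI:
  assumes "M \<subseteq> hcarrier H" "hzero \<in> M" "\<And>x y. x \<in> M \<Longrightarrow> y \<in> M \<Longrightarrow> hplus H x y \<in> M"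
    "\<And>c x. x \<in> M \<Longrightarrow> hscale H c x \<in> M" "\<And>X x. (\<And>n. X n \<in> M) \<Longrightarrow> conv X x \<Longrightarrow> x \<in> M"
  shows "closed_subspace H M"
  unfolding closed_subspace_def
proof (intro conjI)
  show "\<forall>X. \<forall>x\<in>hcarrier H. (\<forall>n. X n \<in> M) \<and> (\<lambda>n. hnorm H (hsub H (X n) x)) \<longlonglongrightarrow> 0 \<longrightarrow> x \<in> M"
    using assms(1,5) unfolding conv_def by blast
qed (use assms(1-4) in auto)

lemma total_induct:
  assumes "total D" "x \<in> hcarrier H"
    and "\<And>d. d \<in> D \<Longrightarrow> P d" "P hzero"
    and "\<And>x y. x \<in> hcarrier H \<Longrightarrow> y \<in> hcarrier H \<Longrightarrow> P x \<Longrightarrow> P y \<Longrightarrow> P (hplus H x y)"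
    and "\<And>c x. x \<in> hcarrier H \<Longrightarrow> P x \<Longrightarrow> P (hscale H c x)"
    and "\<And>X x. (\<And>n. P (X n)) \<Longrightarrow> conv X x \<Longrightarrow> P x"
  shows "P x"
proof -
  have "closed_subspace H {x \<in> hcarrier H. P x}"
  proof (rule closed_subspaceI)
    fix X x assume "\<And>n. X n \<in> {x \<in> hcarrier H. P x}" "conv X x"
    then show "x \<in> {x \<in> hcarrier H. P x}" using assms(7)[of X x] by (simp add: conv_def)
  qed (use assms(4-6) in auto)
  then have "{x \<in> hcarrier H. P x} = hcarrier H"
    using assms(1,3) unfolding total_def by blast
  then show ?thesis using assms(2) by blast
qed

lemma bdd_hzero: "bdd_map H G K T \<Longrightarrow> hilb G \<Longrightarrow> T hzero = hilb.hzero G"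
  by (metis bdd_mapD(1,3) hilb.scale_zero hzero_in scale_zero)

lemma bdd_map_eqI:
  assumes "bdd_map H G K S" "bdd_map H G L T" "hilb G" "total D" "\<And>d. d \<in> D \<Longrightarrow> S d = T d" "x \<in> hcarrier H"
  shows "S x = T x"
  using assms(4,6)
proof (rule total_induct)
  show "S hzero = T hzero" using assms bdd_hzero by metis
next
  fix X x assume "\<And>n. S (X n) = T (X n)" "conv X x"
  then show "S x = T x"
    using conv_bdd[OF assms(1,3), of X x] conv_bdd[OF assms(2,3), of X x] hilb.conv_unique[OF assms(3)]
    by auto
qed (use assms in \<open>auto simp: bdd_map_def\<close>)

lemma bounded_ops_eqI:
  assumes "S \<in> bounded_ops H" "T \<in> bounded_ops H" "total D" "\<And>d. d \<in> D \<Longrightarrow> S d = T d"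
  shows "S = T"
proof (rule extensionalityI[of _ "hcarrier H"])
  fix x assume "x \<in> hcarrier H"
  then show "S x = T x"
    using assms bdd_map_eqI[OF _ _ hilb_axioms assms(3)] unfolding bounded_ops_iff by blast
qed (use assms in \<open>auto simp: bounded_ops_iff\<close>)

lemma mutually_adjointI:
  assumes S: "S \<in> bounded_ops H" and T: "T \<in> bounded_ops H" and D: "total D"
    and eq: "\<And>x y. x \<in> D \<Longrightarrow> y \<in> D \<Longrightarrow> hinner H (S x) y = hinner H x (T y)"
  shows "mutually_adjoint H S T"
proof -
  obtain K L where K: "bdd_map H H K S" and L: "bdd_map H H L T" using S T by (auto simp: bounded_ops_iff)
  note cS = conv_bdd[OF K hilb_axioms] and cT = conv_bdd[OF L hilb_axioms]
  have zS: "S hzero = hzero" and zT: "T hzero = hzero"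
    using bdd_hzero[OF K hilb_axioms] bdd_hzero[OF L hilb_axioms] by auto
  have 1: "hinner H (S x) y = hinner H x (T y)" if y: "y \<in> D" and x: "x \<in> hcarrier H" for x y
    using D x
  proof (rule total_induct)
    have yH: "y \<in> hcarrier H" using y D by (auto simp: total_def)
    note [simp] = yH bounded_opsD[OF S] bounded_opsD[OF T] zS
    show "hinner H (S hzero) y = hinner H hzero (T y)" by simp
    fix X x assume "\<And>n. hinner H (S (X n)) y = hinner H (X n) (T y)" "conv X x"
    then show "hinner H (S x) y = hinner H x (T y)"
      using conv_inner[OF cS[of X x], of y] conv_inner[of X x "T y"] LIMSEQ_unique by auto
  qed (use y D eq bounded_opsD[OF S] bounded_opsD[OF T] in \<open>auto simp: total_def subset_iff\<close>)
  have 2: "hinner H (T y) x = hinner H y (S x)" if x: "x \<in> hcarrier H" and y: "y \<in> hcarrier H" for x y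
    using D y
  proof (rule total_induct)
    note [simp] = x bounded_opsD[OF S] bounded_opsD[OF T] zT
    show "hinner H (T hzero) x = hinner H hzero (S x)" by simp
    fix X y assume "\<And>n. hinner H (T (X n)) x = hinner H (X n) (S x)" "conv X y"
    then show "hinner H (T y) x = hinner H y (S x)"
      using conv_inner[OF cT[of X y], of x] conv_inner[of X y "S x"] LIMSEQ_unique by auto
  next
    fix y assume y: "y \<in> D"
    then have "y \<in> hcarrier H" using D by (auto simp: total_def)
    then show "hinner H (T y) x = hinner H y (S x)"
      using 1[OF y x] x inner_cnj[of x "T y"] inner_cnj[of "S x" y] bounded_opsD[OF S] bounded_opsD[OF T] by auto
  qed (use x bounded_opsD[OF S] bounded_opsD[OF T] in auto)
  show ?thesis
    unfolding mutually_adjoint_def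
  proof (intro ballI)
    fix x y assume xy: "x \<in> hcarrier H" "y \<in> hcarrier H"
    then show "hinner H (S x) y = hinner H x (T y)"
      using 2[OF xy] inner_cnj[of x "T y"] inner_cnj[of "S x" y] bounded_opsD[OF S] bounded_opsD[OF T]
      by (metis complex_cnj_cnj)
  qed
qed

end


lemma (in hilb) closed_subspaceD:
  assumes "closed_subspace H M"
  shows "M \<subseteq> hcarrier H" "M \<noteq> {}" "x \<in> M \<Longrightarrow> y \<in> M \<Longrightarrow> hplus H x y \<in> M"
    "x \<in> M \<Longrightarrow> hscale H c x \<in> M" "(\<And>n. X n \<in> M) \<Longrightarrow> conv X x \<Longrightarrow> x \<in> M"
proof -
  show "M \<subseteq> hcarrier H" "M \<noteq> {}" "x \<in> M \<Longrightarrow> y \<in> M \<Longrightarrow> hplus H x y \<in> M" "x \<in> M \<Longrightarrow> hscale H c x \<in> M"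
    using assms unfolding closed_subspace_def by blast+
  have "\<forall>X. \<forall>x\<in>hcarrier H. (\<forall>n. X n \<in> M) \<and> (\<lambda>n. hnorm H (hsub H (X n) x)) \<longlonglongrightarrow> 0 \<longrightarrow> x \<in> M"
    using assms unfolding closed_subspace_def by (elim conjE)
  then have "\<forall>x\<in>hcarrier H. (\<forall>n. X n \<in> M) \<and> (\<lambda>n. hnorm H (hsub H (X n) x)) \<longlonglongrightarrow> 0 \<longrightarrow> x \<in> M"
    by (rule spec)
  then show "(\<And>n. X n \<in> M) \<Longrightarrow> conv X x \<Longrightarrow> x \<in> M"
    unfolding conv_def by blast
qed


subsection \<open>The Hilbert space generated by a semi-inner product\<close>

locale semi_inner =
  fixes ip :: "'v::unital_cstar_algebra \<Rightarrow> 'v \<Rightarrow> complex"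
  assumes ip_add_left: "ip (v + w) u = ip v u + ip w u"
    and ip_scale_left: "ip (c *\<^sub>C v) u = c * ip v u"
    and ip_cnj: "ip u v = cnj (ip v u)"
    and ip_pos: "0 \<le> Re (ip v v)"
begin

abbreviation P where "P \<equiv> inner_seminorm ip"

lemma ip_add_right: "ip u (v + w) = ip u v + ip u w"
  using ip_add_left[of v w u] ip_cnj[of u "v + w"] ip_cnj[of u v] ip_cnj[of u w] by simp

lemma ip_scale_right: "ip u (c *\<^sub>C v) = cnj c * ip u v"
  using ip_scale_left[of c v u] ip_cnj[of u "c *\<^sub>C v"] ip_cnj[of u v] by simp

lemma ip_diff_left: "ip (v - w) u = ip v u - ip w u"
  using ip_add_left[of v "(- 1) *\<^sub>C w" u] ip_scale_left[of "- 1" w u] by (simp add: scaleC_minus_left)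

lemma ip_diff_right: "ip u (v - w) = ip u v - ip u w"
  using ip_add_right[of u v "(- 1) *\<^sub>C w"] ip_scale_right[of u "- 1" w] by (simp add: scaleC_minus_left)

lemma P_sq: "(P v)\<^sup>2 = Re (ip v v)"
  using ip_pos[of v] by (simp add: inner_seminorm_def)

lemma P_nonneg: "0 \<le> P v"
  using ip_pos[of v] by (simp add: inner_seminorm_def)

lemma ip_self: "ip v v = of_real ((P v)\<^sup>2)"
  using ip_cnj[of v v] by (simp add: complex_eq_iff P_sq del: of_real_power)

lemma ip_cauchy_schwarz: "cmod (ip v u) \<le> P v * P u"
proof -
  have "(cmod (ip u v))\<^sup>2 \<le> (P v)\<^sup>2 * (P u)\<^sup>2"
  proof (rule discriminant_complex)
    fix z
    have "0 \<le> Re (ip (v + z *\<^sub>C u) (v + z *\<^sub>C u))" by (rule ip_pos)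
    also have "ip (v + z *\<^sub>C u) (v + z *\<^sub>C u) =
        of_real ((P v)\<^sup>2) + (z * ip u v + cnj (z * ip u v)) + z * cnj z * of_real ((P u)\<^sup>2)"
      by (simp add: ip_self[symmetric] ip_add_left ip_add_right ip_scale_left ip_scale_right
          ip_cnj[of v u] algebra_simps del: of_real_power)
    also have "z * cnj z = of_real ((cmod z)\<^sup>2)" by (simp only: complex_norm_square)
    finally show "0 \<le> (P v)\<^sup>2 + 2 * Re (z * ip u v) + (cmod z)\<^sup>2 * (P u)\<^sup>2" by simp
  qed simp
  then have "(cmod (ip v u))\<^sup>2 \<le> (P v * P u)\<^sup>2"
    by (simp add: ip_cnj[of v u] power_mult_distrib)
  then show ?thesis by (rule power2_le_imp_le) (simp add: P_nonneg)
qed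

lemma P_scale: "P (c *\<^sub>C v) = cmod c * P v"
proof -
  have "Re (ip (c *\<^sub>C v) (c *\<^sub>C v)) = (cmod c)\<^sup>2 * Re (ip v v)"
  proof -
    have "ip (c *\<^sub>C v) (c *\<^sub>C v) = of_real ((cmod c)\<^sup>2) * ip v v"
      unfolding complex_norm_square by (simp add: ip_scale_left ip_scale_right)
    then show ?thesis by simp
  qed
  then show ?thesis by (simp add: inner_seminorm_def real_sqrt_mult)
qed

sublocale seminormed P
proof
  show "P 0 = 0" using P_scale[of 0 0] by simp
  show "P (- x) = P x" for x using P_scale[of "- 1" x] by (simp add: scaleC_minus_left)
  show "P (x + y) \<le> P x + P y" for x y
  proof (rule power2_le_imp_le)
    have "Re (ip x y) \<le> P x * P y" "Re (ip y x) \<le> P x * P y"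
      using ip_cauchy_schwarz[of x y] ip_cauchy_schwarz[of y x] complex_Re_le_cmod[of "ip x y"]
        complex_Re_le_cmod[of "ip y x"] by (simp_all add: mult.commute)
    then show "(P (x + y))\<^sup>2 \<le> (P x + P y)\<^sup>2"
      by (simp add: P_sq ip_add_left ip_add_right power2_sum)
  qed (simp add: P_nonneg)
qed

abbreviation G where "G \<equiv> hilbert_generated ip"

lemma carrier_G: "hcarrier G = completion P"
  by (simp add: hilbert_generated_def)

lemma plus_class:
  "cauchy_wrt P X \<Longrightarrow> cauchy_wrt P Y \<Longrightarrow> hplus G (seq_class P X) (seq_class P Y) = seq_class P (\<lambda>n. X n + Y n)"
  by (simp add: hilbert_generated_def lift2_add)

lemma scale_lipschitz: "P (c *\<^sub>C x - c *\<^sub>C y) \<le> cmod c * P (x - y)"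
  by (simp add: P_scale flip: scaleC_diff_right)

lemma scale_class:
  "cauchy_wrt P X \<Longrightarrow> hscale G c (seq_class P X) = seq_class P (\<lambda>n. c *\<^sub>C X n)"
  using cmap_class[OF seminormed_axioms seminormed_axioms scale_lipschitz]
  by (simp add: hilbert_generated_def lift1_eq_cmap)

lemma cauchy_scale: "cauchy_wrt P X \<Longrightarrow> cauchy_wrt P (\<lambda>n. c *\<^sub>C X n)"
  by (rule seminormed_cauchy_map[OF seminormed_axioms seminormed_axioms scale_lipschitz])

lemma ip_diff_le:
  "cmod (ip x y - ip x' y') \<le> P (x - x') * P y + P x' * P (y - y')"
proof -
  have "ip x y - ip x' y' = ip (x - x') y + ip x' (y - y')" by (simp add: ip_diff_left ip_diff_right)
  then show ?thesis
    using norm_triangle_ineq[of "ip (x - x') y" "ip x' (y - y')"]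
      ip_cauchy_schwarz[of "x - x'" y] ip_cauchy_schwarz[of x' "y - y'"] by simp
qed

lemma cauchy_ip_convergent:
  assumes X: "cauchy_wrt P X" and Y: "cauchy_wrt P Y"
  shows "convergent (\<lambda>n. ip (X n) (Y n))"
  unfolding Cauchy_convergent_iff[symmetric]
proof (rule metric_CauchyI)
  fix e :: real assume e: "e > 0"
  obtain A where A: "A > 0" "\<And>n. P (X n) \<le> A" using cauchy_bounded[OF X] by blast
  obtain B where B: "B > 0" "\<And>n. P (Y n) \<le> B" using cauchy_bounded[OF Y] by blast
  obtain N where N: "\<And>m n. m \<ge> N \<Longrightarrow> n \<ge> N \<Longrightarrow> P (X m - X n) < e / (2 * B)"
    using cauchyD[OF X, of "e / (2 * B)"] e B(1) by (metis divide_pos_pos mult_pos_pos zero_less_numeral)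
  obtain M where M: "\<And>m n. m \<ge> M \<Longrightarrow> n \<ge> M \<Longrightarrow> P (Y m - Y n) < e / (2 * A)"
    using cauchyD[OF Y, of "e / (2 * A)"] e A(1) by (metis divide_pos_pos mult_pos_pos zero_less_numeral)
  have "dist (ip (X m) (Y m)) (ip (X n) (Y n)) < e" if "m \<ge> max N M" "n \<ge> max N M" for m n
  proof -
    have "P (X m - X n) * P (Y m) \<le> P (X m - X n) * B" "P (X n) * P (Y m - Y n) \<le> A * P (Y m - Y n)"
      using A(2) B(2) P_nonneg by (auto intro: mult_left_mono mult_right_mono)
    moreover have "P (X m - X n) * B < e / 2" "A * P (Y m - Y n) < e / 2"
      using N[of m n] M[of m n] that A(1) B(1) by (auto simp: field_simps)
    ultimately show ?thesis
      using ip_diff_le[of "X m" "Y m" "X n" "Y n"] by (simp add: dist_norm)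
  qed
  then show "\<exists>M. \<forall>m\<ge>M. \<forall>n\<ge>M. dist (ip (X m) (Y m)) (ip (X n) (Y n)) < e" by blast
qed

lemma equi_ip:
  assumes Y: "cauchy_wrt P Y" and X': "cauchy_wrt P X'" and "equi X X'" "equi Y Y'"
  shows "(\<lambda>n. ip (X n) (Y n) - ip (X' n) (Y' n)) \<longlonglongrightarrow> 0"
proof -
  obtain A where A: "\<And>n. P (X' n) \<le> A" using cauchy_bounded[OF X'] by blast
  obtain B where B: "\<And>n. P (Y n) \<le> B" using cauchy_bounded[OF Y] by blast
  have "cmod (ip (X n) (Y n) - ip (X' n) (Y' n)) \<le> P (X n - X' n) * B + A * P (Y n - Y' n)" for n
    using ip_diff_le[of "X n" "Y n" "X' n" "Y' n"] mult_left_mono[OF B[of n] P_nonneg[of "X n - X' n"]]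
      mult_right_mono[OF A[of n] P_nonneg[of "Y n - Y' n"]] by linarith
  moreover have "(\<lambda>n. P (X n - X' n) * B + A * P (Y n - Y' n)) \<longlonglongrightarrow> 0"
    using assms(3,4) unfolding equi_def
    by (intro tendsto_add_zero tendsto_mult_left_zero tendsto_mult_right_zero)
  ultimately show ?thesis by (rule Lim_null_comparison[OF always_eventually[OF allI]])
qed

lemma inner_class:
  assumes X: "cauchy_wrt P X" and Y: "cauchy_wrt P Y"
  shows "(\<lambda>n. ip (X n) (Y n)) \<longlonglongrightarrow> hinner G (seq_class P X) (seq_class P Y)"
proof -
  let ?X = "rep_seq (seq_class P X)" and ?Y = "rep_seq (seq_class P Y)"
  note rX = rep_seq_class[OF X] and rY = rep_seq_class[OF Y]
  have "(\<lambda>n. ip (?X n) (?Y n)) \<longlonglongrightarrow> hinner G (seq_class P X) (seq_class P Y)"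
    using cauchy_ip_convergent[OF rX(1) rY(1)] by (simp add: hilbert_generated_def convergent_LIMSEQ_iff)
  moreover have "(\<lambda>n. ip (X n) (Y n) - ip (?X n) (?Y n)) \<longlonglongrightarrow> 0"
    by (rule equi_ip[OF Y rX(1) rX(2) rY(2)])
  ultimately show ?thesis by (rule Lim_transform)
qed

lemma hnorm_class: "cauchy_wrt P X \<Longrightarrow> (\<lambda>n. P (X n)) \<longlonglongrightarrow> hnorm G (seq_class P X)"
  using tendsto_real_sqrt[OF tendsto_Re[OF inner_class[of X X]]]
  by (simp add: hnorm_def inner_seminorm_def)

lemma inner_embed: "hinner G (embed P v) (embed P u) = ip v u"
  using inner_class[of "\<lambda>_. v" "\<lambda>_. u"] by (simp add: embed_def LIMSEQ_const_iff)

lemma hnorm_embed: "hnorm G (embed P v) = P v"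
  by (simp add: hnorm_def inner_embed inner_seminorm_def)

lemma plus_embed: "hplus G (embed P v) (embed P u) = embed P (v + u)"
  by (simp add: embed_def plus_class)

lemma scale_embed: "hscale G c (embed P v) = embed P (c *\<^sub>C v)"
  by (simp add: embed_def scale_class)

lemma sub_class:
  "cauchy_wrt P X \<Longrightarrow> cauchy_wrt P Y \<Longrightarrow> hsub G (seq_class P X) (seq_class P Y) = seq_class P (\<lambda>n. X n - Y n)"
  using plus_class[of X "\<lambda>n. (- 1) *\<^sub>C Y n"] cauchy_scale[of Y "- 1"]
  by (simp add: scale_class scaleC_minus_left)

lemma cauchy_diff: "cauchy_wrt P X \<Longrightarrow> cauchy_wrt P Y \<Longrightarrow> cauchy_wrt P (\<lambda>n. X n - Y n)"
  using cauchy_add[of X "\<lambda>n. (- 1) *\<^sub>C Y n"] cauchy_scale[of Y "- 1"] by (simp add: scaleC_minus_left)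

lemma completion_cases:
  assumes "C \<in> hcarrier G"
  obtains X where "cauchy_wrt P X" "C = seq_class P X"
  using assms by (auto simp: carrier_G completion_def)

lemma class_limit:
  assumes X: "cauchy_wrt P X"
  shows "(\<lambda>k. hnorm G (hsub G (embed P (X k)) (seq_class P X))) \<longlonglongrightarrow> 0"
proof (rule LIMSEQ_I)
  fix r :: real assume r: "r > 0"
  obtain N where N: "\<And>m n. m \<ge> N \<Longrightarrow> n \<ge> N \<Longrightarrow> P (X m - X n) < r / 2"
    using cauchyD[OF X, of "r / 2"] r by auto
  have "norm (hnorm G (hsub G (embed P (X k)) (seq_class P X)) - 0) < r" if k: "k \<ge> N" for k
  proof -
    have c: "cauchy_wrt P (\<lambda>n. X k - X n)" by (rule cauchy_diff) (simp_all add: X)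
    have eq: "hsub G (embed P (X k)) (seq_class P X) = seq_class P (\<lambda>n. X k - X n)"
      unfolding embed_def by (rule sub_class) (simp_all add: X)
    have "hnorm G (seq_class P (\<lambda>n. X k - X n)) \<le> r / 2"
    proof (rule LIMSEQ_le_const2[OF hnorm_class[OF c]])
      show "\<exists>M. \<forall>n\<ge>M. P (X k - X n) \<le> r / 2" using N[OF k] less_imp_le by blast
    qed
    moreover have "0 \<le> hnorm G (seq_class P (\<lambda>n. X k - X n))"
      by (rule LIMSEQ_le_const[OF hnorm_class[OF c]]) (simp add: P_nonneg)
    ultimately show ?thesis using r by (simp add: eq)
  qed
  then show "\<exists>no. \<forall>n\<ge>no. norm (hnorm G (hsub G (embed P (X n)) (seq_class P X)) - 0) < r" by blast
qed

lemma hilb_generated: "hilb G"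
proof
  show "hcarrier G \<noteq> {}" using embed_in by (auto simp: carrier_G)
next
  fix x y assume x: "x \<in> hcarrier G" and y: "y \<in> hcarrier G"
  obtain X where X: "cauchy_wrt P X" "x = seq_class P X" using completion_cases[OF x] by blast
  obtain Y where Y: "cauchy_wrt P Y" "y = seq_class P Y" using completion_cases[OF y] by blast
  show "hplus G x y \<in> hcarrier G"
    using X Y by (simp add: plus_class carrier_G cauchy_add seq_class_in)
  show "hscale G c x \<in> hcarrier G" for c
    using X by (simp add: scale_class carrier_G cauchy_scale seq_class_in)
  show "hinner G (hplus G x y) z = hinner G x z + hinner G y z" if z: "z \<in> hcarrier G" for z
  proof -
    obtain Z where Z: "cauchy_wrt P Z" "z = seq_class P Z" using completion_cases[OF z] by blast
    have "(\<lambda>n. ip (X n + Y n) (Z n)) \<longlonglongrightarrow> hinner G (hplus G x y) z"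
      using inner_class[OF cauchy_add[OF X(1) Y(1)] Z(1)] X Y Z by (simp add: plus_class)
    moreover have "(\<lambda>n. ip (X n + Y n) (Z n)) \<longlonglongrightarrow> hinner G x z + hinner G y z"
      unfolding ip_add_left X(2) Y(2) Z(2) by (intro tendsto_add inner_class X Y Z)
    ultimately show ?thesis by (rule LIMSEQ_unique)
  qed
  show "hinner G (hscale G c x) y = c * hinner G x y" for c
  proof -
    have "(\<lambda>n. ip (c *\<^sub>C X n) (Y n)) \<longlonglongrightarrow> hinner G (hscale G c x) y"
      using inner_class[OF cauchy_scale[OF X(1)] Y(1)] X Y by (simp add: scale_class)
    moreover have "(\<lambda>n. ip (c *\<^sub>C X n) (Y n)) \<longlonglongrightarrow> c * hinner G x y"
      unfolding ip_scale_left X(2) Y(2) by (intro tendsto_mult_left inner_class X Y)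
    ultimately show ?thesis by (rule LIMSEQ_unique)
  qed
  show "hinner G y x = cnj (hinner G x y)"
  proof -
    have "(\<lambda>n. cnj (ip (X n) (Y n))) \<longlonglongrightarrow> cnj (hinner G x y)"
      unfolding X(2) Y(2) by (intro tendsto_cnj inner_class X Y)
    then have "(\<lambda>n. ip (Y n) (X n)) \<longlonglongrightarrow> cnj (hinner G x y)" by (simp flip: ip_cnj)
    moreover have "(\<lambda>n. ip (Y n) (X n)) \<longlonglongrightarrow> hinner G y x"
      unfolding X(2) Y(2) by (intro inner_class X Y)
    ultimately show ?thesis using LIMSEQ_unique by blast
  qed
  show "0 \<le> Re (hinner G x x)"
    using tendsto_Re[OF inner_class[OF X(1) X(1)]] unfolding X(2)
    by (rule LIMSEQ_le_const) (simp add: ip_pos)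
  show "x = y" if "hnorm G (hsub G x y) = 0"
  proof -
    have "(\<lambda>n. P (X n - Y n)) \<longlonglongrightarrow> 0"
      using hnorm_class[OF cauchy_diff[OF X(1) Y(1)]] that X Y by (simp add: sub_class)
    then show ?thesis using X Y by (simp add: seq_class_eq_iff equi_def)
  qed
next
  fix C :: "nat \<Rightarrow> (nat \<Rightarrow> 'v) set" assume C: "\<And>n. C n \<in> hcarrier G"
    and cauchy: "\<And>e. e > 0 \<Longrightarrow> \<exists>N. \<forall>m\<ge>N. \<forall>n\<ge>N. hnorm G (hsub G (C m) (C n)) < e"
  have tri: "hnorm G (hsub G x z) \<le> hnorm G (hsub G x y) + hnorm G (hsub G y z)"
    if xyz: "x \<in> hcarrier G" "y \<in> hcarrier G" "z \<in> hcarrier G" for x y z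
  proof -
    obtain X where X: "cauchy_wrt P X" "x = seq_class P X" using completion_cases[OF xyz(1)] by blast
    obtain Y where Y: "cauchy_wrt P Y" "y = seq_class P Y" using completion_cases[OF xyz(2)] by blast
    obtain Z where Z: "cauchy_wrt P Z" "z = seq_class P Z" using completion_cases[OF xyz(3)] by blast
    have "(\<lambda>n. P (X n - Z n)) \<longlonglongrightarrow> hnorm G (hsub G x z)"
      "(\<lambda>n. P (X n - Y n) + P (Y n - Z n)) \<longlonglongrightarrow> hnorm G (hsub G x y) + hnorm G (hsub G y z)"
      unfolding X(2) Y(2) Z(2)
      by (auto simp: sub_class X Y Z intro!: tendsto_add hnorm_class cauchy_diff)
    then show ?thesis by (rule LIMSEQ_le) (auto intro: p_diff_triangle)
  qed
  have comm: "hnorm G (hsub G x y) = hnorm G (hsub G y x)" if xy: "x \<in> hcarrier G" "y \<in> hcarrier G" for x y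
  proof -
    obtain X where X: "cauchy_wrt P X" "x = seq_class P X" using completion_cases[OF xy(1)] by blast
    obtain Y where Y: "cauchy_wrt P Y" "y = seq_class P Y" using completion_cases[OF xy(2)] by blast
    have "(\<lambda>n. P (X n - Y n)) \<longlonglongrightarrow> hnorm G (hsub G x y)" "(\<lambda>n. P (Y n - X n)) \<longlonglongrightarrow> hnorm G (hsub G y x)"
      unfolding X(2) Y(2) by (auto simp: sub_class X Y intro!: hnorm_class cauchy_diff)
    then show ?thesis unfolding p_diff_commute[of "Y _"] by (rule LIMSEQ_unique)
  qed
  have emb: "embed P v \<in> hcarrier G" for v by (simp add: carrier_G embed_in)
  \<comment> \<open>Each \<open>C k\<close> is approximated by a single vector; these vectors form the limit class.\<close>
  have "\<exists>v. hnorm G (hsub G (embed P v) (C k)) < 1 / real (Suc k)" for k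
  proof -
    obtain X where X: "cauchy_wrt P X" "C k = seq_class P X" using completion_cases[OF C] by blast
    have "\<forall>\<^sub>F n in sequentially. hnorm G (hsub G (embed P (X n)) (C k)) < 1 / real (Suc k)"
      unfolding X(2) by (rule order_tendstoD(2)[OF class_limit[OF X(1)]]) simp
    then show ?thesis by (auto simp: eventually_sequentially)
  qed
  then obtain v where v: "\<And>k. hnorm G (hsub G (embed P (v k)) (C k)) < 1 / real (Suc k)" by metis
  have vlim: "(\<lambda>k. 1 / real (Suc k)) \<longlonglongrightarrow> 0" using LIMSEQ_inverse_real_of_nat by (simp add: inverse_eq_divide)
  have cv: "cauchy_wrt P v"
  proof (rule cauchyI)
    fix e :: real assume e: "e > 0"
    obtain N where N: "\<And>m n. m \<ge> N \<Longrightarrow> n \<ge> N \<Longrightarrow> hnorm G (hsub G (C m) (C n)) < e / 3"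
      using cauchy[of "e / 3"] e by auto
    obtain M where M: "\<And>n. n \<ge> M \<Longrightarrow> 1 / real (Suc n) < e / 3"
      using order_tendstoD(2)[OF vlim, of "e / 3"] e by (auto simp: eventually_sequentially)
    have "P (v m - v n) < e" if mn: "m \<ge> max N M" "n \<ge> max N M" for m n
    proof -
      have "P (v m - v n) = hnorm G (hsub G (embed P (v m)) (embed P (v n)))"
        by (simp add: scale_embed plus_embed hnorm_embed scaleC_minus_left)
      also have "\<dots> \<le> hnorm G (hsub G (embed P (v m)) (C m)) +
          (hnorm G (hsub G (C m) (C n)) + hnorm G (hsub G (C n) (embed P (v n))))"
        using tri[OF emb C emb, of "v m" "v n" m] tri[OF C C emb, of m "v n" n] by linarith
      also have "\<dots> < e"
        using v[of m] v[of n] M[of m] M[of n] N[of m n] mn comm[OF C emb, of n "v n"] by auto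
      finally show ?thesis .
    qed
    then show "\<exists>N. \<forall>m\<ge>N. \<forall>n\<ge>N. P (v m - v n) < e" by blast
  qed
  have "(\<lambda>n. hnorm G (hsub G (C n) (seq_class P v))) \<longlonglongrightarrow> 0"
  proof (rule Lim_null_comparison[OF always_eventually])
    show "(\<lambda>n. 1 / real (Suc n) + hnorm G (hsub G (embed P (v n)) (seq_class P v))) \<longlonglongrightarrow> 0"
      by (intro tendsto_add_zero vlim class_limit cv)
    have inG: "seq_class P v \<in> hcarrier G" using cv by (simp add: carrier_G seq_class_in)
    have nn: "0 \<le> hnorm G (hsub G (C n) (seq_class P v))" for n
    proof -
      obtain X where X: "cauchy_wrt P X" "C n = seq_class P X" using completion_cases[OF C] by blast
      show ?thesis unfolding X(2) sub_class[OF X(1) cv]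
        by (rule LIMSEQ_le_const[OF hnorm_class[OF cauchy_diff[OF X(1) cv]]]) (simp add: P_nonneg)
    qed
    have "hnorm G (hsub G (C n) (seq_class P v)) \<le>
        1 / real (Suc n) + hnorm G (hsub G (embed P (v n)) (seq_class P v))" for n
      using tri[OF C emb inG, of n "v n"] comm[OF C emb, of n "v n"] v[of n] by linarith
    then show "\<forall>n. norm (hnorm G (hsub G (C n) (seq_class P v))) \<le>
        1 / real (Suc n) + hnorm G (hsub G (embed P (v n)) (seq_class P v))"
      unfolding real_norm_def abs_of_nonneg[OF nn] by blast
  qed
  then show "\<exists>x\<in>hcarrier G. (\<lambda>n. hnorm G (hsub G (C n) x)) \<longlonglongrightarrow> 0"
    using cv by (auto simp: carrier_G seq_class_in)
qed

lemma total_embed: "hilb.total G (range (embed P))"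
proof -
  interpret hilb G by (rule hilb_generated)
  show ?thesis
    unfolding total_def
  proof (intro conjI allI impI)
    show "range (embed P) \<subseteq> hcarrier G" by (auto simp: carrier_G embed_in)
    fix M assume M: "closed_subspace G M \<and> range (embed P) \<subseteq> M"
    have "C \<in> M" if C: "C \<in> hcarrier G" for C
    proof -
      obtain X where X: "cauchy_wrt P X" "C = seq_class P X" using completion_cases[OF C] by blast
      have "conv (\<lambda>k. embed P (X k)) C"
        using class_limit[OF X(1)] C by (simp add: conv_def X(2) carrier_G embed_in)
      then show ?thesis using closed_subspaceD(5)[of M "\<lambda>k. embed P (X k)" C] M by auto
    qed
    then show "M = hcarrier G" using M by (auto simp: closed_subspace_def)
  qed
qed

end

lemma bdd_map_cmap:
  assumes i: "semi_inner i" and j: "semi_inner j"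
    and add: "\<And>v w. g (v + w) = g v + g w" and scale: "\<And>c v. g (c *\<^sub>C v) = c *\<^sub>C g v"
    and bound: "\<And>v. Re (j (g v) (g v)) \<le> K\<^sup>2 * Re (i v v)" and K: "K \<ge> 0"
  shows "bdd_map (hilbert_generated i) (hilbert_generated j) K (cmap (inner_seminorm j) g)"
    and "cmap (inner_seminorm j) g (embed (inner_seminorm i) v) = embed (inner_seminorm j) (g v)"
proof -
  interpret I: semi_inner i by fact
  interpret J: semi_inner j by fact
  have P: "J.P (g v) \<le> K * I.P v" for v
    by (rule power2_le_imp_le) (use bound[of v] K in \<open>simp_all add: J.P_sq power_mult_distrib I.P_sq I.P_nonneg\<close>)
  have diff: "g (v - w) = g v - g w" for v w
    using add[of v "(- 1) *\<^sub>C w"] scale[of "- 1" w] by (simp add: scaleC_minus_left)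
  have lip: "J.P (g v - g w) \<le> K * I.P (v - w)" for v w
    using P[of "v - w"] by (simp add: diff)
  note cls = cmap_class[OF I.seminormed_axioms J.seminormed_axioms lip]
  note cau = seminormed_cauchy_map[OF I.seminormed_axioms J.seminormed_axioms lip]
  show "cmap J.P g (embed I.P v) = embed J.P (g v)"
    by (rule cmap_embed[OF I.seminormed_axioms J.seminormed_axioms lip])
  show "bdd_map I.G J.G K (cmap J.P g)"
    unfolding bdd_map_def
  proof (intro conjI ballI allI funcsetI)
    fix x assume x: "x \<in> hcarrier I.G"
    obtain X where X: "cauchy_wrt I.P X" "x = seq_class I.P X" using I.completion_cases[OF x] by blast
    show "cmap J.P g x \<in> hcarrier J.G" using X by (simp add: cls cau J.seq_class_in J.carrier_G)
    show "cmap J.P g (hscale I.G c x) = hscale J.G c (cmap J.P g x)" for c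
      using X by (simp add: cls cau I.scale_class J.scale_class I.cauchy_scale scale)
    show "hnorm J.G (cmap J.P g x) \<le> K * hnorm I.G x"
    proof -
      have "(\<lambda>n. J.P (g (X n))) \<longlonglongrightarrow> hnorm J.G (cmap J.P g x)"
        using X by (simp add: cls cau J.hnorm_class)
      moreover have "(\<lambda>n. K * I.P (X n)) \<longlonglongrightarrow> K * hnorm I.G x"
        using X by (auto intro: tendsto_mult_left I.hnorm_class)
      ultimately show ?thesis by (rule LIMSEQ_le) (auto intro: P)
    qed
    fix y assume y: "y \<in> hcarrier I.G"
    obtain Y where Y: "cauchy_wrt I.P Y" "y = seq_class I.P Y" using I.completion_cases[OF y] by blast
    show "cmap J.P g (hplus I.G x y) = hplus J.G (cmap J.P g x) (cmap J.P g y)"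
      using X Y by (simp add: cls cau I.plus_class J.plus_class I.cauchy_add add)
  qed
qed


subsection \<open>Hilbert space direct sums\<close>

locale hilb_family =
  fixes I :: "'i set" and K :: "'i \<Rightarrow> 'h hilbert"
  assumes hilb_K: "i \<in> I \<Longrightarrow> hilb (K i)"
begin

abbreviation S where "S \<equiv> hilbert_sum I K"

lemma inner_S: "hinner S x y = (\<Sum>\<^sub>\<infinity>i\<in>I. hinner (K i) (x i) (y i))"
  by (simp add: hilbert_sum_def)

lemma in_S_iff: "x \<in> hcarrier S \<longleftrightarrow>
    x \<in> extensional I \<and> (\<forall>i\<in>I. x i \<in> hcarrier (K i)) \<and> (\<lambda>i. (hnorm (K i) (x i))\<^sup>2) summable_on I"
  by (auto simp: hilbert_sum_def PiE_def)

lemma in_SD: "x \<in> hcarrier S \<Longrightarrow> i \<in> I \<Longrightarrow> x i \<in> hcarrier (K i)"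
  by (simp add: in_S_iff)

lemma plus_S: "hplus S x y = (\<lambda>i\<in>I. hplus (K i) (x i) (y i))"
  and scale_S: "hscale S c x = (\<lambda>i\<in>I. hscale (K i) c (x i))"
  by (simp_all add: hilbert_sum_def)

lemma summable_sq_bound:
  assumes "\<And>i. i \<in> I \<Longrightarrow> z i \<in> hcarrier (K i)" "z \<in> extensional I"
    and "\<And>i. i \<in> I \<Longrightarrow> (hnorm (K i) (z i))\<^sup>2 \<le> g i" "g summable_on I"
  shows "z \<in> hcarrier S"
  using assms summable_on_comparison_test[of g I "\<lambda>i. (hnorm (K i) (z i))\<^sup>2"] by (simp add: in_S_iff)

lemma plus_in_S:
  assumes x: "x \<in> hcarrier S" and y: "y \<in> hcarrier S"
  shows "hplus S x y \<in> hcarrier S"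
proof (rule summable_sq_bound)
  show "(\<lambda>i. 2 * (hnorm (K i) (x i))\<^sup>2 + 2 * (hnorm (K i) (y i))\<^sup>2) summable_on I"
    using x y by (intro summable_on_add summable_on_cmult_right) (auto simp: in_S_iff)
  fix i assume i: "i \<in> I"
  interpret Ki: hilb "K i" by (rule hilb_K[OF i])
  have xy: "x i \<in> hcarrier (K i)" "y i \<in> hcarrier (K i)" using x y i by (auto simp: in_SD)
  then show "hplus S x y i \<in> hcarrier (K i)" using i by (simp add: plus_S)
  have "(hnorm (K i) (hplus (K i) (x i) (y i)))\<^sup>2 \<le> (hnorm (K i) (x i) + hnorm (K i) (y i))\<^sup>2"
    using Ki.hnorm_triangle[OF xy] xy by (intro power_mono) auto
  also have "\<dots> \<le> 2 * (hnorm (K i) (x i))\<^sup>2 + 2 * (hnorm (K i) (y i))\<^sup>2"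
    using sum_squares_bound[of "hnorm (K i) (x i)" "hnorm (K i) (y i)"] by (simp add: power2_sum)
  finally show "(hnorm (K i) (hplus S x y i))\<^sup>2 \<le> 2 * (hnorm (K i) (x i))\<^sup>2 + 2 * (hnorm (K i) (y i))\<^sup>2"
    using i by (simp add: plus_S)
qed (simp add: plus_S)

lemma scale_in_S:
  assumes x: "x \<in> hcarrier S"
  shows "hscale S c x \<in> hcarrier S"
proof (rule summable_sq_bound)
  show "(\<lambda>i. (cmod c)\<^sup>2 * (hnorm (K i) (x i))\<^sup>2) summable_on I"
    using x by (intro summable_on_cmult_right) (auto simp: in_S_iff)
  fix i assume i: "i \<in> I"
  interpret Ki: hilb "K i" by (rule hilb_K[OF i])
  have xi: "x i \<in> hcarrier (K i)" using x i by (auto simp: in_SD)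
  then show "hscale S c x i \<in> hcarrier (K i)" using i by (simp add: scale_S)
  show "(hnorm (K i) (hscale S c x i))\<^sup>2 \<le> (cmod c)\<^sup>2 * (hnorm (K i) (x i))\<^sup>2"
    using i xi by (simp add: scale_S Ki.hnorm_scale power_mult_distrib)
qed (simp add: scale_S)

lemma inner_summable:
  assumes x: "x \<in> hcarrier S" and y: "y \<in> hcarrier S"
  shows "(\<lambda>i. hinner (K i) (x i) (y i)) summable_on I"
proof (rule abs_summable_summable)
  have "(\<lambda>i. (hnorm (K i) (x i))\<^sup>2 + (hnorm (K i) (y i))\<^sup>2) summable_on I"
    using x y by (intro summable_on_add) (auto simp: in_S_iff)
  then show "(\<lambda>i. norm (hinner (K i) (x i) (y i))) summable_on I"
  proof (rule summable_on_comparison_test)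
    fix i assume i: "i \<in> I"
    interpret Ki: hilb "K i" by (rule hilb_K[OF i])
    have xy: "x i \<in> hcarrier (K i)" "y i \<in> hcarrier (K i)" using x y i by (auto simp: in_SD)
    have "norm (hinner (K i) (x i) (y i)) \<le> hnorm (K i) (x i) * hnorm (K i) (y i)"
      by (rule Ki.cauchy_schwarz[OF xy])
    also have "\<dots> \<le> (hnorm (K i) (x i))\<^sup>2 + (hnorm (K i) (y i))\<^sup>2"
    proof -
      have "0 \<le> hnorm (K i) (x i) * hnorm (K i) (y i)" using xy by simp
      then show ?thesis
        using sum_squares_bound[of "hnorm (K i) (x i)" "hnorm (K i) (y i)"] by linarith
    qed
    finally show "norm (hinner (K i) (x i) (y i)) \<le> (hnorm (K i) (x i))\<^sup>2 + (hnorm (K i) (y i))\<^sup>2" .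
  qed simp
qed

lemma inner_self_S:
  assumes x: "x \<in> hcarrier S"
  shows "hinner S x x = of_real (\<Sum>\<^sub>\<infinity>i\<in>I. (hnorm (K i) (x i))\<^sup>2)"
proof -
  have "hinner S x x = (\<Sum>\<^sub>\<infinity>i\<in>I. of_real ((hnorm (K i) (x i))\<^sup>2))"
    unfolding inner_S using in_SD[OF x] by (intro infsum_cong hilb.inner_self hilb_K) auto
  also have "\<dots> = of_real (\<Sum>\<^sub>\<infinity>i\<in>I. (hnorm (K i) (x i))\<^sup>2)"
    using has_sum_infsum[of "\<lambda>i. (hnorm (K i) (x i))\<^sup>2" I] x unfolding in_S_iff
    by (intro infsumI) (simp add: has_sum_of_real_iff del: of_real_power)
  finally show ?thesis .
qed

lemma hnorm_sq_S:
  assumes x: "x \<in> hcarrier S"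
  shows "(hnorm S x)\<^sup>2 = (\<Sum>\<^sub>\<infinity>i\<in>I. (hnorm (K i) (x i))\<^sup>2)"
  unfolding hnorm_def[of S] inner_self_S[OF x] by (simp add: infsum_nonneg)

lemma sum_le_hnorm_sq:
  assumes x: "x \<in> hcarrier S" and F: "finite F" "F \<subseteq> I"
  shows "(\<Sum>i\<in>F. (hnorm (K i) (x i))\<^sup>2) \<le> (hnorm S x)\<^sup>2"
  unfolding hnorm_sq_S[OF x] using x F by (intro finite_sum_le_infsum) (auto simp: in_S_iff)

lemma hnorm_S_nonneg: "x \<in> hcarrier S \<Longrightarrow> 0 \<le> hnorm S x"
  by (simp add: hnorm_def inner_self_S infsum_nonneg)

lemma hnorm_component_le:
  assumes x: "x \<in> hcarrier S" and i: "i \<in> I"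
  shows "hnorm (K i) (x i) \<le> hnorm S x"
  by (rule power2_le_imp_le) (use sum_le_hnorm_sq[OF x, of "{i}"] i hnorm_S_nonneg[OF x] in auto)

lemma sub_S: "i \<in> I \<Longrightarrow> hsub S x y i = hsub (K i) (x i) (y i)"
  by (simp add: plus_S scale_S)

lemma hilb_S: "hilb S"
proof
  have "(\<lambda>i\<in>I. hilb.hzero (K i)) \<in> hcarrier S"
    by (simp add: in_S_iff hilb.hzero_in[OF hilb_K] hilb.hnorm_hzero[OF hilb_K] cong: summable_on_cong)
  then show "hcarrier S \<noteq> {}" by auto
next
  fix x y assume x: "x \<in> hcarrier S" and y: "y \<in> hcarrier S"
  show "hplus S x y \<in> hcarrier S" by (rule plus_in_S[OF x y])
  show "hscale S c x \<in> hcarrier S" for c by (rule scale_in_S[OF x])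
  show "hinner S (hplus S x y) z = hinner S x z + hinner S y z" if z: "z \<in> hcarrier S" for z
  proof -
    have "hinner S (hplus S x y) z = (\<Sum>\<^sub>\<infinity>i\<in>I. hinner (K i) (x i) (z i) + hinner (K i) (y i) (z i))"
      unfolding inner_S using in_SD x y z
      by (intro infsum_cong) (simp add: plus_S hilb.inner_plus[OF hilb_K])
    then show ?thesis using infsum_add[OF inner_summable[OF x z] inner_summable[OF y z]] by (simp add: inner_S)
  qed
  show "hinner S (hscale S c x) y = c * hinner S x y" for c
  proof -
    have "hinner S (hscale S c x) y = (\<Sum>\<^sub>\<infinity>i\<in>I. c * hinner (K i) (x i) (y i))"
      unfolding inner_S using in_SD x y
      by (intro infsum_cong) (simp add: scale_S hilb.inner_scale[OF hilb_K])
    then show ?thesis by (simp add: inner_S infsum_cmult_right')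
  qed
  show "hinner S y x = cnj (hinner S x y)"
  proof -
    have "hinner S y x = (\<Sum>\<^sub>\<infinity>i\<in>I. cnj (hinner (K i) (x i) (y i)))"
      unfolding inner_S using in_SD x y by (intro infsum_cong hilb.inner_cnj hilb_K) auto
    then show ?thesis by (simp add: inner_S infsum_cnj)
  qed
  show "0 \<le> Re (hinner S x x)" by (simp add: inner_self_S[OF x] infsum_nonneg)
  show "x = y" if 0: "hnorm S (hsub S x y) = 0"
  proof (rule extensionalityI[of _ I])
    show "x \<in> extensional I" "y \<in> extensional I" using x y by (auto simp: in_S_iff)
    fix i assume i: "i \<in> I"
    interpret Ki: hilb "K i" by (rule hilb_K[OF i])
    have s: "hsub S x y \<in> hcarrier S" using x y by (intro plus_in_S scale_in_S)
    have "hnorm (K i) (hsub S x y i) = 0"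
      using hnorm_component_le[OF s i] 0 Ki.hnorm_nonneg[OF in_SD[OF s i]] by linarith
    then show "x i = y i" using i in_SD x y by (intro Ki.definite) (auto simp: sub_S)
  qed
next
  fix X :: "nat \<Rightarrow> 'i \<Rightarrow> 'h" assume X: "\<And>n. X n \<in> hcarrier S"
    and cauchy: "\<And>e. e > 0 \<Longrightarrow> \<exists>N. \<forall>m\<ge>N. \<forall>n\<ge>N. hnorm S (hsub S (X m) (X n)) < e"
  have sub_in: "hsub S x y \<in> hcarrier S" if "x \<in> hcarrier S" "y \<in> hcarrier S" for x y
    using that by (intro plus_in_S scale_in_S)
  have "\<exists>x. x \<in> hcarrier (K i) \<and> (\<lambda>n. hnorm (K i) (hsub (K i) (X n i) x)) \<longlonglongrightarrow> 0" if i: "i \<in> I" for i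
  proof -
    interpret Ki: hilb "K i" by (rule hilb_K[OF i])
    have "\<exists>x\<in>hcarrier (K i). (\<lambda>n. hnorm (K i) (hsub (K i) (X n i) x)) \<longlonglongrightarrow> 0"
    proof (rule Ki.complete)
      show "X n i \<in> hcarrier (K i)" for n using in_SD[OF X i] .
      fix e :: real assume "e > 0"
      then obtain N where N: "\<And>m n. m \<ge> N \<Longrightarrow> n \<ge> N \<Longrightarrow> hnorm S (hsub S (X m) (X n)) < e"
        using cauchy by blast
      have "hnorm (K i) (hsub (K i) (X m i) (X n i)) < e" if "m \<ge> N" "n \<ge> N" for m n
        using hnorm_component_le[OF sub_in[OF X X] i, of m n] N[OF that] by (simp add: sub_S[OF i])
      then show "\<exists>N. \<forall>m\<ge>N. \<forall>n\<ge>N. hnorm (K i) (hsub (K i) (X m i) (X n i)) < e" by blast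
    qed
    then show ?thesis by blast
  qed
  then obtain x0 where x0: "\<And>i. i \<in> I \<Longrightarrow> x0 i \<in> hcarrier (K i)"
    "\<And>i. i \<in> I \<Longrightarrow> (\<lambda>n. hnorm (K i) (hsub (K i) (X n i) (x0 i))) \<longlonglongrightarrow> 0" by metis
  define x where "x = restrict x0 I"
  \<comment> \<open>Finite partial sums of the squared distances pass to the limit, which bounds the whole sum.\<close>
  have key: "\<exists>N. \<forall>n\<ge>N. \<forall>F. finite F \<and> F \<subseteq> I \<longrightarrow> (\<Sum>i\<in>F. (hnorm (K i) (hsub (K i) (X n i) (x i)))\<^sup>2) \<le> e\<^sup>2"
    if e: "e > 0" for e
  proof -
    obtain N where N: "\<And>m n. m \<ge> N \<Longrightarrow> n \<ge> N \<Longrightarrow> hnorm S (hsub S (X m) (X n)) < e"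
      using cauchy[OF e] by blast
    have "(\<Sum>i\<in>F. (hnorm (K i) (hsub (K i) (X n i) (x i)))\<^sup>2) \<le> e\<^sup>2"
      if n: "n \<ge> N" and F: "finite F" "F \<subseteq> I" for n F
    proof (rule LIMSEQ_le_const2)
      show "(\<lambda>m. \<Sum>i\<in>F. (hnorm (K i) (hsub (K i) (X n i) (X m i)))\<^sup>2) \<longlonglongrightarrow>
          (\<Sum>i\<in>F. (hnorm (K i) (hsub (K i) (X n i) (x i)))\<^sup>2)"
      proof (intro tendsto_sum tendsto_power)
        fix i assume "i \<in> F"
        then have i: "i \<in> I" using F by auto
        interpret Ki: hilb "K i" by (rule hilb_K[OF i])
        have c: "X m i \<in> hcarrier (K i)" "x i \<in> hcarrier (K i)" for m
          using in_SD[OF X i] x0 i by (auto simp: x_def)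
        show "(\<lambda>m. hnorm (K i) (hsub (K i) (X n i) (X m i))) \<longlonglongrightarrow> hnorm (K i) (hsub (K i) (X n i) (x i))"
        proof (rule LIM_zero_cancel, rule Lim_null_comparison[OF always_eventually])
          show "(\<lambda>m. hnorm (K i) (hsub (K i) (X m i) (x i))) \<longlonglongrightarrow> 0" using x0 i by (simp add: x_def)
          show "\<forall>m. norm (hnorm (K i) (hsub (K i) (X n i) (X m i)) - hnorm (K i) (hsub (K i) (X n i) (x i)))
              \<le> hnorm (K i) (hsub (K i) (X m i) (x i))"
          proof
            fix m
            show "norm (hnorm (K i) (hsub (K i) (X n i) (X m i)) - hnorm (K i) (hsub (K i) (X n i) (x i)))
              \<le> hnorm (K i) (hsub (K i) (X m i) (x i))"
              using Ki.hsub_triangle[OF c(1)[of n] c(1)[of m] c(2)] Ki.hsub_triangle[OF c(1)[of n] c(2) c(1)[of m]]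
                Ki.hsub_commute[OF c(1)[of m] c(2)] by simp
          qed
        qed
      qed
      have "(\<Sum>i\<in>F. (hnorm (K i) (hsub (K i) (X n i) (X m i)))\<^sup>2) \<le> e\<^sup>2" if m: "m \<ge> N" for m
      proof -
        have "(\<Sum>i\<in>F. (hnorm (K i) (hsub (K i) (X n i) (X m i)))\<^sup>2) = (\<Sum>i\<in>F. (hnorm (K i) (hsub S (X n) (X m) i))\<^sup>2)"
          using F by (intro sum.cong) (auto simp: sub_S)
        also have "\<dots> \<le> (hnorm S (hsub S (X n) (X m)))\<^sup>2" by (rule sum_le_hnorm_sq[OF sub_in[OF X X] F])
        also have "\<dots> \<le> e\<^sup>2"
          using N[OF n m] hnorm_S_nonneg[OF sub_in[OF X X]] by (intro power_mono) auto
        finally show ?thesis .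
      qed
      then show "\<exists>M. \<forall>m\<ge>M. (\<Sum>i\<in>F. (hnorm (K i) (hsub (K i) (X n i) (X m i)))\<^sup>2) \<le> e\<^sup>2" by blast
    qed
    then show ?thesis by blast
  qed
  have xK: "x i \<in> hcarrier (K i)" if "i \<in> I" for i using x0 that by (simp add: x_def)
  have diff_in: "hsub S (X n) x \<in> hcarrier S"
    if b: "\<And>F. finite F \<Longrightarrow> F \<subseteq> I \<Longrightarrow> (\<Sum>i\<in>F. (hnorm (K i) (hsub (K i) (X n i) (x i)))\<^sup>2) \<le> c" for n c
    unfolding in_S_iff
  proof (intro conjI ballI)
    show "hsub S (X n) x \<in> extensional I" by (simp add: plus_S)
    fix i assume i: "i \<in> I"
    interpret Ki: hilb "K i" by (rule hilb_K[OF i])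
    show "hsub S (X n) x i \<in> hcarrier (K i)" using in_SD[OF X i] xK[OF i] by (simp add: sub_S[OF i])
  next
    show "(\<lambda>i. (hnorm (K i) (hsub S (X n) x i))\<^sup>2) summable_on I"
    proof (rule nonneg_bdd_above_summable_on)
      show "bdd_above (sum (\<lambda>i. (hnorm (K i) (hsub S (X n) x i))\<^sup>2) ` {F. F \<subseteq> I \<and> finite F})"
      proof (rule bdd_aboveI2)
        fix F assume "F \<in> {F. F \<subseteq> I \<and> finite F}"
        then have F: "finite F" "F \<subseteq> I" by auto
        then show "(\<Sum>i\<in>F. (hnorm (K i) (hsub S (X n) x i))\<^sup>2) \<le> c"
          using b[OF F] sum.cong[of F F "\<lambda>i. (hnorm (K i) (hsub S (X n) x i))\<^sup>2"
              "\<lambda>i. (hnorm (K i) (hsub (K i) (X n i) (x i)))\<^sup>2"] by (auto simp: sub_S subset_iff)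
      qed
    qed simp
  qed
  obtain N1 where N1: "\<And>F. finite F \<Longrightarrow> F \<subseteq> I \<Longrightarrow> (\<Sum>i\<in>F. (hnorm (K i) (hsub (K i) (X N1 i) (x i)))\<^sup>2) \<le> 1\<^sup>2"
    using key[of 1] by auto
  have xS: "x \<in> hcarrier S"
  proof -
    have "x = hsub S (X N1) (hsub S (X N1) x)"
    proof (rule extensionalityI[of _ I])
      show "x \<in> extensional I" "hsub S (X N1) (hsub S (X N1) x) \<in> extensional I" by (auto simp: x_def plus_S)
      fix i assume i: "i \<in> I"
      interpret Ki: hilb "K i" by (rule hilb_K[OF i])
      show "x i = hsub S (X N1) (hsub S (X N1) x) i"
        using in_SD[OF X i] xK[OF i] by (auto simp: sub_S[OF i] intro!: Ki.ext)
    qed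
    moreover have "hsub S (X N1) (hsub S (X N1) x) \<in> hcarrier S"
      by (rule sub_in[OF X diff_in[OF N1]])
    ultimately show ?thesis by simp
  qed
  show "\<exists>x\<in>hcarrier S. (\<lambda>n. hnorm S (hsub S (X n) x)) \<longlonglongrightarrow> 0"
  proof (intro bexI[OF _ xS] LIMSEQ_I)
    fix r :: real assume r: "r > 0"
    obtain N where N: "\<And>n F. n \<ge> N \<Longrightarrow> finite F \<Longrightarrow> F \<subseteq> I \<Longrightarrow>
        (\<Sum>i\<in>F. (hnorm (K i) (hsub (K i) (X n i) (x i)))\<^sup>2) \<le> (r / 2)\<^sup>2"
      using key[of "r / 2"] r by auto
    have "norm (hnorm S (hsub S (X n) x) - 0) < r" if n: "n \<ge> N" for n
    proof -
      have d: "hsub S (X n) x \<in> hcarrier S" by (rule sub_in[OF X xS])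
      have "(hnorm S (hsub S (X n) x))\<^sup>2 \<le> (r / 2)\<^sup>2"
        unfolding hnorm_sq_S[OF d]
      proof (rule infsum_le_finite_sums)
        show "(\<lambda>i. (hnorm (K i) (hsub S (X n) x i))\<^sup>2) summable_on I" using d by (simp add: in_S_iff)
        fix F assume F: "finite F" "F \<subseteq> I"
        have "(\<Sum>i\<in>F. (hnorm (K i) (hsub S (X n) x i))\<^sup>2) = (\<Sum>i\<in>F. (hnorm (K i) (hsub (K i) (X n i) (x i)))\<^sup>2)"
          using F by (intro sum.cong) (auto simp: sub_S)
        then show "(\<Sum>i\<in>F. (hnorm (K i) (hsub S (X n) x i))\<^sup>2) \<le> (r / 2)\<^sup>2" using N[OF n F] by simp
      qed
      then have "hnorm S (hsub S (X n) x) \<le> r / 2" by (rule power2_le_imp_le) (use r in simp)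
      then show ?thesis using r hnorm_S_nonneg[OF d] by simp
    qed
    then show "\<exists>no. \<forall>n\<ge>no. norm (hnorm S (hsub S (X n) x) - 0) < r" by blast
  qed
qed

sublocale S: hilb S
  by (rule hilb_S)

definition single :: "'i \<Rightarrow> 'h \<Rightarrow> 'i \<Rightarrow> 'h" where
  "single i v = (\<lambda>j\<in>I. if j = i then v else hilb.hzero (K j))"

lemma single_apply: "j \<in> I \<Longrightarrow> single i v j = (if j = i then v else hilb.hzero (K j))"
  by (simp add: single_def)

lemma single_in:
  assumes i: "i \<in> I" and v: "v \<in> hcarrier (K i)"
  shows "single i v \<in> hcarrier S"
  unfolding in_S_iff
proof (intro conjI ballI)
  have "(\<lambda>j. (hnorm (K j) (single i v j))\<^sup>2) summable_on {i}" by simp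
  then show "(\<lambda>j. (hnorm (K j) (single i v j))\<^sup>2) summable_on I"
    by (rule summable_on_cong_neutral[THEN iffD1, rotated -1])
      (use i in \<open>auto simp: single_apply hilb.hnorm_hzero[OF hilb_K]\<close>)
qed (use v in \<open>auto simp: single_def hilb.hzero_in[OF hilb_K]\<close>)

lemma inner_single:
  assumes i: "i \<in> I" and v: "v \<in> hcarrier (K i)" and y: "y \<in> hcarrier S"
  shows "hinner S (single i v) y = hinner (K i) v (y i)"
proof -
  have "hinner S (single i v) y = (\<Sum>\<^sub>\<infinity>j\<in>{i}. hinner (K j) (single i v j) (y j))"
    unfolding inner_S
    by (rule infsum_cong_neutral) (use i y in \<open>auto simp: single_apply hilb.inner_hzero[OF hilb_K] in_SD\<close>)
  then show ?thesis using i by (simp add: single_apply)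
qed

lemma bdd_map_single:
  assumes i: "i \<in> I"
  shows "bdd_map (K i) S 1 (single i)"
  unfolding bdd_map_def
proof (intro conjI ballI allI funcsetI)
  interpret Ki: hilb "K i" by (rule hilb_K[OF i])
  fix v assume v: "v \<in> hcarrier (K i)"
  show "single i v \<in> hcarrier S" by (rule single_in[OF i v])
  show "single i (hscale (K i) c v) = hscale S c (single i v)" for c
    unfolding scale_S
    by (auto simp: single_def fun_eq_iff hilb.scale_hzero[OF hilb_K])
  show "hnorm S (single i v) \<le> 1 * hnorm (K i) v"
    using inner_single[OF i v single_in[OF i v]] i by (simp add: hnorm_def single_apply)
  show "single i (hplus (K i) v w) = hplus S (single i v) (single i w)" for w
    unfolding plus_S
    by (auto simp: single_def fun_eq_iff hilb.plus_hzero[OF hilb_K] hilb.hzero_in[OF hilb_K])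
qed

text \<open>A closed subspace that contains the vectors with one component from \<open>D i\<close> contains all vectors with
  one component, hence all finite truncations, and these approximate.\<close>

lemma total_single:
  assumes D: "\<And>i. i \<in> I \<Longrightarrow> hilb.total (K i) (D i)"
  shows "S.total (\<Union>i\<in>I. single i ` D i)"
  unfolding S.total_def
proof (intro conjI allI impI)
  have DK: "d \<in> hcarrier (K i)" if "i \<in> I" "d \<in> D i" for i d
    using D[OF that(1)] hilb.total_def[OF hilb_K[OF that(1)]] that(2) by auto
  then show "(\<Union>i\<in>I. single i ` D i) \<subseteq> hcarrier S" by (auto intro: single_in)
  fix M assume M: "closed_subspace S M \<and> (\<Union>i\<in>I. single i ` D i) \<subseteq> M"
  have cl: "closed_subspace S M" using M by blast
  note Mplus = S.closed_subspaceD(3)[OF cl] and Mscale = S.closed_subspaceD(4)[OF cl]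
    and Mlim = S.closed_subspaceD(5)[OF cl]
  have Msub: "x \<in> hcarrier S" if "x \<in> M" for x using S.closed_subspaceD(1)[OF cl] that by blast
  obtain m where m: "m \<in> M" using S.closed_subspaceD(2)[OF cl] by blast
  have M0: "S.hzero \<in> M" using Mscale[OF m, of 0] S.scale_zero[OF Msub[OF m]] by simp
  have single: "single i v \<in> M" if i: "i \<in> I" and v: "v \<in> hcarrier (K i)" for i v
  proof -
    interpret Ki: hilb "K i" by (rule hilb_K[OF i])
    note bs = bdd_map_single[OF i]
    show ?thesis
      using D[OF i] v
    proof (rule Ki.total_induct)
      show "single i Ki.hzero \<in> M" using Ki.bdd_hzero[OF bs hilb_S] M0 by simp
      show "single i d \<in> M" if "d \<in> D i" for d using M i that by auto
      fix X x assume "\<And>n. single i (X n) \<in> M" "Ki.conv X x"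
      then show "single i x \<in> M" using Mlim[of "\<lambda>n. single i (X n)"] Ki.conv_bdd[OF bs hilb_S, of X x] by simp
    qed (auto simp: bdd_mapD(3,4)[OF bs] Mplus Mscale)
  qed
  have trunc: "(\<lambda>i\<in>I. if i \<in> F then x i else hilb.hzero (K i)) \<in> M"
    if F: "finite F" "F \<subseteq> I" and x: "x \<in> hcarrier S" for F x
    using F
  proof (induction F rule: finite_induct)
    case empty
    have "(\<lambda>i\<in>I. hilb.hzero (K i)) = S.hzero"
    proof (rule extensionalityI[of _ I])
      show "S.hzero \<in> extensional I" using S.hzero_in by (simp add: in_S_iff)
      fix i assume i: "i \<in> I"
      have "hscale S 0 x i = hscale (K i) 0 (x i)" using i by (simp add: scale_S)
      then have "S.hzero i = hscale (K i) 0 (x i)" using x by simp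
      then show "(\<lambda>i\<in>I. hilb.hzero (K i)) i = S.hzero i"
        using i hilb.scale_zero[OF hilb_K[OF i] in_SD[OF x i]] by simp
    qed simp
    then show ?case using M0 by simp
  next
    case (insert j F)
    have "(\<lambda>i\<in>I. if i \<in> insert j F then x i else hilb.hzero (K i)) =
        hplus S (\<lambda>i\<in>I. if i \<in> F then x i else hilb.hzero (K i)) (single j (x j))"
      unfolding plus_S using insert in_SD[OF x]
      by (auto simp: fun_eq_iff single_def hilb.plus_hzero[OF hilb_K] hilb.hzero_in[OF hilb_K])
    moreover have "single j (x j) \<in> M" using insert.prems in_SD[OF x] by (intro single) auto
    moreover have "(\<lambda>i\<in>I. if i \<in> F then x i else hilb.hzero (K i)) \<in> M"
      by (rule insert.IH) (use insert.prems in auto)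
    ultimately show ?case using Mplus by (simp only:)
  qed
  have "x \<in> M" if x: "x \<in> hcarrier S" for x
  proof -
    have sx: "(\<lambda>i. (hnorm (K i) (x i))\<^sup>2) summable_on I" using x by (simp add: in_S_iff)
    define T where "T F = (\<lambda>i\<in>I. if i \<in> F then x i else hilb.hzero (K i))" for F
    have "\<exists>F. finite F \<and> F \<subseteq> I \<and> (hnorm S (hsub S (T F) x))\<^sup>2 < 1 / real (Suc n)" for n
    proof -
      obtain F where F: "finite F" "F \<subseteq> I"
        "norm ((\<Sum>i\<in>F. (hnorm (K i) (x i))\<^sup>2) - (\<Sum>\<^sub>\<infinity>i\<in>I. (hnorm (K i) (x i))\<^sup>2)) < 1 / real (Suc n)"
      proof -
        have "((\<lambda>F. \<Sum>i\<in>F. (hnorm (K i) (x i))\<^sup>2) \<longlongrightarrow> (\<Sum>\<^sub>\<infinity>i\<in>I. (hnorm (K i) (x i))\<^sup>2)) (finite_subsets_at_top I)"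
          using has_sum_infsum[OF sx] by (simp add: has_sum_def)
        then have "\<forall>\<^sub>F F in finite_subsets_at_top I. dist (\<Sum>i\<in>F. (hnorm (K i) (x i))\<^sup>2) (\<Sum>\<^sub>\<infinity>i\<in>I. (hnorm (K i) (x i))\<^sup>2) < 1 / real (Suc n)"
          by (rule tendstoD) simp
        then show ?thesis using that by (auto simp: eventually_finite_subsets_at_top dist_norm)
      qed
      have TS: "T F \<in> hcarrier S" using trunc[OF F(1,2) x] Msub by (simp add: T_def)
      have d: "hsub S (T F) x \<in> hcarrier S" using TS x by auto
      have comp: "hnorm (K i) (hsub S (T F) x i) = (if i \<in> F then 0 else hnorm (K i) (x i))" if i: "i \<in> I" for i
      proof -
        interpret Ki: hilb "K i" by (rule hilb_K[OF i])
        show ?thesis using in_SD[OF x i] i by (simp add: sub_S T_def Ki.hnorm_scale)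
      qed
      have "(hnorm S (hsub S (T F) x))\<^sup>2 = (\<Sum>\<^sub>\<infinity>i\<in>I. if i \<in> F then 0 else (hnorm (K i) (x i))\<^sup>2)"
        unfolding hnorm_sq_S[OF d] by (rule infsum_cong) (simp add: comp)
      also have "\<dots> = (\<Sum>\<^sub>\<infinity>i\<in>I - F. (hnorm (K i) (x i))\<^sup>2)"
        by (rule infsum_cong_neutral) auto
      also have "\<dots> = (\<Sum>\<^sub>\<infinity>i\<in>I. (hnorm (K i) (x i))\<^sup>2) - (\<Sum>i\<in>F. (hnorm (K i) (x i))\<^sup>2)"
        using infsum_Diff[OF sx _ F(2)] F(1) by simp
      also have "\<dots> < 1 / real (Suc n)" using F(3) by (simp add: abs_less_iff)
      finally show ?thesis using F by blast
    qed
    then obtain F where F: "\<And>n. finite (F n)" "\<And>n. F n \<subseteq> I"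
      "\<And>n. (hnorm S (hsub S (T (F n)) x))\<^sup>2 < 1 / real (Suc n)" by metis
    have TM: "T (F n) \<in> M" for n using trunc[OF F(1,2) x] by (simp add: T_def)
    have "(\<lambda>n. (hnorm S (hsub S (T (F n)) x))\<^sup>2) \<longlonglongrightarrow> 0"
    proof (rule Lim_null_comparison[OF always_eventually])
      show "(\<lambda>n. 1 / real (Suc n)) \<longlonglongrightarrow> 0" using LIMSEQ_inverse_real_of_nat by (simp add: inverse_eq_divide)
      show "\<forall>n. norm ((hnorm S (hsub S (T (F n)) x))\<^sup>2) \<le> 1 / real (Suc n)"
        using F(3) less_imp_le by (auto simp: norm_power)
    qed
    then have "(\<lambda>n. sqrt ((hnorm S (hsub S (T (F n)) x))\<^sup>2)) \<longlonglongrightarrow> sqrt 0" by (rule tendsto_real_sqrt)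
    then have "(\<lambda>n. hnorm S (hsub S (T (F n)) x)) \<longlonglongrightarrow> 0"
      using TM Msub x by (simp add: hnorm_S_nonneg)
    then have "S.conv (\<lambda>n. T (F n)) x" using TM Msub x by (auto simp: S.conv_def)
    then show ?thesis using TM Mlim[of "\<lambda>n. T (F n)" x] by simp
  qed
  then show "M = hcarrier S" using Msub by blast
qed

end

text \<open>The permutation \<open>\<sigma>\<close> will be a shift of the degree; reindexing along it compares the sums of squares.\<close>

lemma bdd_map_sum:
  assumes "hilb_family I K" and \<sigma>: "bij_betw \<sigma> I I" and C: "C \<ge> 0"
    and B: "\<And>i. i \<in> I \<Longrightarrow> bdd_map (K (\<sigma> i)) (K i) C (B i)"
  shows "bdd_map (hilbert_sum I K) (hilbert_sum I K) C (\<lambda>x. \<lambda>i\<in>I. B i (x (\<sigma> i)))"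
proof -
  interpret hilb_family I K by fact
  have \<sigma>I: "\<sigma> i \<in> I" if "i \<in> I" for i using \<sigma> that by (auto simp: bij_betw_def)
  note BD = bdd_mapD[OF B]
  let ?T = "\<lambda>x. \<lambda>i\<in>I. B i (x (\<sigma> i))"
  have sq: "(hnorm (K i) (B i (x (\<sigma> i))))\<^sup>2 \<le> C\<^sup>2 * (hnorm (K (\<sigma> i)) (x (\<sigma> i)))\<^sup>2"
    if x: "x \<in> hcarrier S" and i: "i \<in> I" for x i
  proof -
    interpret Ki: hilb "K i" by (rule hilb_K[OF i])
    have "(hnorm (K i) (B i (x (\<sigma> i))))\<^sup>2 \<le> (C * hnorm (K (\<sigma> i)) (x (\<sigma> i)))\<^sup>2"
      using BD(1,2)[OF i in_SD[OF x \<sigma>I[OF i]]] by (intro power_mono) auto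
    then show ?thesis by (simp add: power_mult_distrib)
  qed
  have summ: "(\<lambda>i. C\<^sup>2 * (hnorm (K (\<sigma> i)) (x (\<sigma> i)))\<^sup>2) summable_on I" if x: "x \<in> hcarrier S" for x
  proof (rule summable_on_cmult_right)
    show "(\<lambda>i. (hnorm (K (\<sigma> i)) (x (\<sigma> i)))\<^sup>2) summable_on I"
      using x summable_on_reindex_bij_betw[OF \<sigma>, of "\<lambda>j. (hnorm (K j) (x j))\<^sup>2"] by (simp add: in_S_iff)
  qed
  have TS: "?T x \<in> hcarrier S" if x: "x \<in> hcarrier S" for x
    by (rule summable_sq_bound[where g = "\<lambda>i. C\<^sup>2 * (hnorm (K (\<sigma> i)) (x (\<sigma> i)))\<^sup>2"])
      (use sq[OF x] summ[OF x] BD(1)[OF _ in_SD[OF x \<sigma>I]] in auto)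
  show ?thesis
    unfolding bdd_map_def
  proof (intro conjI ballI allI funcsetI)
    fix x assume x: "x \<in> hcarrier S"
    show "?T x \<in> hcarrier S" by (rule TS[OF x])
    show "?T (hscale S c x) = hscale S c (?T x)" for c
      using BD(3)[OF _ in_SD[OF x \<sigma>I]] \<sigma>I by (auto simp: scale_S fun_eq_iff)
    show "hnorm S (?T x) \<le> C * hnorm S x"
    proof (rule power2_le_imp_le)
      have "(hnorm S (?T x))\<^sup>2 = (\<Sum>\<^sub>\<infinity>i\<in>I. (hnorm (K i) (B i (x (\<sigma> i))))\<^sup>2)"
        unfolding hnorm_sq_S[OF TS[OF x]] by (rule infsum_cong) simp
      also have "\<dots> \<le> (\<Sum>\<^sub>\<infinity>i\<in>I. C\<^sup>2 * (hnorm (K (\<sigma> i)) (x (\<sigma> i)))\<^sup>2)"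
        using TS[OF x] sq[OF x] summ[OF x] by (intro infsum_mono) (auto simp: in_S_iff cong: summable_on_cong)
      also have "\<dots> = C\<^sup>2 * (\<Sum>\<^sub>\<infinity>i\<in>I. (hnorm (K (\<sigma> i)) (x (\<sigma> i)))\<^sup>2)"
        by (rule infsum_cmult_right')
      also have "\<dots> = (C * hnorm S x)\<^sup>2"
        using infsum_reindex_bij_betw[OF \<sigma>, of "\<lambda>j. (hnorm (K j) (x j))\<^sup>2"]
        by (simp add: hnorm_sq_S[OF x] power_mult_distrib)
      finally show "(hnorm S (?T x))\<^sup>2 \<le> (C * hnorm S x)\<^sup>2" .
    qed (use C hnorm_S_nonneg[OF x] in simp)
    fix y assume y: "y \<in> hcarrier S"
    show "?T (hplus S x y) = hplus S (?T x) (?T y)"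
      using BD(4)[OF _ in_SD[OF x \<sigma>I] in_SD[OF y \<sigma>I]] \<sigma>I by (auto simp: plus_S fun_eq_iff)
  qed
qed


subsection \<open>Sums and compositions of operators\<close>

context hilb
begin

definition op_id :: "'h \<Rightarrow> 'h" where "op_id = (\<lambda>x\<in>hcarrier H. x)"

definition op_plus :: "('h \<Rightarrow> 'h) \<Rightarrow> ('h \<Rightarrow> 'h) \<Rightarrow> 'h \<Rightarrow> 'h" where
  "op_plus S T = (\<lambda>x\<in>hcarrier H. hplus H (S x) (T x))"

definition op_scale :: "complex \<Rightarrow> ('h \<Rightarrow> 'h) \<Rightarrow> 'h \<Rightarrow> 'h" where
  "op_scale c T = (\<lambda>x\<in>hcarrier H. hscale H c (T x))"

lemma op_apply [simp]:
  "x \<in> hcarrier H \<Longrightarrow> op_id x = x"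
  "x \<in> hcarrier H \<Longrightarrow> op_plus S T x = hplus H (S x) (T x)"
  "x \<in> hcarrier H \<Longrightarrow> op_scale c T x = hscale H c (T x)"
  "x \<in> hcarrier H \<Longrightarrow> op_comp H S T x = S (T x)"
  by (simp_all add: op_id_def op_plus_def op_scale_def op_comp_def compose_def)

lemma bounded_opsI:
  assumes "T \<in> extensional (hcarrier H)" "bdd_map H H K T"
  shows "T \<in> bounded_ops H"
  using assms by (auto simp: bounded_ops_iff)

lemma bdd_id: "bdd_map H H 1 op_id"
  by (auto simp: bdd_map_def)

lemma op_id_in [simp]: "op_id \<in> bounded_ops H"
  by (rule bounded_opsI[OF _ bdd_id]) (simp add: op_id_def)

lemma op_plus_in [simp]:
  assumes S: "S \<in> bounded_ops H" and T: "T \<in> bounded_ops H"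
  shows "op_plus S T \<in> bounded_ops H"
proof -
  obtain K where K: "bdd_map H H K S" using S by (auto simp: bounded_ops_iff)
  obtain L where L: "bdd_map H H L T" using T by (auto simp: bounded_ops_iff)
  have "bdd_map H H (K + L) (op_plus S T)"
    unfolding bdd_map_def
  proof (intro conjI ballI allI funcsetI)
    fix x assume x: "x \<in> hcarrier H"
    note c = bounded_opsD[OF S] bounded_opsD[OF T]
    show "op_plus S T x \<in> hcarrier H" using x by (simp add: c)
    show "op_plus S T (hscale H a x) = hscale H a (op_plus S T x)" for a
      using x by (auto simp: c algebra_simps intro!: ext)
    show "op_plus S T (hplus H x y) = hplus H (op_plus S T x) (op_plus S T y)" if "y \<in> hcarrier H" for y
      using x that by (auto simp: c intro!: ext)
    show "hnorm H (op_plus S T x) \<le> (K + L) * hnorm H x"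
      using x hnorm_triangle[of "S x" "T x"] bdd_mapD(2)[OF K x] bdd_mapD(2)[OF L x]
      by (simp add: c algebra_simps)
  qed
  then show ?thesis by (rule bounded_opsI[rotated]) (simp add: op_plus_def)
qed

lemma op_scale_in [simp]:
  assumes T: "T \<in> bounded_ops H"
  shows "op_scale a T \<in> bounded_ops H"
proof -
  obtain K where K: "bdd_map H H K T" using T by (auto simp: bounded_ops_iff)
  have "bdd_map H H (cmod a * K) (op_scale a T)"
    unfolding bdd_map_def
  proof (intro conjI ballI allI funcsetI)
    fix x assume x: "x \<in> hcarrier H"
    note c = bounded_opsD[OF T]
    show "op_scale a T x \<in> hcarrier H" using x by (simp add: c)
    show "op_scale a T (hscale H b x) = hscale H b (op_scale a T x)" for b
      using x by (auto simp: c mult_ac intro!: ext)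
    show "op_scale a T (hplus H x y) = hplus H (op_scale a T x) (op_scale a T y)" if "y \<in> hcarrier H" for y
      using x that by (auto simp: c algebra_simps intro!: ext)
    show "hnorm H (op_scale a T x) \<le> cmod a * K * hnorm H x"
      using x bdd_mapD(2)[OF K x] by (simp add: c hnorm_scale mult.assoc mult_left_mono)
  qed
  then show ?thesis by (rule bounded_opsI[rotated]) (simp add: op_scale_def)
qed

lemma bdd_comp:
  assumes K: "bdd_map H H K S" and L: "bdd_map H H L T" and K0: "K \<ge> 0"
  shows "bdd_map H H (K * L) (op_comp H S T)"
  unfolding bdd_map_def
proof (intro conjI ballI allI funcsetI)
  fix x assume x: "x \<in> hcarrier H"
  note c = bdd_mapD(1,3,4)[OF K] bdd_mapD(1,3,4)[OF L]
  show "op_comp H S T x \<in> hcarrier H" using x by (simp add: c)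
  show "op_comp H S T (hscale H b x) = hscale H b (op_comp H S T x)" for b using x by (simp add: c)
  show "op_comp H S T (hplus H x y) = hplus H (op_comp H S T x) (op_comp H S T y)" if "y \<in> hcarrier H" for y
    using x that by (simp add: c)
  have "hnorm H (S (T x)) \<le> K * hnorm H (T x)" using x by (intro bdd_mapD(2)[OF K]) (simp add: c)
  also have "\<dots> \<le> K * (L * hnorm H x)" using bdd_mapD(2)[OF L x] K0 by (rule mult_left_mono)
  finally show "hnorm H (op_comp H S T x) \<le> K * L * hnorm H x" using x by simp
qed

lemma op_comp_in [simp]:
  assumes S: "S \<in> bounded_ops H" and T: "T \<in> bounded_ops H"
  shows "op_comp H S T \<in> bounded_ops H"
proof -
  obtain K where K: "K \<ge> 0" "bdd_map H H K S" using bounded_ops_bound[OF hilb_axioms S] by blast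
  obtain L where L: "bdd_map H H L T" using T by (auto simp: bounded_ops_iff)
  show ?thesis
    by (rule bounded_opsI[OF _ bdd_comp[OF K(2) L K(1)]]) (simp add: op_comp_def)
qed

lemma op_eqI:
  assumes "S \<in> bounded_ops H" "T \<in> bounded_ops H" "\<And>x. x \<in> hcarrier H \<Longrightarrow> S x = T x"
  shows "S = T"
  by (rule extensionalityI[of _ "hcarrier H"]) (use assms in \<open>auto simp: bounded_ops_iff\<close>)

end

lemma (in hilb_family) hzero_S: "S.hzero = (\<lambda>i\<in>I. hilb.hzero (K i))"
proof (rule extensionalityI[of _ I])
  show "S.hzero \<in> extensional I" using S.hzero_in by (simp add: in_S_iff)
  fix i assume i: "i \<in> I"
  have "hscale S 0 S.hzero i = hscale (K i) 0 (S.hzero i)" using i by (simp add: scale_S)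
  then show "S.hzero i = (\<lambda>i\<in>I. hilb.hzero (K i)) i"
    using i hilb.scale_zero[OF hilb_K[OF i] in_SD[OF S.hzero_in i]] by simp
qed simp

lemma (in semi_inner) seminormed_P: "seminormed P"
  by (rule seminormed_axioms)

lemma (in semi_inner) hzero_embed: "hilb.hzero G = embed P 0"
proof -
  interpret hilb G by (rule hilb_generated)
  show ?thesis using scale_zero[of "embed P 0"] scale_embed[of 0 0] by (simp add: carrier_G embed_in)
qed


section \<open>The regular representation\<close>

context transfer_system
begin

abbreviation PF :: "('a \<Rightarrow> complex) set" where "PF \<equiv> positive_functionals"
abbreviation H where "H \<equiv> reg_space \<delta> \<delta>s"
abbreviation N where "N f n \<equiv> inner_seminorm (reg_inner \<delta> \<delta>s f n)"
abbreviation Hn where "Hn f \<equiv> reg_summand \<delta> \<delta>s f"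
abbreviation Hf where "Hf f \<equiv> hilbert_sum UNIV (Hn f)"

lemma semi_inner_reg: "f \<in> PF \<Longrightarrow> semi_inner (reg_inner \<delta> \<delta>s f n)"
  using ip_add_left[of f n] ip_scale_left[of f n] ip_cnj[of f n] ip_pos[of f n]
  unfolding semi_inner_def ip_def by blast

lemma family_n: "f \<in> PF \<Longrightarrow> hilb_family UNIV (Hn f)"
  unfolding hilb_family_def reg_summand_def using semi_inner.hilb_generated[OF semi_inner_reg] by blast

lemma family_f: "hilb_family PF Hf"
  unfolding hilb_family_def using hilb_family.hilb_S[OF family_n] by blast

lemma H_eq: "H = hilbert_sum PF Hf"
  by (simp add: reg_space_def)

sublocale F: hilb_family PF Hf
  by (rule family_f)

sublocale R: hilb H
  unfolding H_eq by (rule F.hilb_S)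

definition svec :: "('a \<Rightarrow> complex) \<Rightarrow> int \<Rightarrow> 'a \<Rightarrow> 'a reg_vector" where
  "svec f n v = reg_vec \<delta> \<delta>s f (\<lambda>m. if m = n then v else 0)"

lemma hzero_Hf: "f \<in> PF \<Longrightarrow> hilb.hzero (Hf f) = (\<lambda>n. embed (N f n) 0)"
  using hilb_family.hzero_S[OF family_n] semi_inner.hzero_embed[OF semi_inner_reg]
  by (simp add: reg_summand_def restrict_def)

lemma svec_eq_single:
  assumes f: "f \<in> PF"
  shows "svec f n v = F.single f (hilb_family.single UNIV (Hn f) n (embed (N f n) v))"
proof (rule ext)
  fix g
  show "svec f n v g = F.single f (hilb_family.single UNIV (Hn f) n (embed (N f n) v)) g"
  proof (cases "g \<in> PF")
    case True
    then show ?thesis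
      using f semi_inner.hzero_embed[OF semi_inner_reg]
      by (cases "g = f")
        (auto simp: svec_def reg_vec_def F.single_apply hzero_Hf hilb_family.single_def[OF family_n]
          reg_summand_def restrict_def intro!: HOL.ext)
  qed (simp add: svec_def reg_vec_def F.single_def)
qed

lemma embed_in_Hn: "f \<in> PF \<Longrightarrow> embed (N f n) v \<in> hcarrier (Hn f n)"
  by (simp add: reg_summand_def semi_inner.carrier_G[OF semi_inner_reg]
      seminormed.embed_in[OF semi_inner.seminormed_P[OF semi_inner_reg]])

lemma svec_in [simp, intro]: "f \<in> PF \<Longrightarrow> svec f n v \<in> hcarrier H"
  unfolding H_eq svec_eq_single
  by (intro F.single_in hilb_family.single_in[OF family_n] embed_in_Hn) auto

lemma inner_svec:
  assumes f: "f \<in> PF" and y: "y \<in> hcarrier H"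
  shows "hinner H (svec f n v) y = hinner (Hn f n) (embed (N f n) v) (y f n)"
proof -
  have y': "y \<in> hcarrier F.S" using y by (simp add: H_eq)
  have s: "hilb_family.single UNIV (Hn f) n (embed (N f n) v) \<in> hcarrier (Hf f)"
    by (intro hilb_family.single_in[OF family_n[OF f]] embed_in_Hn f) auto
  show ?thesis
    unfolding H_eq svec_eq_single[OF f] F.inner_single[OF f s y']
    by (rule hilb_family.inner_single[OF family_n[OF f] _ embed_in_Hn[OF f] F.in_SD[OF y' f]]) simp
qed

lemma svec_apply: "g \<in> PF \<Longrightarrow> svec f n v g m = embed (N g m) (if g = f \<and> m = n then v else 0)"
  by (simp add: svec_def reg_vec_def)

lemma inner_svec_svec:
  assumes f: "f \<in> PF" and g: "g \<in> PF"
  shows "hinner H (svec f n v) (svec g m u) = (if f = g \<and> n = m then ip f n v u else 0)"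
  unfolding inner_svec[OF f svec_in[OF g]] svec_apply[OF f] reg_summand_def
    semi_inner.inner_embed[OF semi_inner_reg[OF f]]
  using semi_inner.ip_scale_right[OF semi_inner_reg[OF f], of n v 0 0] by (auto simp: ip_def)

lemma total_svec: "R.total {svec f n v |f n v. f \<in> PF}"
proof -
  have "F.S.total (\<Union>f\<in>PF. F.single f ` (\<Union>n\<in>UNIV. hilb_family.single UNIV (Hn f) n ` range (embed (N f n))))"
  proof (rule F.total_single)
    fix f assume f: "f \<in> PF"
    show "hilb.total (Hf f) (\<Union>n\<in>UNIV. hilb_family.single UNIV (Hn f) n ` range (embed (N f n)))"
      by (rule hilb_family.total_single[OF family_n[OF f]])
        (simp add: reg_summand_def semi_inner.total_embed[OF semi_inner_reg[OF f]])
  qed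
  moreover have "(\<Union>f\<in>PF. F.single f ` (\<Union>n\<in>UNIV. hilb_family.single UNIV (Hn f) n ` range (embed (N f n))))
      = {svec f n v |f n v. f \<in> PF}"
  proof (intro equalityI subsetI)
    fix x assume "x \<in> {svec f n v |f n v. f \<in> PF}"
    then obtain f n v where f: "f \<in> PF" and x: "x = svec f n v" by blast
    show "x \<in> (\<Union>f\<in>PF. F.single f ` (\<Union>n\<in>UNIV. hilb_family.single UNIV (Hn f) n ` range (embed (N f n))))"
      unfolding x svec_eq_single[OF f] by (intro UN_I[OF f] imageI UN_I[of n] rangeI UNIV_I)
  next
    fix x assume "x \<in> (\<Union>f\<in>PF. F.single f ` (\<Union>n\<in>UNIV. hilb_family.single UNIV (Hn f) n ` range (embed (N f n))))"
    then obtain f n v where f: "f \<in> PF" and "x = F.single f (hilb_family.single UNIV (Hn f) n (embed (N f n) v))"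
      by blast
    then have "x = svec f n v" by (simp only: svec_eq_single)
    then show "x \<in> {svec f n v |f n v. f \<in> PF}" using f by blast
  qed
  ultimately show ?thesis by (simp add: H_eq)
qed

lemma svec_eqI: "null f n (v - w) \<Longrightarrow> f \<in> PF \<Longrightarrow> svec f n v = svec f n w"
proof -
  assume 0: "null f n (v - w)" and f: "f \<in> PF"
  have "N f n (v - w) = 0" using 0 by (simp add: null_def ip_def inner_seminorm_def)
  then have "embed (N f n) v = embed (N f n) w"
    by (simp add: seminormed.embed_eq_iff[OF semi_inner.seminormed_P[OF semi_inner_reg[OF f]]])
  then show ?thesis by (simp add: svec_eq_single[OF f])
qed

lemma reg_vec_in:
  assumes f: "f \<in> PF" and h: "finite {n. h n \<noteq> 0}"
  shows "reg_vec \<delta> \<delta>s f h \<in> hcarrier H"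
proof -
  interpret Ff: hilb_family UNIV "Hn f" by (rule family_n[OF f])
  have "(\<lambda>n. embed (N f n) (h n)) \<in> hcarrier (Hf f)"
    unfolding Ff.in_S_iff
  proof (intro conjI ballI)
    have "(\<lambda>n. (hnorm (Hn f n) (embed (N f n) (h n)))\<^sup>2) summable_on {n. h n \<noteq> 0}" using h by simp
    then show "(\<lambda>n. (hnorm (Hn f n) (embed (N f n) (h n)))\<^sup>2) summable_on UNIV"
    proof (rule summable_on_cong_neutral[THEN iffD1, rotated -1])
      fix n assume "n \<in> UNIV - {n. h n \<noteq> 0}"
      then have "embed (N f n) (h n) = hilb.hzero (Hn f n)"
        using semi_inner.hzero_embed[OF semi_inner_reg[OF f]] by (simp add: reg_summand_def)
      then show "(hnorm (Hn f n) (embed (N f n) (h n)))\<^sup>2 = 0"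
        by (simp add: hilb.hnorm_hzero[OF Ff.hilb_K])
    qed auto
  qed (use f in \<open>auto simp: embed_in_Hn\<close>)
  moreover have "reg_vec \<delta> \<delta>s f h = F.single f (\<lambda>n. embed (N f n) (h n))"
    unfolding reg_vec_def F.single_def by (rule restrict_ext) (auto simp: hzero_Hf)
  ultimately show ?thesis unfolding H_eq using F.single_in[OF f] by simp
qed


subsection \<open>Weighted shifts\<close>

text \<open>All operators in question, including the projections onto the degrees, are weighted shifts:
  the \<open>n\<close>-th component of the image is \<open>\<phi> n\<close> applied to the \<open>(n - k)\<close>-th component.\<close>

definition shift :: "int \<Rightarrow> (int \<Rightarrow> 'a \<Rightarrow> 'a) \<Rightarrow> 'a reg_vector \<Rightarrow> 'a reg_vector" where
  "shift k \<phi> = (\<lambda>x\<in>hcarrier H. \<lambda>g\<in>PF. \<lambda>n. cmap (N g n) (\<phi> n) (x g (n - k)))"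

definition weights :: "int \<Rightarrow> real \<Rightarrow> (int \<Rightarrow> 'a \<Rightarrow> 'a) \<Rightarrow> bool" where
  "weights k K \<phi> \<longleftrightarrow> K \<ge> 0 \<and> (\<forall>n v w. \<phi> n (v + w) = \<phi> n v + \<phi> n w) \<and> (\<forall>n c v. \<phi> n (c *\<^sub>C v) = c *\<^sub>C \<phi> n v) \<and>
     (\<forall>f\<in>PF. \<forall>n v. Re (ip f n (\<phi> n v) (\<phi> n v)) \<le> K\<^sup>2 * Re (ip f (n - k) v v))"

context
  fixes k K \<phi>
  assumes w: "weights k K \<phi>"
begin

lemma weight_zero: "\<phi> n 0 = 0"
proof -
  have "\<phi> n (0 *\<^sub>C 0) = 0 *\<^sub>C \<phi> n 0" using w unfolding weights_def by blast
  then show ?thesis by simp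
qed

lemma weight_cmap:
  assumes g: "g \<in> PF"
  shows "bdd_map (Hn g (n - k)) (Hn g n) K (cmap (N g n) (\<phi> n))"
    "cmap (N g n) (\<phi> n) (embed (N g (n - k)) v) = embed (N g n) (\<phi> n v)"
  using bdd_map_cmap[OF semi_inner_reg[OF g] semi_inner_reg[OF g], of "\<phi> n" n K "n - k"] w g
  unfolding weights_def reg_summand_def ip_def by blast+

lemma shift_bdd: "bdd_map H H K (shift k \<phi>)"
proof -
  have "bdd_map (Hf g) (Hf g) K (\<lambda>x. \<lambda>n\<in>UNIV. cmap (N g n) (\<phi> n) (x (n - k)))" if g: "g \<in> PF" for g
  proof (rule bdd_map_sum[OF family_n[OF g]])
    show "bij_betw (\<lambda>n. n - k) UNIV UNIV"
      by (rule bij_betwI[where g = "\<lambda>n. n + k"]) auto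
  qed (use w weight_cmap(1)[OF g] in \<open>auto simp: weights_def\<close>)
  then have "bdd_map F.S F.S K (\<lambda>x. \<lambda>g\<in>PF. (\<lambda>y. \<lambda>n\<in>UNIV. cmap (N g n) (\<phi> n) (y (n - k))) (x g))"
    using bdd_map_sum[OF family_f bij_betw_id, of K "\<lambda>g y. \<lambda>n\<in>UNIV. cmap (N g n) (\<phi> n) (y (n - k))"] w
    by (simp add: weights_def)
  then have "bdd_map H H K (\<lambda>x. \<lambda>g\<in>PF. \<lambda>n. cmap (N g n) (\<phi> n) (x g (n - k)))"
    by (simp add: H_eq restrict_def)
  then show ?thesis
    by (rule bdd_map_cong[THEN iffD1, rotated -1]) (auto simp: shift_def R.hilb_axioms)
qed

lemma shift_in: "shift k \<phi> \<in> bounded_ops H"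
  by (rule R.bounded_opsI[OF _ shift_bdd]) (simp add: shift_def)

lemma shift_reg_vec:
  assumes f: "f \<in> PF" and h: "finite {n. h n \<noteq> 0}"
  shows "shift k \<phi> (reg_vec \<delta> \<delta>s f h) = reg_vec \<delta> \<delta>s f (\<lambda>n. \<phi> n (h (n - k)))"
  using reg_vec_in[OF f h] weight_cmap(2) weight_zero
  by (auto simp: shift_def reg_vec_def fun_eq_iff)

lemma shift_svec:
  assumes f: "f \<in> PF"
  shows "shift k \<phi> (svec f n v) = svec f (n + k) (\<phi> (n + k) v)"
proof -
  have eq: "(\<lambda>m. \<phi> m (if m - k = n then v else 0)) = (\<lambda>m. if m = n + k then \<phi> (n + k) v else 0)"
    by (auto simp: weight_zero)
  have "finite {m. (if m = n then v else 0) \<noteq> 0}" by (rule finite_subset[of _ "{n}"]) auto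
  then show ?thesis unfolding svec_def shift_reg_vec[OF f] eq by (simp add: shift_reg_vec[OF f] eq)
qed

lemma shift_continuous_extension:
  assumes "\<And>h n. \<Phi> h n = \<phi> n (h (n - k))"
  shows "continuous_extension \<delta> \<delta>s \<Phi> T \<longleftrightarrow> T = shift k \<phi>"
proof
  have \<Phi>: "\<Phi> h = (\<lambda>n. \<phi> n (h (n - k)))" for h using assms by blast
  show "continuous_extension \<delta> \<delta>s \<Phi> T" if "T = shift k \<phi>"
    unfolding that continuous_extension_def \<Phi> using shift_in shift_reg_vec by blast
  assume T: "continuous_extension \<delta> \<delta>s \<Phi> T"
  show "T = shift k \<phi>"
  proof (rule R.bounded_ops_eqI[OF _ shift_in total_svec])
    show "T \<in> bounded_ops H" using T by (simp add: continuous_extension_def)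
    fix d assume "d \<in> {svec f n v |f n v. f \<in> PF}"
    then obtain f n v where d: "d = svec f n v" "f \<in> PF" by blast
    have fin: "finite {m. (if m = n then v else 0) \<noteq> 0}" by (rule finite_subset[of _ "{n}"]) auto
    have "T d = reg_vec \<delta> \<delta>s f (\<Phi> (\<lambda>m. if m = n then v else 0))"
      unfolding d(1) svec_def
      by (rule mp[OF spec[OF bspec[OF conjunct2[OF T[unfolded continuous_extension_def]] d(2)]] fin])
    also have "\<dots> = shift k \<phi> d" unfolding \<Phi> d(1) svec_def by (rule shift_reg_vec[OF d(2) fin, symmetric])
    finally show "T d = shift k \<phi> d" .
  qed
qed

end

lemma weights_uc: "weights 1 1 uc"
  by (simp add: weights_def uc_linear uc_bound)

lemma weights_usc: "weights (- 1) 1 usc"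
  by (simp add: weights_def usc_linear usc_bound)

lemma weights_pc: "weights 0 (norm a) (pc a)"
  by (simp add: weights_def pc_linear pc_bound)

abbreviation U where "U \<equiv> reg_U \<delta> \<delta>s"
abbreviation Us where "Us \<equiv> reg_Ustar \<delta> \<delta>s"
abbreviation \<pi> where "\<pi> \<equiv> reg_pi \<delta> \<delta>s"

lemma U_ext: "continuous_extension \<delta> \<delta>s (U_formula \<delta>) T \<longleftrightarrow> T = shift 1 uc"
  by (rule shift_continuous_extension[OF weights_uc]) (rule U_formula_uc)

lemma Us_ext: "continuous_extension \<delta> \<delta>s (Ustar_formula \<delta> \<delta>s) T \<longleftrightarrow> T = shift (- 1) usc"
  by (rule shift_continuous_extension[OF weights_usc]) (simp add: Ustar_formula_usc)

lemma pi_ext: "continuous_extension \<delta> \<delta>s (pi_formula \<delta> a) T \<longleftrightarrow> T = shift 0 (pc a)"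
  by (rule shift_continuous_extension[OF weights_pc]) (simp add: pi_formula_pc)

lemma U_shift: "U = shift 1 uc" and Us_shift: "Us = shift (- 1) usc" and pi_shift: "\<pi> a = shift 0 (pc a)"
  by (simp_all add: reg_U_def reg_Ustar_def reg_pi_def U_ext Us_ext pi_ext)

lemma U_in [simp]: "U \<in> bounded_ops H" and Us_in [simp]: "Us \<in> bounded_ops H" and pi_in [simp]: "\<pi> a \<in> bounded_ops H"
  by (auto simp: U_shift Us_shift pi_shift intro: shift_in weights_uc weights_usc weights_pc)

lemma U_svec: "f \<in> PF \<Longrightarrow> U (svec f n v) = svec f (n + 1) (uc (n + 1) v)"
  by (simp add: U_shift shift_svec[OF weights_uc])

lemma Us_svec: "f \<in> PF \<Longrightarrow> Us (svec f n v) = svec f (n - 1) (usc (n - 1) v)"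
  by (simp add: Us_shift shift_svec[OF weights_usc])

lemma pi_svec: "f \<in> PF \<Longrightarrow> \<pi> a (svec f n v) = svec f n (pc a n v)"
  by (simp add: pi_shift shift_svec[OF weights_pc])

lemma op_eq_svec:
  assumes "S \<in> bounded_ops H" "T \<in> bounded_ops H" "\<And>f n v. f \<in> PF \<Longrightarrow> S (svec f n v) = T (svec f n v)"
  shows "S = T"
  by (rule R.bounded_ops_eqI[OF assms(1,2) total_svec]) (use assms(3) in auto)

lemma U_adjoint: "mutually_adjoint H U Us"
  by (rule R.mutually_adjointI[OF U_in Us_in total_svec])
    (auto simp: U_svec Us_svec inner_svec_svec uc_adjoint)

lemma pi_adjoint: "mutually_adjoint H (\<pi> a) (\<pi> (star a))"
  by (rule R.mutually_adjointI[OF pi_in pi_in total_svec])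
    (auto simp: pi_svec inner_svec_svec pc_adjoint)

lemma svec_plus: "f \<in> PF \<Longrightarrow> hplus H (svec f n v) (svec f n w) = svec f n (v + w)"
  using semi_inner.plus_embed[OF semi_inner_reg]
  by (auto simp: H_eq hilbert_sum_def svec_def reg_vec_def fun_eq_iff reg_summand_def)

lemma svec_scale: "f \<in> PF \<Longrightarrow> hscale H c (svec f n v) = svec f n (c *\<^sub>C v)"
  using semi_inner.scale_embed[OF semi_inner_reg]
  by (auto simp: H_eq hilbert_sum_def svec_def reg_vec_def fun_eq_iff reg_summand_def)

lemma svec_zero: "f \<in> PF \<Longrightarrow> svec f n 0 = R.hzero"
  using svec_scale[of f 0 n 0] by simp

lemma pi_add: "\<pi> (a + b) = R.op_plus (\<pi> a) (\<pi> b)"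
  by (rule op_eq_svec) (auto simp: pi_svec svec_plus pc_add)

lemma pi_scale: "\<pi> (c *\<^sub>C a) = R.op_scale c (\<pi> a)"
  by (rule op_eq_svec) (auto simp: pi_svec svec_scale pc_scaleC)

lemma pi_mult: "\<pi> (a * b) = op_comp H (\<pi> a) (\<pi> b)"
  by (rule op_eq_svec) (auto simp: pi_svec pc_mult)

lemma pi_one: "\<pi> 1 = R.op_id"
  by (rule op_eq_svec) (auto simp: pi_svec intro: svec_eqI pc_one_null)

lemma U_pi_Us: "op_comp H U (op_comp H (\<pi> a) Us) = \<pi> (\<delta> a)"
proof (rule op_eq_svec)
  fix f n v assume f: "f \<in> PF"
  show "op_comp H U (op_comp H (\<pi> a) Us) (svec f n v) = \<pi> (\<delta> a) (svec f n v)"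
    using f svec_eqI[OF uc_pc_usc_null[OF f]] by (simp add: U_svec Us_svec pi_svec)
qed simp_all

lemma Us_pi_U: "op_comp H Us (op_comp H (\<pi> a) U) = \<pi> (\<delta>s a)"
  by (rule op_eq_svec) (auto simp: U_svec Us_svec pi_svec usc_pc_uc)

lemma U_pi: "op_comp H U (\<pi> a) = op_comp H (\<pi> (\<delta> a)) U"
proof (rule op_eq_svec)
  fix f n v assume f: "f \<in> PF"
  show "op_comp H U (\<pi> a) (svec f n v) = op_comp H (\<pi> (\<delta> a)) U (svec f n v)"
    using f uc_pc[of "n + 1" a v] by (simp add: U_svec pi_svec)
qed simp_all

lemma hnorm_svec: "f \<in> PF \<Longrightarrow> (hnorm H (svec f n v))\<^sup>2 = Re (ip f n v v)"
  by (simp add: R.hnorm_sq inner_svec_svec)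

lemma star_representation_pi: "star_representation type_algebra H \<pi>"
  unfolding star_representation_def type_algebra_def
  by (auto simp: pi_add pi_scale pi_mult pi_adjoint)

text \<open>The cyclic vector of a state that attains the norm of \<open>a\<close> shows that \<open>\<pi>\<close> preserves norms.\<close>

lemma norming_vector:
  obtains f where "f \<in> PF" "hnorm H (svec f 0 1) \<le> 1" "hnorm H (\<pi> a (svec f 0 1)) = norm a"
proof -
  obtain f where f: "f \<in> PF" "f (star a * a) = (norm a)\<^sup>2" "Re (f 1) \<le> 1"
    using state_attaining_norm by blast
  have "(hnorm H (svec f 0 1))\<^sup>2 \<le> 1\<^sup>2" using f by (simp add: hnorm_svec ip_nonneg)
  then have "hnorm H (svec f 0 1) \<le> 1" by (rule power2_le_imp_le) simp
  moreover have "(hnorm H (\<pi> a (svec f 0 1)))\<^sup>2 = (norm a)\<^sup>2"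
    using f by (simp add: pi_svec hnorm_svec ip_nonneg pc_def)
  then have "hnorm H (\<pi> a (svec f 0 1)) = norm a"
    by (rule power2_eq_imp_eq) (use f in \<open>auto intro!: R.hnorm_nonneg R.bounded_opsD(1)[OF pi_in] svec_in\<close>)
  ultimately show ?thesis using that f by blast
qed

lemma faithful_pi: "faithful type_algebra \<pi>"
  unfolding faithful_def
proof (rule inj_onI)
  fix a b assume ab: "\<pi> a = \<pi> b"
  obtain f where f: "f \<in> PF" "hnorm H (\<pi> (a - b) (svec f 0 1)) = norm (a - b)"
    using norming_vector by blast
  have "\<pi> (a - b) = R.op_plus (\<pi> a) (R.op_scale (- 1) (\<pi> b))"
    using pi_add[of a "(- 1) *\<^sub>C b"] by (simp add: pi_scale[symmetric] scaleC_minus_left)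
  then have "hnorm H (\<pi> (a - b) (svec f 0 1)) = 0"
    using f(1) R.bounded_opsD(1)[OF pi_in] by (simp add: ab)
  then show "a = b" using f by simp
qed

lemma nondegenerate_pi: "nondegenerate type_algebra H \<pi>"
  unfolding nondegenerate_def
proof (intro allI impI)
  fix M assume M: "closed_subspace H M \<and> (\<forall>x\<in>acarrier type_algebra. \<forall>h\<in>hcarrier H. \<pi> x h \<in> M)"
  then have "\<pi> 1 h \<in> M" if "h \<in> hcarrier H" for h using that by (simp add: type_algebra_def)
  then show "M = hcarrier H" using M R.closed_subspaceD(1)[of M] by (auto simp: pi_one)
qed


subsection \<open>Projections onto the degrees\<close>

definition pj :: "int \<Rightarrow> 'a reg_vector \<Rightarrow> 'a reg_vector" where
  "pj j = shift 0 (\<lambda>n v. if n = j then v else 0)"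

lemma weights_pj: "weights 0 1 (\<lambda>n v. if n = j then v else 0)"
  using ip_pos by (auto simp: weights_def ip_scale_left[of _ _ 0 0, simplified])

lemma pj_in [simp]: "pj j \<in> bounded_ops H"
  unfolding pj_def by (rule shift_in[OF weights_pj])

lemma pj_contraction: "x \<in> hcarrier H \<Longrightarrow> hnorm H (pj j x) \<le> hnorm H x"
  using bdd_mapD(2)[OF shift_bdd[OF weights_pj]] by (simp add: pj_def)

lemma pj_svec: "f \<in> PF \<Longrightarrow> pj j (svec f n v) = (if n = j then svec f n v else R.hzero)"
  unfolding pj_def by (simp add: shift_svec[OF weights_pj] svec_zero)

lemma bounded_hzero [simp]: "T \<in> bounded_ops H \<Longrightarrow> T R.hzero = R.hzero"
  by (metis R.bounded_opsD(1,3) R.hzero_in R.scale_zero)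

lemma pj_U: "op_comp H (pj (j + 1)) U = op_comp H U (pj j)"
  by (rule op_eq_svec) (auto simp: pj_svec U_svec)

lemma pj_Us: "op_comp H (pj (j - 1)) Us = op_comp H Us (pj j)"
  by (rule op_eq_svec) (auto simp: pj_svec Us_svec)

lemma pj_pi: "op_comp H (pj j) (\<pi> a) = op_comp H (\<pi> a) (pj j)"
  by (rule op_eq_svec) (auto simp: pj_svec pi_svec)

lemma pj_pj: "x \<in> hcarrier H \<Longrightarrow> pj i (pj j x) = (if i = j then pj j x else R.hzero)"
proof -
  assume x: "x \<in> hcarrier H"
  have "op_comp H (pj i) (pj j) = (if i = j then pj j else R.op_scale 0 (pj j))"
    by (rule op_eq_svec) (auto simp: pj_svec)
  then have "op_comp H (pj i) (pj j) x = (if i = j then pj j else R.op_scale 0 (pj j)) x" by simp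
  then show ?thesis using x R.bounded_opsD(1)[OF pj_in x] by (auto split: if_splits)
qed

end


section \<open>The free *-algebra and its C*-seminorms\<close>

abbreviation fterm :: "'g word \<Rightarrow> complex \<Rightarrow> 'g free_star" where
  "fterm \<equiv> Poly_Mapping.single"

definition adj_word :: "'g word \<Rightarrow> 'g word" where
  "adj_word w = Word (rev (map flip_letter (letters w)))"

lemma flip_flip [simp]: "flip_letter (flip_letter l) = l"
  by (cases l) auto

lemma adj_word_simps [simp]:
  "adj_word (u + v) = adj_word v + adj_word u" "adj_word (adj_word u) = u" "adj_word 0 = 0"
  by (simp_all add: adj_word_def plus_word_def zero_word_def rev_map comp_def)

lemma sum_fterms: "x = (\<Sum>w\<in>Poly_Mapping.keys x. fterm w (Poly_Mapping.lookup x w))"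
  by (rule poly_mapping_eqI) (auto simp: lookup_sum lookup_single when_def not_in_keys_iff_lookup_eq_zero)

lemma free_induct [case_names fterm add]:
  fixes x :: "'g free_star"
  assumes "\<And>w c. P (fterm w c)" "\<And>x y. P x \<Longrightarrow> P y \<Longrightarrow> P (x + y)"
  shows "P x"
proof -
  have x: "x = (\<Sum>w\<in>Poly_Mapping.keys x. fterm w (Poly_Mapping.lookup x w))" by (rule sum_fterms)
  have P0: "P 0" using assms(1)[of 0 0] by simp
  have "P (\<Sum>w\<in>A. fterm w (f w))" if "finite A" for A f
    using that by (induction A rule: finite_induct) (auto intro: assms P0)
  then show ?thesis using x by (metis finite_keys)
qed

lemma sum_keys_fterm:
  assumes "g w 0 = 0"
  shows "(\<Sum>v\<in>Poly_Mapping.keys (fterm w c). g v (Poly_Mapping.lookup (fterm w c) v)) = g w c"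
  using assms by (cases "c = 0") auto

lemma free_adj_fterm: "free_adj (fterm w c) = fterm (adj_word w) (cnj c)"
  unfolding free_adj_def adj_word_def[symmetric]
  by (rule sum_keys_fterm[where g = "\<lambda>w c. fterm (adj_word w) (cnj c)"]) simp

lemma free_adj_add: "free_adj (x + y) = free_adj x + free_adj y"
  unfolding free_adj_def adj_word_def[symmetric]
  by (rule setsum_keys_plus_distrib) (simp_all add: single_add)

lemma free_adj_zero [simp]: "free_adj 0 = 0"
  by (simp add: free_adj_def)

lemma free_adj_adj [simp]: "free_adj (free_adj x) = x"
  by (induction x rule: free_induct) (simp_all add: free_adj_fterm free_adj_add)

lemma free_adj_mult: "free_adj (x * y) = free_adj y * free_adj x"
proof (induction x rule: free_induct)
  case (fterm w c)
  show ?case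
    by (induction y rule: free_induct)
      (simp_all add: mult_single free_adj_fterm free_adj_add distrib_left distrib_right mult.commute)
qed (simp add: free_adj_add distrib_left distrib_right)

lemma free_adj_minus: "free_adj (- x) = - free_adj x"
  using free_adj_add[of x "- x"] by (simp add: eq_neg_iff_add_eq_0 add.commute)

lemma free_adj_diff: "free_adj (x - y) = free_adj x - free_adj y"
  using free_adj_add[of x "- y"] by (simp add: free_adj_minus)

lemma free_adj_one [simp]: "free_adj 1 = 1"
  using free_adj_fterm[of 0 1] by simp

lemma free_scale_minus_one: "free_scale (- 1) x = - x"
  by (simp add: free_scale_def single_uminus)

lemma free_scale_fterm: "free_scale c (fterm w d) = fterm w (c * d)"
  by (simp add: free_scale_def mult_single)

lemma free_scale_diff: "free_scale c (x - y) = free_scale c x - free_scale c y"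
  by (simp add: free_scale_def right_diff_distrib)

locale cstar_sn =
  fixes p :: "'g free_star \<Rightarrow> real"
  assumes cstar: "cstar_seminorm p"
begin

lemma p_triangle: "p (x + y) \<le> p x + p y"
  and p_scale: "p (free_scale c x) = cmod c * p x"
  and p_mult: "p (x * y) \<le> p x * p y"
  and p_cstar: "p (free_adj x * x) = (p x)\<^sup>2"
  and p_pos: "0 \<le> p x"
  using cstar by (auto simp: cstar_seminorm_def)

sublocale seminormed p
proof
  show "p 0 = 0" using p_scale[of 0 0] by (simp add: free_scale_def)
  show "p (- x) = p x" for x using p_scale[of "- 1" x] by (simp add: free_scale_minus_one)
qed (rule p_triangle)

lemma p_adj: "p (free_adj x) = p x"
proof -
  have le: "p x \<le> p (free_adj x)" for x
  proof (cases "p x = 0")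
    case False
    then have "p x > 0" using p_pos[of x] by simp
    moreover have "p x * p x \<le> p (free_adj x) * p x"
      using p_mult[of "free_adj x" x] by (simp add: p_cstar power2_eq_square)
    ultimately show ?thesis by simp
  qed (simp add: p_pos)
  show ?thesis using le[of x] le[of "free_adj x"] by simp
qed

lemma p_cstar': "p (x * free_adj x) = (p x)\<^sup>2"
  using p_cstar[of "free_adj x"] by (simp add: p_adj)

lemma p_one: "p 1 \<le> 1"
proof -
  have "p 1 = (p 1)\<^sup>2" using p_cstar[of 1] by simp
  then have "p 1 = 0 \<or> p 1 = 1" by (simp add: power2_eq_square)
  then show ?thesis by auto
qed

lemma p_mult_left_0: "p x = 0 \<Longrightarrow> p (y * x) = 0"
  using p_mult[of y x] p_pos[of "y * x"] by simp

lemma p_mult_right_0: "p x = 0 \<Longrightarrow> p (x * y) = 0"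
  using p_mult[of x y] p_pos[of "x * y"] by simp

end


section \<open>Reduction of words in the crossed product\<close>

context transfer_system
begin

text \<open>The norms pulled back from realisations of the relations in C*-algebras.\<close>

definition admissible :: "('a cp_gen free_star \<Rightarrow> real) \<Rightarrow> bool" where
  "admissible p \<longleftrightarrow> cstar_seminorm p \<and> (\<forall>r\<in>cp_relators \<delta> \<delta>s. p r = 0)"

text \<open>Equality in all realisations of the relations. The reductions below have to hold for all of them at
  once, since the regular one is compared with an arbitrary one.\<close>

definition eqv :: "'a cp_gen free_star \<Rightarrow> 'a cp_gen free_star \<Rightarrow> bool" (infix "\<doteq>" 50) where
  "x \<doteq> y \<longleftrightarrow> (\<forall>p. admissible p \<longrightarrow> p (x - y) = 0)"

lemma admissible_sn: "admissible p \<Longrightarrow> cstar_sn p"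
  by (simp add: admissible_def cstar_sn_def)

lemma eqvD: "x \<doteq> y \<Longrightarrow> admissible p \<Longrightarrow> p (x - y) = 0"
  by (simp add: eqv_def)

lemma eqv_refl [simp]: "x \<doteq> x"
proof -
  have "p (x - x) = 0" if p: "admissible p" for p
  proof -
    interpret cstar_sn p by (rule admissible_sn[OF p])
    show ?thesis by (simp add: p_zero)
  qed
  then show ?thesis by (simp add: eqv_def)
qed

lemma eqv_sym: "x \<doteq> y \<Longrightarrow> y \<doteq> x"
proof -
  assume xy: "x \<doteq> y"
  have "p (y - x) = 0" if p: "admissible p" for p
  proof -
    interpret cstar_sn p by (rule admissible_sn[OF p])
    show ?thesis using xy p by (simp add: eqv_def p_diff_commute[of y x])
  qed
  then show ?thesis by (simp add: eqv_def)
qed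

lemma eqv_trans [trans]: "x \<doteq> y \<Longrightarrow> y \<doteq> z \<Longrightarrow> x \<doteq> z"
proof -
  assume xy: "x \<doteq> y" and yz: "y \<doteq> z"
  have "p (x - z) = 0" if p: "admissible p" for p
  proof -
    interpret cstar_sn p by (rule admissible_sn[OF p])
    show ?thesis using eqvD[OF xy p] eqvD[OF yz p] p_diff_triangle[of x z y] p_pos[of "x - z"] by simp
  qed
  then show ?thesis by (simp add: eqv_def)
qed

lemma eqv_add: "x \<doteq> x' \<Longrightarrow> y \<doteq> y' \<Longrightarrow> x + y \<doteq> x' + y'"
proof -
  assume xy: "x \<doteq> x'" "y \<doteq> y'"
  have "p (x + y - (x' + y')) = 0" if p: "admissible p" for p
  proof -
    interpret cstar_sn p by (rule admissible_sn[OF p])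
    show ?thesis using eqvD[OF xy(1) p] eqvD[OF xy(2) p] p_add_diff[of x y x' y'] p_pos[of "x + y - (x' + y')"] by simp
  qed
  then show ?thesis by (simp add: eqv_def)
qed

lemma eqv_mult: "x \<doteq> x' \<Longrightarrow> y \<doteq> y' \<Longrightarrow> x * y \<doteq> x' * y'"
proof -
  assume xy: "x \<doteq> x'" "y \<doteq> y'"
  have "p (x * y - x' * y') = 0" if p: "admissible p" for p
  proof -
    interpret cstar_sn p by (rule admissible_sn[OF p])
    have "x * y - x' * y' = (x - x') * y + x' * (y - y')" by (simp add: algebra_simps)
    moreover have "p ((x - x') * y) = 0" "p (x' * (y - y')) = 0"
      using xy p by (auto simp: eqv_def p_mult_left_0 p_mult_right_0)
    ultimately show ?thesis
      using p_triangle[of "(x - x') * y" "x' * (y - y')"] p_pos[of "x * y - x' * y'"] by simp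
  qed
  then show ?thesis by (simp add: eqv_def)
qed

lemma eqv_mult_left: "y \<doteq> y' \<Longrightarrow> x * y \<doteq> x * y'"
  by (rule eqv_mult) simp_all

lemma eqv_mult_right: "x \<doteq> x' \<Longrightarrow> x * y \<doteq> x' * y"
  by (rule eqv_mult) simp_all

lemma eqv_adj: "x \<doteq> y \<Longrightarrow> free_adj x \<doteq> free_adj y"
proof -
  assume xy: "x \<doteq> y"
  have "p (free_adj x - free_adj y) = 0" if p: "admissible p" for p
  proof -
    interpret cstar_sn p by (rule admissible_sn[OF p])
    show ?thesis using xy p p_adj[of "x - y"] by (simp add: eqv_def free_adj_diff)
  qed
  then show ?thesis by (simp add: eqv_def)
qed

lemma eqv_scale: "x \<doteq> y \<Longrightarrow> free_scale c x \<doteq> free_scale c y"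
  unfolding free_scale_def by (rule eqv_mult_left)

lemma eqv_relator: "x - y \<in> cp_relators \<delta> \<delta>s \<Longrightarrow> x \<doteq> y"
  by (auto simp: eqv_def admissible_def)

lemma eqv_p_eq:
  assumes "x \<doteq> y" "admissible p"
  shows "p x = p y"
proof -
  interpret cstar_sn p by (rule admissible_sn) fact
  show ?thesis using abs_p_diff[of x y] eqvD[OF assms] by simp
qed

abbreviation c where "c a \<equiv> gen (Coeff a)"
abbreviation V where "V \<equiv> gen PIso"
abbreviation V' where "V' \<equiv> free_adj (gen PIso)"

lemma c_add: "c (a + b) \<doteq> c a + c b"
  and c_scale: "c (z *\<^sub>C a) \<doteq> free_scale z (c a)"
  and c_mult: "c (a * b) \<doteq> c a * c b"
  and c_star: "c (star a) \<doteq> free_adj (c a)"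
  and c_one: "c 1 \<doteq> 1"
  and V_c_V': "V * c a * V' \<doteq> c (\<delta> a)"
  and V'_c_V: "V' * c a * V \<doteq> c (\<delta>s a)"
  by (rule eqv_relator, unfold cp_relators_def coeff_relators_def covariance_relators_def, blast)+

lemma V_V': "V * V' \<doteq> c (\<delta> 1)"
proof -
  have "V * V' \<doteq> V * c 1 * V'"
    using eqv_mult_right[OF eqv_mult_left[OF eqv_sym[OF c_one]], of V V'] by simp
  also note V_c_V'
  finally show ?thesis .
qed

text \<open>The relation \<open>U a = \<delta>(a) U\<close> is not among the defining ones; for the difference \<open>z\<close> of its two
  sides, \<open>z z\<^sup>*\<close> vanishes by the others.\<close>

lemma V_c: "V * c a \<doteq> c (\<delta> a) * V"
proof -
  define z where "z = V * c a - c (\<delta> a) * V"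
  have "z * free_adj z = V * c a * (free_adj (c a) * V') + - (V * c a * V' * free_adj (c (\<delta> a)))
      + (- (c (\<delta> a) * (V * free_adj (c a) * V')) + c (\<delta> a) * (V * V') * free_adj (c (\<delta> a)))"
    by (simp add: z_def free_adj_diff free_adj_mult algebra_simps)
  also have "\<dots> \<doteq> c (\<delta> (a * star a)) + free_scale (- 1) (c (\<delta> a * \<delta> (star a)))
      + (free_scale (- 1) (c (\<delta> a * \<delta> (star a))) + c (\<delta> a * \<delta> 1 * \<delta> (star a)))"
    unfolding free_scale_minus_one[symmetric]
  proof (intro eqv_add eqv_scale)
    have "V * c a * (free_adj (c a) * V') = V * (c a * free_adj (c a)) * V'" by (simp add: mult.assoc)
    also have "\<dots> \<doteq> V * (c a * c (star a)) * V'"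
      by (intro eqv_mult_right eqv_mult_left eqv_sym[OF c_star])
    also have "\<dots> \<doteq> V * c (a * star a) * V'"
      by (intro eqv_mult_right eqv_mult_left eqv_sym[OF c_mult])
    also note V_c_V'
    finally show "V * c a * (free_adj (c a) * V') \<doteq> c (\<delta> (a * star a))" .
    have st: "free_adj (c (\<delta> a)) \<doteq> c (\<delta> (star a))"
      unfolding delta_star by (rule eqv_sym[OF c_star])
    show "V * c a * V' * free_adj (c (\<delta> a)) \<doteq> c (\<delta> a * \<delta> (star a))"
      using eqv_trans[OF eqv_mult[OF V_c_V' st] eqv_sym[OF c_mult]] .
    have "V * free_adj (c a) * V' \<doteq> V * c (star a) * V'"
      by (intro eqv_mult_right eqv_mult_left eqv_sym[OF c_star])
    also note V_c_V'
    finally show "c (\<delta> a) * (V * free_adj (c a) * V') \<doteq> c (\<delta> a * \<delta> (star a))"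
      using eqv_trans[OF eqv_mult_left eqv_sym[OF c_mult]] by blast
    have "c (\<delta> a) * (V * V') \<doteq> c (\<delta> a * \<delta> 1)"
      using eqv_trans[OF eqv_mult_left[OF V_V'] eqv_sym[OF c_mult]] .
    then show "c (\<delta> a) * (V * V') * free_adj (c (\<delta> a)) \<doteq> c (\<delta> a * \<delta> 1 * \<delta> (star a))"
      using eqv_trans[OF eqv_mult[OF _ st] eqv_sym[OF c_mult]] by blast
  qed
  also have "c (\<delta> (a * star a)) + free_scale (- 1) (c (\<delta> a * \<delta> (star a)))
      + (free_scale (- 1) (c (\<delta> a * \<delta> (star a))) + c (\<delta> a * \<delta> 1 * \<delta> (star a))) = 0"
    by (simp add: free_scale_minus_one delta_mult[symmetric])
  finally have zz: "z * free_adj z \<doteq> 0" .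
  have "p z = 0" if p: "admissible p" for p
  proof -
    interpret cstar_sn p by (rule admissible_sn[OF p])
    show ?thesis using eqv_p_eq[OF zz p] p_cstar'[of z] p_zero by simp
  qed
  then show ?thesis by (simp add: eqv_def z_def)
qed

lemma c_V': "c b * V' \<doteq> V' * c (\<delta> b)"
proof -
  have "c b * V' \<doteq> free_adj (c (star b)) * V'"
    using eqv_mult_right[OF c_star[of "star b"], of V'] by (simp add: star_star)
  also have "free_adj (c (star b)) * V' = free_adj (V * c (star b))" by (simp add: free_adj_mult)
  also have "\<dots> \<doteq> free_adj (c (\<delta> (star b)) * V)" by (rule eqv_adj[OF V_c])
  also have "\<dots> = V' * free_adj (c (\<delta> (star b)))" by (simp add: free_adj_mult)
  also have "\<dots> \<doteq> V' * c (\<delta> b)"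
    using eqv_mult_left[OF eqv_sym[OF c_star[of "\<delta> (star b)"]], of V'] by (simp add: delta_star star_star)
  finally show ?thesis .
qed

lemma c_V'_power: "c b * V' ^ m \<doteq> V' ^ m * c ((\<delta> ^^ m) b)"
proof (induction m arbitrary: b)
  case (Suc m)
  have "c b * V' ^ Suc m = c b * V' * V' ^ m" by (simp add: mult.assoc)
  also have "\<dots> \<doteq> V' * c (\<delta> b) * V' ^ m" by (rule eqv_mult_right[OF c_V'])
  also have "\<dots> = V' * (c (\<delta> b) * V' ^ m)" by (simp add: mult.assoc)
  also have "\<dots> \<doteq> V' * (V' ^ m * c ((\<delta> ^^ m) (\<delta> b)))" by (rule eqv_mult_left[OF Suc.IH])
  finally show ?case by (simp add: funpow_swap1 mult.assoc)
qed simp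

fun letter_degree :: "'x cp_gen letter \<Rightarrow> int" where
  "letter_degree (Gen (Coeff a)) = 0"
| "letter_degree (Adj (Coeff a)) = 0"
| "letter_degree (Gen PIso) = 1"
| "letter_degree (Adj PIso) = - 1"

definition wdeg :: "'x cp_gen word \<Rightarrow> int" where
  "wdeg w = sum_list (map letter_degree (letters w))"

definition normal :: "int \<Rightarrow> 'a \<Rightarrow> 'a cp_gen free_star" where
  "normal k a = (if k \<ge> 0 then c a * V ^ nat k else V' ^ nat (- k) * c a)"

lemma normal_c: "\<exists>a'. c b * normal k a \<doteq> normal k a'"
proof (cases "k \<ge> 0")
  case True
  then have "c b * normal k a \<doteq> normal k (b * a)"
    using eqv_mult_right[OF eqv_sym[OF c_mult[of b a]], of "V ^ nat k"] by (simp add: normal_def mult.assoc)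
  then show ?thesis by blast
next
  case False
  let ?m = "nat (- k)"
  have "c b * normal k a = c b * V' ^ ?m * c a" using False by (simp add: normal_def mult.assoc)
  also have "\<dots> \<doteq> V' ^ ?m * c ((\<delta> ^^ ?m) b) * c a" by (rule eqv_mult_right[OF c_V'_power])
  also have "\<dots> = V' ^ ?m * (c ((\<delta> ^^ ?m) b) * c a)" by (simp add: mult.assoc)
  also have "\<dots> \<doteq> V' ^ ?m * c ((\<delta> ^^ ?m) b * a)" by (rule eqv_mult_left[OF eqv_sym[OF c_mult]])
  also have "\<dots> = normal k ((\<delta> ^^ ?m) b * a)" using False by (simp add: normal_def)
  finally show ?thesis by blast
qed

lemma normal_V: "\<exists>a'. V * normal k a \<doteq> normal (k + 1) a'"
proof (cases "k \<ge> 0")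
  case True
  then have "nat (k + 1) = Suc (nat k)" by simp
  then have "V * normal k a \<doteq> normal (k + 1) (\<delta> a)"
    using eqv_mult_right[OF V_c[of a], of "V ^ nat k"] True by (simp add: normal_def mult.assoc)
  then show ?thesis by blast
next
  case False
  define m where "m = nat (- k - 1)"
  have km: "nat (- k) = Suc m" using False by (simp add: m_def)
  have "V * normal k a = V * V' * (V' ^ m * c a)" using False by (simp add: normal_def km mult.assoc)
  also have "\<dots> \<doteq> c (\<delta> 1) * (V' ^ m * c a)" by (rule eqv_mult_right[OF V_V'])
  also have "\<dots> = c (\<delta> 1) * V' ^ m * c a" by (simp add: mult.assoc)
  also have "\<dots> \<doteq> V' ^ m * c ((\<delta> ^^ m) (\<delta> 1)) * c a" by (rule eqv_mult_right[OF c_V'_power])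
  also have "\<dots> = V' ^ m * (c ((\<delta> ^^ m) (\<delta> 1)) * c a)" by (simp add: mult.assoc)
  also have "\<dots> \<doteq> V' ^ m * c ((\<delta> ^^ m) (\<delta> 1) * a)" by (rule eqv_mult_left[OF eqv_sym[OF c_mult]])
  also have "\<dots> = normal (k + 1) ((\<delta> ^^ m) (\<delta> 1) * a)"
  proof (cases "k = - 1")
    case True
    then show ?thesis by (simp add: normal_def m_def)
  next
    case False
    then have "nat (- (k + 1)) = m" "\<not> k + 1 \<ge> 0" using \<open>\<not> k \<ge> 0\<close> by (auto simp: m_def)
    then show ?thesis by (simp add: normal_def)
  qed
  finally show ?thesis by blast
qed

lemma normal_V': "\<exists>a'. V' * normal k a \<doteq> normal (k - 1) a'"
proof (cases "k \<ge> 1")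
  case True
  then have "nat k = Suc (nat (k - 1))" by simp
  then have "V' * normal k a \<doteq> normal (k - 1) (\<delta>s a)"
    using eqv_mult_right[OF V'_c_V[of a], of "V ^ nat (k - 1)"] True by (simp add: normal_def mult.assoc)
  then show ?thesis by blast
next
  case False
  then have "nat (- (k - 1)) = Suc (nat (- k))" by simp
  then have "V' * normal k a = normal (k - 1) a" using False by (auto simp: normal_def mult.assoc)
  then show ?thesis by (metis eqv_refl)
qed

lemma fterm_Cons: "fterm (Word (l # ls)) 1 = fterm (Word [l]) 1 * fterm (Word ls) 1"
  by (simp add: mult_single plus_word_def)

lemma fterm_Adj: "fterm (Word [Adj g]) 1 = free_adj (gen g)"
  by (simp add: gen_def free_adj_fterm adj_word_def)

text \<open>Letters are absorbed one by one from the left: \<open>U\<close> meeting \<open>U\<^sup>*\<close> and \<open>U\<^sup>*\<close> meeting \<open>a U\<close> leave a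
  coefficient, and coefficients move across powers of \<open>U\<^sup>*\<close> by \<open>c_V'_power\<close>.\<close>

theorem word_reduction: "\<exists>a. fterm w 1 \<doteq> normal (wdeg w) a"
proof -
  have "\<exists>a. fterm (Word ls) 1 \<doteq> normal (wdeg (Word ls)) a" for ls :: "'a cp_gen letter list"
  proof (induction ls)
    case Nil
    have "fterm (Word []) 1 = (1 :: 'a cp_gen free_star)" by (simp flip: zero_word_def)
    then have "fterm (Word []) 1 \<doteq> normal 0 1" using eqv_sym[OF c_one] by (simp add: normal_def)
    then show ?case by (auto simp: wdeg_def)
  next
    case (Cons l ls)
    then obtain a where a: "fterm (Word ls) 1 \<doteq> normal (wdeg (Word ls)) a" by blast
    let ?k = "wdeg (Word ls)"
    have step: "fterm (Word (l # ls)) 1 \<doteq> fterm (Word [l]) 1 * normal ?k a"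
      by (subst fterm_Cons) (rule eqv_mult_left[OF a])
    have "\<exists>a'. fterm (Word [l]) 1 * normal ?k a \<doteq> normal (letter_degree l + ?k) a'"
    proof (cases l)
      case (Gen g)
      then have "fterm (Word [l]) 1 = gen g" by (simp add: gen_def)
      then show ?thesis using Gen normal_c[of _ ?k a] normal_V[of ?k a] by (cases g) (auto simp: add.commute)
    next
      case (Adj g)
      then have l: "fterm (Word [l]) 1 = free_adj (gen g)" by (simp add: fterm_Adj)
      show ?thesis
      proof (cases g)
        case (Coeff b)
        have "free_adj (gen g) * normal ?k a \<doteq> c (star b) * normal ?k a"
          unfolding Coeff by (rule eqv_mult_right[OF eqv_sym[OF c_star]])
        then show ?thesis using normal_c[of "star b" ?k a] Adj Coeff eqv_trans unfolding l by auto
      next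
        case PIso
        then show ?thesis using normal_V'[of ?k a] Adj unfolding l by simp
      qed
    qed
    then show ?case using step eqv_trans by (auto simp: wdeg_def)
  qed
  then show ?thesis by (metis word.collapse)
qed

definition homogeneous :: "int \<Rightarrow> 'x cp_gen free_star \<Rightarrow> bool" where
  "homogeneous k x \<longleftrightarrow> (\<forall>w\<in>Poly_Mapping.keys x. wdeg w = k)"

theorem degree_zero_reduction:
  assumes "homogeneous 0 x"
  obtains a where "x \<doteq> c a"
proof -
  have x: "x = (\<Sum>w\<in>Poly_Mapping.keys x. fterm w (Poly_Mapping.lookup x w))" by (rule sum_fterms)
  have c0: "c 0 \<doteq> 0" using c_scale[of 0 0] by (simp add: free_scale_def)
  have "\<exists>a. (\<Sum>w\<in>A. fterm w (f w)) \<doteq> c a" if "finite A" "\<And>w. w \<in> A \<Longrightarrow> wdeg w = 0" for A and f :: "'a cp_gen word \<Rightarrow> complex"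
    using that
  proof (induction A rule: finite_induct)
    case empty
    then show ?case using eqv_sym[OF c0] by auto
  next
    case (insert w A)
    then obtain a where a: "(\<Sum>w\<in>A. fterm w (f w)) \<doteq> c a" by auto
    obtain b where "fterm w 1 \<doteq> normal 0 b" using word_reduction[of w] insert.prems by auto
    then have "free_scale (f w) (fterm w 1) \<doteq> free_scale (f w) (c b)" by (auto simp: normal_def intro: eqv_scale)
    then have "fterm w (f w) \<doteq> c (f w *\<^sub>C b)" using eqv_trans eqv_sym[OF c_scale] by (simp add: free_scale_fterm)
    then have "fterm w (f w) + (\<Sum>w\<in>A. fterm w (f w)) \<doteq> c (f w *\<^sub>C b + a)"
      using eqv_trans[OF eqv_add[OF _ a] eqv_sym[OF c_add]] by blast
    then show ?case using insert by auto
  qed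
  then have "\<exists>a. x \<doteq> c a"
    using assms x unfolding homogeneous_def by (metis finite_keys)
  then show ?thesis using that by blast
qed

text \<open>A C*-seminorm is at most 1 on unitaries, and a self-adjoint contraction is the mean of a unitary and
  its adjoint. The C*-identity reduces the general case to self-adjoint elements.\<close>

lemma p_c_le:
  assumes p: "admissible p"
  shows "p (c a) \<le> norm a"
proof -
  interpret cstar_sn p by (rule admissible_sn[OF p])
  have sa: "p (c h) \<le> 1" if h: "star h = h" "norm h \<le> 1" for h
  proof -
    obtain k u where u: "star u * u = 1" "h = (1/2) *\<^sub>R (u + star u)" using contraction_unitary[OF h] by metis
    have "free_adj (c u) * c u \<doteq> c (star u) * c u" by (rule eqv_mult_right[OF eqv_sym[OF c_star]])
    also have "\<dots> \<doteq> c (star u * u)" by (rule eqv_sym[OF c_mult])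
    also have "\<dots> \<doteq> 1" unfolding u(1) by (rule c_one)
    finally have "(p (c u))\<^sup>2 \<le> 1\<^sup>2" using eqv_p_eq[OF _ p] p_cstar[of "c u"] p_one by simp
    then have pu: "p (c u) \<le> 1" by (rule power2_le_imp_le) simp
    have "c h \<doteq> free_scale (1/2) (c (u + star u))"
      unfolding u(2) scaleR_scaleC using c_scale[of "1/2" "u + star u"] by simp
    also have "\<dots> \<doteq> free_scale (1/2) (c u + free_adj (c u))"
      by (intro eqv_scale eqv_trans[OF c_add] eqv_add eqv_refl c_star)
    finally have "p (c h) = 1/2 * p (c u + free_adj (c u))" using eqv_p_eq[OF _ p] by (simp add: p_scale)
    also have "\<dots> \<le> 1" using p_triangle[of "c u" "free_adj (c u)"] pu by (simp add: p_adj)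
    finally show ?thesis .
  qed
  have scaled: "p (c h) \<le> norm h" if h: "star h = h" for h
  proof (cases "h = 0")
    case True
    have "c 0 \<doteq> 0" using c_scale[of 0 0] by (simp add: free_scale_def)
    then show ?thesis using True eqv_p_eq[OF _ p] p_zero by auto
  next
    case False
    define g where "g = (1 / norm h) *\<^sub>R h"
    have "h = of_real (norm h) *\<^sub>C g" using False by (simp add: g_def flip: scaleR_scaleC)
    then have "p (c h) = norm h * p (c g)" using eqv_p_eq[OF c_scale p, of "of_real (norm h)" g] by (simp add: p_scale)
    also have "\<dots> \<le> norm h * 1" using h False by (intro mult_left_mono sa) (auto simp: g_def star_scaleR)
    finally show ?thesis by simp
  qed
  have "free_adj (c a) * c a \<doteq> c (star a) * c a" by (rule eqv_mult_right[OF eqv_sym[OF c_star]])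
  also have "\<dots> \<doteq> c (star a * a)" by (rule eqv_sym[OF c_mult])
  finally have "(p (c a))\<^sup>2 = p (c (star a * a))" using eqv_p_eq[OF _ p] p_cstar[of "c a"] by simp
  also have "\<dots> \<le> norm (star a * a)" by (rule scaled) (simp add: star_mult star_star)
  also have "\<dots> = (norm a)\<^sup>2" by (rule cstar_identity)
  finally show ?thesis by (rule power2_le_imp_le) simp
qed

end


section \<open>The operator seminorm of the regular representation\<close>

context hilb
begin

definition opnorm :: "('h \<Rightarrow> 'h) \<Rightarrow> real" where
  "opnorm T = Sup {hnorm H (T x) |x. x \<in> hcarrier H \<and> hnorm H x \<le> 1}"

lemma opnorm_bdd_above:
  assumes "T \<in> bounded_ops H"
  shows "bdd_above {hnorm H (T x) |x. x \<in> hcarrier H \<and> hnorm H x \<le> 1}"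
proof -
  obtain K where K: "K \<ge> 0" "bdd_map H H K T" using bounded_ops_bound[OF hilb_axioms assms] by blast
  show ?thesis
  proof (rule bdd_aboveI)
    fix r assume "r \<in> {hnorm H (T x) |x. x \<in> hcarrier H \<and> hnorm H x \<le> 1}"
    then obtain x where x: "x \<in> hcarrier H" "hnorm H x \<le> 1" "r = hnorm H (T x)" by blast
    then show "r \<le> K" using bdd_mapD(2)[OF K(2), of x] mult_left_mono[OF x(2) K(1)] by simp
  qed
qed

lemma opnorm_nonneg: "T \<in> bounded_ops H \<Longrightarrow> 0 \<le> opnorm T"
proof -
  assume T: "T \<in> bounded_ops H"
  have "hnorm H (T hzero) \<le> opnorm T"
    unfolding opnorm_def by (rule cSup_upper[OF _ opnorm_bdd_above[OF T]]) auto
  then show ?thesis using hnorm_nonneg[OF bounded_opsD(1)[OF T hzero_in]] by linarith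
qed

lemma opnorm_bound:
  assumes T: "T \<in> bounded_ops H" and x: "x \<in> hcarrier H"
  shows "hnorm H (T x) \<le> opnorm T * hnorm H x"
proof (cases "hnorm H x = 0")
  case True
  then have "x = hzero" by (rule hnorm_eq_0[OF x])
  then have "T x = hzero" using bounded_opsD(3)[OF T x, of 0] x bounded_opsD(1)[OF T x] by simp
  then show ?thesis using True by simp
next
  case False
  then have n: "hnorm H x > 0" using hnorm_nonneg[OF x] by linarith
  let ?y = "hscale H (of_real (1 / hnorm H x)) x"
  have "hnorm H (T ?y) \<le> opnorm T"
    unfolding opnorm_def
    by (rule cSup_upper[OF _ opnorm_bdd_above[OF T]])
      (use x n in \<open>auto simp: hnorm_scale norm_divide intro!: exI[of _ ?y]\<close>)
  moreover have "hnorm H (T ?y) = hnorm H (T x) / hnorm H x"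
    using n bounded_opsD(1)[OF T x] by (simp add: bounded_opsD(3)[OF T x] hnorm_scale norm_divide)
  ultimately show ?thesis using n by (simp only: pos_divide_le_eq)
qed

lemma opnorm_le:
  assumes "K \<ge> 0" "\<And>x. x \<in> hcarrier H \<Longrightarrow> hnorm H (T x) \<le> K * hnorm H x"
  shows "opnorm T \<le> K"
  unfolding opnorm_def
proof (rule cSup_least)
  have "hnorm H (T hzero) \<in> {hnorm H (T x) |x. x \<in> hcarrier H \<and> hnorm H x \<le> 1}" by force
  then show "{hnorm H (T x) |x. x \<in> hcarrier H \<and> hnorm H x \<le> 1} \<noteq> {}" by blast
  fix r assume "r \<in> {hnorm H (T x) |x. x \<in> hcarrier H \<and> hnorm H x \<le> 1}"
  then obtain x where x: "x \<in> hcarrier H" "hnorm H x \<le> 1" "r = hnorm H (T x)" by blast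
  then show "r \<le> K" using assms(2)[of x] mult_left_mono[OF x(2) assms(1)] by simp
qed

lemma adjointD: "mutually_adjoint H S T \<Longrightarrow> x \<in> hcarrier H \<Longrightarrow> y \<in> hcarrier H \<Longrightarrow>
    hinner H (S x) y = hinner H x (T y)"
  by (simp add: mutually_adjoint_def)

lemma adjoint_sym:
  assumes "mutually_adjoint H S T" "S \<in> bounded_ops H" "T \<in> bounded_ops H"
  shows "mutually_adjoint H T S"
  unfolding mutually_adjoint_def
proof (intro ballI)
  fix x y assume xy: "x \<in> hcarrier H" "y \<in> hcarrier H"
  then show "hinner H (T x) y = hinner H x (S y)"
    using adjointD[OF assms(1) xy(2,1)] inner_cnj[OF xy(2) bounded_opsD(1)[OF assms(3) xy(1)]]
      inner_cnj[OF bounded_opsD(1)[OF assms(2) xy(2)] xy(1)] by simp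
qed

lemma adjoint_norm_sq:
  assumes "mutually_adjoint H S T" "S \<in> bounded_ops H" "T \<in> bounded_ops H" "x \<in> hcarrier H"
  shows "(hnorm H (S x))\<^sup>2 \<le> hnorm H (T (S x)) * hnorm H x"
proof -
  have Sx: "S x \<in> hcarrier H" "T (S x) \<in> hcarrier H" using assms bounded_opsD(1) by auto
  have "hinner H (S x) (S x) = hinner H x (T (S x))" using adjointD[OF assms(1,4) Sx(1)] .
  then show ?thesis
    using cauchy_schwarz[OF assms(4) Sx(2)] complex_Re_le_cmod[of "hinner H x (T (S x))"]
    by (simp add: hnorm_sq[OF Sx(1)] mult.commute)
qed

lemma opnorm_comp_le:
  assumes S: "S \<in> bounded_ops H" and T: "T \<in> bounded_ops H"
  shows "opnorm (op_comp H T S) \<le> opnorm T * opnorm S"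
proof (rule opnorm_le)
  fix x assume x: "x \<in> hcarrier H"
  have "hnorm H (T (S x)) \<le> opnorm T * hnorm H (S x)" using bounded_opsD(1)[OF S x] by (rule opnorm_bound[OF T])
  also have "\<dots> \<le> opnorm T * (opnorm S * hnorm H x)"
    using opnorm_bound[OF S x] opnorm_nonneg[OF T] by (rule mult_left_mono)
  finally show "hnorm H (op_comp H T S x) \<le> opnorm T * opnorm S * hnorm H x" using x by simp
qed (simp add: opnorm_nonneg S T)

lemma opnorm_sq_le:
  assumes adj: "mutually_adjoint H S T" and S: "S \<in> bounded_ops H" and T: "T \<in> bounded_ops H"
  shows "(opnorm S)\<^sup>2 \<le> opnorm (op_comp H T S)"
proof -
  have TS: "op_comp H T S \<in> bounded_ops H" using S T by simp
  have "opnorm S \<le> sqrt (opnorm (op_comp H T S))"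
  proof (rule opnorm_le)
    fix x assume x: "x \<in> hcarrier H"
    have "(hnorm H (S x))\<^sup>2 \<le> hnorm H (op_comp H T S x) * hnorm H x"
      using adjoint_norm_sq[OF adj S T x] x by simp
    also have "\<dots> \<le> opnorm (op_comp H T S) * hnorm H x * hnorm H x"
      using opnorm_bound[OF TS x] x by (intro mult_right_mono) auto
    also have "\<dots> = (sqrt (opnorm (op_comp H T S)) * hnorm H x)\<^sup>2"
      using opnorm_nonneg[OF TS] by (simp add: power_mult_distrib power2_eq_square)
    finally show "hnorm H (S x) \<le> sqrt (opnorm (op_comp H T S)) * hnorm H x"
      by (rule power2_le_imp_le) (use opnorm_nonneg[OF TS] x in simp)
  qed (simp add: opnorm_nonneg[OF TS])
  then have "(opnorm S)\<^sup>2 \<le> (sqrt (opnorm (op_comp H T S)))\<^sup>2" using opnorm_nonneg[OF S] by (rule power_mono)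
  then show ?thesis using opnorm_nonneg[OF TS] by simp
qed

lemma opnorm_adjoint:
  assumes "mutually_adjoint H S T" "S \<in> bounded_ops H" "T \<in> bounded_ops H"
  shows "opnorm T = opnorm S"
proof -
  have le: "opnorm S \<le> opnorm T"
    if adj: "mutually_adjoint H S T" and S: "S \<in> bounded_ops H" and T: "T \<in> bounded_ops H" for S T
  proof (cases "opnorm S = 0")
    case False
    then have "opnorm S > 0" using opnorm_nonneg[OF S] by simp
    moreover have "opnorm S * opnorm S \<le> opnorm T * opnorm S"
      using opnorm_sq_le[OF adj S T] opnorm_comp_le[OF S T] by (simp add: power2_eq_square)
    ultimately show ?thesis by simp
  qed (simp add: opnorm_nonneg T)
  show ?thesis using le[OF assms] le[OF adjoint_sym[OF assms] assms(3,2)] by simp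
qed

lemma opnorm_cstar:
  assumes "mutually_adjoint H S T" "S \<in> bounded_ops H" "T \<in> bounded_ops H"
  shows "opnorm (op_comp H T S) = (opnorm S)\<^sup>2"
  using opnorm_sq_le[OF assms] opnorm_comp_le[OF assms(2,3)] opnorm_adjoint[OF assms]
  by (simp add: power2_eq_square)

lemma adjoint_comp:
  assumes "mutually_adjoint H S S'" "mutually_adjoint H T T'"
    "S \<in> bounded_ops H" "S' \<in> bounded_ops H" "T \<in> bounded_ops H" "T' \<in> bounded_ops H"
  shows "mutually_adjoint H (op_comp H S T) (op_comp H T' S')"
  using assms by (simp add: mutually_adjoint_def bounded_opsD(1))

lemma adjoint_plus:
  assumes "mutually_adjoint H S S'" "mutually_adjoint H T T'"
    "S \<in> bounded_ops H" "S' \<in> bounded_ops H" "T \<in> bounded_ops H" "T' \<in> bounded_ops H"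
  shows "mutually_adjoint H (op_plus S T) (op_plus S' T')"
  using assms by (simp add: mutually_adjoint_def bounded_opsD(1))

lemma adjoint_scale:
  assumes "mutually_adjoint H S S'" "S \<in> bounded_ops H" "S' \<in> bounded_ops H"
  shows "mutually_adjoint H (op_scale a S) (op_scale (cnj a) S')"
  using assms by (simp add: mutually_adjoint_def bounded_opsD(1))

lemma op_comp_assoc:
  assumes "R \<in> bounded_ops H" "S \<in> bounded_ops H" "T \<in> bounded_ops H"
  shows "op_comp H (op_comp H R S) T = op_comp H R (op_comp H S T)"
  by (rule op_eqI) (use assms in \<open>auto simp: bounded_opsD(1)\<close>)

lemma op_comp_id [simp]:
  assumes "T \<in> bounded_ops H"
  shows "op_comp H op_id T = T" "op_comp H T op_id = T"
  by (rule op_eqI; use assms in \<open>auto simp: bounded_opsD(1)\<close>)+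

end

context transfer_system
begin

subsection \<open>Evaluation of the free algebra\<close>

fun letter_op :: "'a cp_gen letter \<Rightarrow> 'a reg_vector \<Rightarrow> 'a reg_vector" where
  "letter_op (Gen (Coeff a)) = \<pi> a"
| "letter_op (Adj (Coeff a)) = \<pi> (star a)"
| "letter_op (Gen PIso) = U"
| "letter_op (Adj PIso) = Us"

definition word_op :: "'a cp_gen word \<Rightarrow> 'a reg_vector \<Rightarrow> 'a reg_vector" where
  "word_op w = foldr (\<lambda>l. op_comp H (letter_op l)) (letters w) R.op_id"

lemma letter_op_in [simp]: "letter_op l \<in> bounded_ops H"
  by (cases l rule: letter_op.cases) simp_all

lemma word_op_Cons: "word_op (Word (l # ls)) = op_comp H (letter_op l) (word_op (Word ls))"
  and word_op_Nil: "word_op (Word []) = R.op_id"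
  by (simp_all add: word_op_def)

lemma word_op_in [simp]: "word_op w \<in> bounded_ops H"
proof -
  have "word_op (Word ls) \<in> bounded_ops H" for ls
    by (induction ls) (simp_all add: word_op_Cons word_op_Nil)
  then show ?thesis by (metis word.collapse)
qed

lemma word_op_plus: "word_op (u + v) = op_comp H (word_op u) (word_op v)"
proof -
  have "word_op (Word (ls @ ms)) = op_comp H (word_op (Word ls)) (word_op (Word ms))" for ls ms
    by (induction ls) (simp_all add: word_op_Cons word_op_Nil R.op_comp_assoc)
  then show ?thesis by (simp add: plus_word_def)
qed

lemma word_op_letter: "word_op (Word [l]) = letter_op l"
  by (simp add: word_op_Cons word_op_Nil)

lemma letter_adjoint: "mutually_adjoint H (letter_op l) (letter_op (flip_letter l))"
proof -
  have "mutually_adjoint H (\<pi> (star a)) (\<pi> a)" for a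
    using pi_adjoint[of "star a"] by (simp add: star_star)
  then show ?thesis
    using U_adjoint R.adjoint_sym[OF U_adjoint U_in Us_in] pi_adjoint
    by (cases l rule: letter_op.cases) simp_all
qed

lemma word_adjoint: "mutually_adjoint H (word_op w) (word_op (adj_word w))"
proof -
  have "mutually_adjoint H (word_op (Word ls)) (word_op (adj_word (Word ls)))" for ls
  proof (induction ls)
    case Nil
    show ?case by (simp add: adj_word_def word_op_Nil mutually_adjoint_def)
  next
    case (Cons l ls)
    have "Word (l # ls) = Word [l] + Word ls" by (simp add: plus_word_def)
    moreover have "adj_word (Word [l]) = Word [flip_letter l]" by (simp add: adj_word_def)
    ultimately have "adj_word (Word (l # ls)) = adj_word (Word ls) + Word [flip_letter l]"
      by simp
    then show ?case
      using R.adjoint_comp[OF letter_adjoint Cons.IH]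
      by (simp add: word_op_plus word_op_letter word_op_Cons word_op_Nil)
  qed
  then show ?thesis by (metis word.collapse)
qed

text \<open>Evaluation is specified through matrix coefficients, which turns finite sums of operators into
  sums of complex numbers.\<close>

definition ev_spec :: "'a cp_gen free_star \<Rightarrow> ('a reg_vector \<Rightarrow> 'a reg_vector) \<Rightarrow> bool" where
  "ev_spec x T \<longleftrightarrow> T \<in> bounded_ops H \<and> (\<forall>\<xi>\<in>hcarrier H. \<forall>\<eta>\<in>hcarrier H. hinner H (T \<xi>) \<eta> =
     (\<Sum>w\<in>Poly_Mapping.keys x. Poly_Mapping.lookup x w * hinner H (word_op w \<xi>) \<eta>))"

definition ev :: "'a cp_gen free_star \<Rightarrow> 'a reg_vector \<Rightarrow> 'a reg_vector" where
  "ev x = (SOME T. ev_spec x T)"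

lemma ev_spec_fterm: "ev_spec (fterm w a) (R.op_scale a (word_op w))"
  unfolding ev_spec_def
proof (intro conjI ballI)
  fix \<xi> \<eta> assume "\<xi> \<in> hcarrier H" "\<eta> \<in> hcarrier H"
  then show "hinner H (R.op_scale a (word_op w) \<xi>) \<eta> =
     (\<Sum>v\<in>Poly_Mapping.keys (fterm w a). Poly_Mapping.lookup (fterm w a) v * hinner H (word_op v \<xi>) \<eta>)"
    by (subst sum_keys_fterm) (auto simp: R.bounded_opsD(1)[OF word_op_in])
qed simp

lemma ev_spec_add: "ev_spec x S \<Longrightarrow> ev_spec y T \<Longrightarrow> ev_spec (x + y) (R.op_plus S T)"
  unfolding ev_spec_def
proof (intro conjI ballI)
  assume S: "S \<in> bounded_ops H \<and> (\<forall>\<xi>\<in>hcarrier H. \<forall>\<eta>\<in>hcarrier H. hinner H (S \<xi>) \<eta> =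
     (\<Sum>w\<in>Poly_Mapping.keys x. Poly_Mapping.lookup x w * hinner H (word_op w \<xi>) \<eta>))"
   and T: "T \<in> bounded_ops H \<and> (\<forall>\<xi>\<in>hcarrier H. \<forall>\<eta>\<in>hcarrier H. hinner H (T \<xi>) \<eta> =
     (\<Sum>w\<in>Poly_Mapping.keys y. Poly_Mapping.lookup y w * hinner H (word_op w \<xi>) \<eta>))"
  show "R.op_plus S T \<in> bounded_ops H" using S T by simp
  fix \<xi> \<eta> assume \<xi>: "\<xi> \<in> hcarrier H" and \<eta>: "\<eta> \<in> hcarrier H"
  show "hinner H (R.op_plus S T \<xi>) \<eta> =
     (\<Sum>w\<in>Poly_Mapping.keys (x + y). Poly_Mapping.lookup (x + y) w * hinner H (word_op w \<xi>) \<eta>)"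
    using S T \<xi> \<eta> by (subst setsum_keys_plus_distrib) (auto simp: algebra_simps R.bounded_opsD(1))
qed

lemma ev_spec_exists: "\<exists>T. ev_spec x T"
  by (induction x rule: free_induct) (blast intro: ev_spec_fterm ev_spec_add)+

lemma ev_spec_unique: "ev_spec x S \<Longrightarrow> ev_spec x T \<Longrightarrow> S = T"
  by (rule R.op_eqI) (auto simp: ev_spec_def R.bounded_opsD(1) intro!: R.ext)

lemma ev_spec_ev: "ev_spec x (ev x)"
  unfolding ev_def using ev_spec_exists by (rule someI_ex)

lemma ev_in [simp]: "ev x \<in> bounded_ops H"
  using ev_spec_ev by (simp add: ev_spec_def)

lemma ev_closed [simp]: "\<xi> \<in> hcarrier H \<Longrightarrow> ev x \<xi> \<in> hcarrier H"
  by (rule R.bounded_opsD(1)[OF ev_in])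

lemma ev_fterm: "ev (fterm w a) = R.op_scale a (word_op w)"
  by (rule ev_spec_unique[OF ev_spec_ev ev_spec_fterm])

lemma ev_add: "ev (x + y) = R.op_plus (ev x) (ev y)"
  by (rule ev_spec_unique[OF ev_spec_ev ev_spec_add[OF ev_spec_ev ev_spec_ev]])

lemma ev_mult: "ev (x * y) = op_comp H (ev x) (ev y)"
proof (induction x rule: free_induct)
  case (fterm w a)
  show ?case
  proof (induction y rule: free_induct)
    case (fterm v b)
    show ?case
      by (rule R.op_eqI)
        (auto simp: mult_single ev_fterm word_op_plus R.bounded_opsD(1,3)[OF word_op_in] intro!: R.ext)
  next
    case (add x y)
    show ?case
      unfolding distrib_left ev_add add
      by (rule R.op_eqI) (auto simp: R.bounded_opsD(2)[OF ev_in])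
  qed
next
  case (add x1 x2)
  show ?case
    unfolding distrib_right ev_add add by (rule R.op_eqI) auto
qed

lemma ev_one: "ev 1 = R.op_id"
proof -
  have "word_op 0 = R.op_id" by (simp add: zero_word_def word_op_Nil)
  then have "ev (fterm 0 1) = R.op_id" unfolding ev_fterm by (intro R.op_eqI) auto
  then show ?thesis by simp
qed

lemma ev_scale: "ev (free_scale a x) = R.op_scale a (ev x)"
proof -
  have "word_op 0 = R.op_id" by (simp add: zero_word_def word_op_Nil)
  then have "ev (free_scale a x) = op_comp H (R.op_scale a R.op_id) (ev x)"
    by (simp add: free_scale_def ev_mult ev_fterm)
  also have "\<dots> = R.op_scale a (ev x)" by (rule R.op_eqI) auto
  finally show ?thesis .
qed

lemma ev_adjoint: "mutually_adjoint H (ev x) (ev (free_adj x))"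
  by (induction x rule: free_induct)
    (simp_all add: ev_fterm ev_add free_adj_fterm free_adj_add R.adjoint_scale word_adjoint R.adjoint_plus)

lemma ev_coeff: "ev (c a) = \<pi> a" and ev_V: "ev V = U" and ev_V': "ev V' = Us"
proof -
  have s: "R.op_scale 1 T = T" if "T \<in> bounded_ops H" for T
    using that by (intro R.op_eqI) (auto simp: R.bounded_opsD(1))
  show "ev (c a) = \<pi> a" "ev V = U" by (simp_all add: gen_def ev_fterm word_op_letter s)
  show "ev V' = Us" by (simp add: gen_def free_adj_fterm adj_word_def ev_fterm word_op_letter s)
qed

definition reg_norm :: "'a cp_gen free_star \<Rightarrow> real" where
  "reg_norm x = R.opnorm (ev x)"

lemma ev_bound: "\<xi> \<in> hcarrier H \<Longrightarrow> hnorm H (ev x \<xi>) \<le> reg_norm x * hnorm H \<xi>"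
  unfolding reg_norm_def by (rule R.opnorm_bound[OF ev_in])

lemma reg_norm_nonneg: "0 \<le> reg_norm x"
  by (simp add: reg_norm_def R.opnorm_nonneg)

lemma reg_norm_le: "K \<ge> 0 \<Longrightarrow> (\<And>\<xi>. \<xi> \<in> hcarrier H \<Longrightarrow> hnorm H (ev x \<xi>) \<le> K * hnorm H \<xi>) \<Longrightarrow> reg_norm x \<le> K"
  unfolding reg_norm_def by (rule R.opnorm_le)

lemma cstar_seminorm_reg: "cstar_seminorm reg_norm"
  unfolding cstar_seminorm_def
proof (intro conjI allI)
  fix x y a
  show "0 \<le> reg_norm x" by (rule reg_norm_nonneg)
  show "reg_norm (x + y) \<le> reg_norm x + reg_norm y"
  proof (rule reg_norm_le)
    fix \<xi> assume \<xi>: "\<xi> \<in> hcarrier H"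
    then show "hnorm H (ev (x + y) \<xi>) \<le> (reg_norm x + reg_norm y) * hnorm H \<xi>"
      using R.hnorm_triangle[of "ev x \<xi>" "ev y \<xi>"] ev_bound[of \<xi> x] ev_bound[of \<xi> y]
      by (simp add: ev_add algebra_simps)
  qed (simp add: reg_norm_nonneg)
  show "reg_norm (x * y) \<le> reg_norm x * reg_norm y"
    unfolding reg_norm_def ev_mult by (rule R.opnorm_comp_le) simp_all
  show "reg_norm (free_adj x * x) = (reg_norm x)\<^sup>2"
    unfolding reg_norm_def ev_mult by (rule R.opnorm_cstar[OF ev_adjoint]) simp_all
  have le: "reg_norm (free_scale a x) \<le> cmod a * reg_norm x" for a x
  proof (rule reg_norm_le)
    fix \<xi> assume \<xi>: "\<xi> \<in> hcarrier H"
    then show "hnorm H (ev (free_scale a x) \<xi>) \<le> cmod a * reg_norm x * hnorm H \<xi>"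
      using mult_left_mono[OF ev_bound[OF \<xi>, of x], of "cmod a"] by (simp add: ev_scale R.hnorm_scale mult.assoc)
  qed (simp add: reg_norm_nonneg)
  show "reg_norm (free_scale a x) = cmod a * reg_norm x"
  proof (cases "a = 0")
    case True
    then show ?thesis using le[of a x] reg_norm_nonneg[of "free_scale a x"] by simp
  next
    case False
    have "free_scale (inverse a) (free_scale a x) = x"
      using False by (simp add: free_scale_def mult_single flip: mult.assoc)
    then have "reg_norm x \<le> inverse (cmod a) * reg_norm (free_scale a x)"
      using le[of "inverse a" "free_scale a x"] by (simp add: norm_inverse)
    then have "cmod a * reg_norm x \<le> reg_norm (free_scale a x)" using False by (simp add: field_simps)
    then show ?thesis using le[of a x] by simp
  qed
qed

lemma reg_norm_diff_0: "ev x = ev y \<Longrightarrow> reg_norm (x - y) = 0"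
proof -
  assume eq: "ev x = ev y"
  have "x - y = x + free_scale (- 1) y" by (simp add: free_scale_minus_one)
  then have "ev (x - y) = R.op_plus (ev y) (R.op_scale (- 1) (ev y))" by (simp only: ev_add ev_scale eq)
  then have "reg_norm (x - y) \<le> 0" by (intro reg_norm_le) simp_all
  then show ?thesis using reg_norm_nonneg[of "x - y"] by simp
qed

theorem admissible_reg: "admissible reg_norm"
  unfolding admissible_def
proof (intro conjI ballI cstar_seminorm_reg)
  fix r assume "r \<in> cp_relators \<delta> \<delta>s"
  then consider
    (add) a b where "r = c (a + b) - (c a + c b)"
  | (scale) z a where "r = c (z *\<^sub>C a) - free_scale z (c a)"
  | (mult) a b where "r = c (a * b) - c a * c b"
  | (star) a where "r = c (star a) - free_adj (c a)"
  | (one) "r = c 1 - 1"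
  | (iso) "r = V * V' * V - V"
  | (endo) a where "r = V * c a * V' - c (\<delta> a)"
  | (transfer) a where "r = V' * c a * V - c (\<delta>s a)"
    unfolding cp_relators_def coeff_relators_def covariance_relators_def by blast
  then show "reg_norm r = 0"
  proof cases
    case star
    have "ev (free_adj (c a)) = \<pi> (star a)"
    proof (rule R.op_eqI)
      fix \<xi> assume \<xi>: "\<xi> \<in> hcarrier H"
      show "ev (free_adj (c a)) \<xi> = \<pi> (star a) \<xi>"
      proof (rule R.ext)
        fix \<eta> assume \<eta>: "\<eta> \<in> hcarrier H"
        have "hinner H \<eta> (ev (free_adj (c a)) \<xi>) = hinner H \<eta> (\<pi> (star a) \<xi>)"
          using R.adjointD[OF ev_adjoint \<eta> \<xi>, of "c a"] R.adjointD[OF pi_adjoint \<eta> \<xi>, of a] by (simp add: ev_coeff)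
        then show "hinner H (ev (free_adj (c a)) \<xi>) \<eta> = hinner H (\<pi> (star a) \<xi>) \<eta>"
          using R.inner_cnj[OF \<eta>] \<xi> R.bounded_opsD(1)[OF pi_in \<xi>] ev_closed[OF \<xi>] by metis
      qed (use \<xi> R.bounded_opsD(1)[OF pi_in \<xi>] in auto)
    qed simp_all
    then show ?thesis unfolding star by (intro reg_norm_diff_0) (simp add: ev_coeff)
  next
    case iso
    have "op_comp H (op_comp H U Us) U = U"
    proof -
      have "op_comp H U Us = \<pi> (\<delta> 1)"
        using U_pi_Us[of 1] by (simp add: pi_one)
      moreover have "op_comp H (\<pi> (\<delta> 1)) U = U" using U_pi[of 1] by (simp add: pi_one)
      ultimately show ?thesis by simp
    qed
    then show ?thesis unfolding iso by (intro reg_norm_diff_0) (simp add: ev_mult ev_V ev_V')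
  next
    case endo
    then show ?thesis
      using U_pi_Us[of a] by (auto intro!: reg_norm_diff_0 simp: ev_mult ev_V ev_V' ev_coeff R.op_comp_assoc)
  next
    case transfer
    then show ?thesis
      using Us_pi_U[of a] by (auto intro!: reg_norm_diff_0 simp: ev_mult ev_V ev_V' ev_coeff R.op_comp_assoc)
  qed (auto intro!: reg_norm_diff_0 simp: ev_coeff ev_add ev_mult ev_scale ev_one pi_add pi_scale pi_mult pi_one)
qed

end


section \<open>The regular seminorm is the largest\<close>

context transfer_system
begin

lemma wdeg_plus [simp]: "wdeg (u + v) = wdeg u + wdeg v"
  by (simp add: wdeg_def plus_word_def)

lemma wdeg_zero [simp]: "wdeg 0 = 0"
  by (simp add: wdeg_def zero_word_def)

lemma wdeg_adj [simp]: "wdeg (adj_word w) = - wdeg w"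
proof -
  have f: "letter_degree (flip_letter l) = - letter_degree l" for l :: "'x cp_gen letter"
    by (cases l rule: letter_degree.cases) auto
  have "sum_list (map letter_degree (rev (map flip_letter ls))) = - sum_list (map letter_degree ls)"
    for ls :: "'x cp_gen letter list"
    by (induction ls) (auto simp: f)
  then show ?thesis by (simp add: wdeg_def adj_word_def)
qed

definition part :: "int \<Rightarrow> 'x cp_gen free_star \<Rightarrow> 'x cp_gen free_star" where
  "part k x = (\<Sum>w\<in>Poly_Mapping.keys x. if wdeg w = k then fterm w (Poly_Mapping.lookup x w) else 0)"

lemma part_fterm: "part k (fterm w a) = (if wdeg w = k then fterm w a else 0)"
  unfolding part_def
  by (rule sum_keys_fterm[where g = "\<lambda>w a. if wdeg w = k then fterm w a else 0"]) simp

lemma part_add: "part k (x + y) = part k x + part k y"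
  unfolding part_def by (rule setsum_keys_plus_distrib) (auto simp: single_add)

lemma part_adj: "free_adj (part k x) = part (- k) (free_adj x)"
  by (induction x rule: free_induct) (auto simp: part_fterm part_add free_adj_add free_adj_fterm)

lemma part_homogeneous: "homogeneous k (part k x)"
proof -
  have "Poly_Mapping.keys (part k x) \<subseteq> {w. wdeg w = k}"
    unfolding part_def
    by (rule order_trans[OF keys_sum]) (auto split: if_splits)
  then show ?thesis by (auto simp: homogeneous_def)
qed

lemma keys_free_adj: "Poly_Mapping.keys (free_adj x) \<subseteq> adj_word ` Poly_Mapping.keys x"
  unfolding free_adj_def adj_word_def[symmetric]
  by (rule order_trans[OF keys_sum]) (auto split: if_splits)

lemma homogeneous_mult_adj: "homogeneous k x \<Longrightarrow> homogeneous 0 (x * free_adj x)"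
  using keys_mult[of x "free_adj x"] keys_free_adj[of x] by (fastforce simp: homogeneous_def)


subsection \<open>Comparison on homogeneous elements\<close>

lemma pj_letter: "op_comp H (pj (j + letter_degree l)) (letter_op l) = op_comp H (letter_op l) (pj j)"
  using pj_U[of j] pj_Us[of j] pj_pi[of j]
  by (cases l rule: letter_op.cases) simp_all

lemma pj_word: "op_comp H (pj (j + wdeg w)) (word_op w) = op_comp H (word_op w) (pj j)"
proof -
  have "op_comp H (pj (j + wdeg (Word ls))) (word_op (Word ls)) = op_comp H (word_op (Word ls)) (pj j)" for ls
  proof (induction ls arbitrary: j)
    case Nil
    show ?case by (simp add: wdeg_def word_op_Nil)
  next
    case (Cons l ls)
    let ?d = "wdeg (Word ls)"
    have deg: "j + wdeg (Word (l # ls)) = j + ?d + letter_degree l" by (simp add: wdeg_def)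
    have "op_comp H (pj (j + wdeg (Word (l # ls)))) (word_op (Word (l # ls)))
        = op_comp H (op_comp H (pj (j + ?d + letter_degree l)) (letter_op l)) (word_op (Word ls))"
      unfolding deg by (simp add: word_op_Cons R.op_comp_assoc)
    also have "\<dots> = op_comp H (letter_op l) (op_comp H (pj (j + ?d)) (word_op (Word ls)))"
      by (simp add: pj_letter R.op_comp_assoc)
    also have "\<dots> = op_comp H (word_op (Word (l # ls))) (pj j)"
      by (simp add: Cons.IH word_op_Cons R.op_comp_assoc)
    finally show ?case .
  qed
  then show ?thesis by (metis word.collapse)
qed

text \<open>Words shift the degree of vectors by their own degree, so projections single out homogeneous parts.\<close>

lemma pj_ev:
  assumes \<xi>: "\<xi> \<in> hcarrier H"
  shows "pj (j + k) (ev x (pj j \<xi>)) = ev (part k x) (pj j \<xi>)"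
proof -
  have pjH: "\<eta> \<in> hcarrier H \<Longrightarrow> pj i \<eta> \<in> hcarrier H" for i \<eta> by (rule R.bounded_opsD(1)[OF pj_in])
  have wH: "\<eta> \<in> hcarrier H \<Longrightarrow> word_op w \<eta> \<in> hcarrier H" for w \<eta> by (rule R.bounded_opsD(1)[OF word_op_in])
  note in_H = pjH wH \<xi>
  show ?thesis
  proof (induction x rule: free_induct)
    case (fterm w a)
    have w: "word_op w (pj j \<xi>) = pj (j + wdeg w) (word_op w \<xi>)"
      using fun_cong[OF pj_word[of j w], of \<xi>] \<xi> by simp
    have "ev 0 (pj j \<xi>) = R.hzero"
      using ev_fterm[of 0 0] in_H by simp
    then show ?case
      using in_H by (auto simp: part_fterm ev_fterm R.bounded_opsD(3)[OF pj_in] w pj_pj)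
  next
    case (add x y)
    then show ?case using in_H by (simp add: part_add ev_add R.bounded_opsD(2)[OF pj_in])
  qed
qed

lemma reg_norm_0_ev:
  assumes "reg_norm (x - y) = 0" "\<xi> \<in> hcarrier H"
  shows "ev x \<xi> = ev y \<xi>"
proof -
  have x: "x = (x - y) + y" by simp
  have "hnorm H (ev (x - y) \<xi>) = 0"
    using ev_bound[OF assms(2), of "x - y"] assms R.hnorm_nonneg[OF ev_closed[OF assms(2)], of "x - y"] by simp
  then have "ev (x - y) \<xi> = R.hzero" using assms(2) by (intro R.hnorm_eq_0) auto
  then have "ev ((x - y) + y) \<xi> = ev y \<xi>" using assms(2) unfolding ev_add by simp
  then show ?thesis using x by simp
qed

text \<open>If \<open>y = x\<^sub>k x\<^sub>k\<^sup>*\<close> reduces to \<open>a\<close>, the norm of \<open>a\<close> is attained at a vector \<open>\<xi>\<close> of degree 0, where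
  \<open>a \<xi> = P\<^sub>0 x P\<^sub>-\<^sub>k x\<^sup>* \<xi>\<close> has norm at most \<open>\<parallel>x\<parallel>\<^sup>2\<close>. This single estimate replaces a conditional
  expectation.\<close>

theorem part_le_reg_norm:
  assumes p: "admissible p"
  shows "p (part k x) \<le> reg_norm x"
proof -
  interpret cstar_sn p by (rule admissible_sn[OF p])
  interpret r: cstar_sn reg_norm by (rule admissible_sn[OF admissible_reg])
  define y where "y = part k x * free_adj (part k x)"
  have "homogeneous 0 y" unfolding y_def by (rule homogeneous_mult_adj[OF part_homogeneous])
  then obtain a where a: "y \<doteq> c a" by (rule degree_zero_reduction)
  obtain f where f: "f \<in> PF" "hnorm H (svec f 0 1) \<le> 1" "hnorm H (\<pi> a (svec f 0 1)) = norm a"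
    using norming_vector by blast
  let ?\<xi> = "svec f 0 1"
  have \<xi>: "?\<xi> \<in> hcarrier H" "pj 0 ?\<xi> = ?\<xi>" using f by (auto simp: pj_svec)
  define \<eta> where "\<eta> = ev (free_adj x) ?\<xi>"
  have \<eta>: "\<eta> \<in> hcarrier H" "pj (- k) \<eta> \<in> hcarrier H"
    using \<xi> by (auto simp: \<eta>_def intro: R.bounded_opsD(1)[OF pj_in])
  have "\<pi> a ?\<xi> = ev y ?\<xi>"
    using reg_norm_0_ev[OF eqvD[OF a admissible_reg] \<xi>(1)] by (simp add: ev_coeff)
  also have "\<dots> = ev (part k x) (ev (part (- k) (free_adj x)) ?\<xi>)"
    using \<xi> by (simp add: y_def ev_mult part_adj)
  also have "ev (part (- k) (free_adj x)) ?\<xi> = pj (- k) \<eta>"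
    using pj_ev[OF \<xi>(1), of 0 "- k" "free_adj x"] \<xi>(2) by (simp add: \<eta>_def)
  also have "ev (part k x) (pj (- k) \<eta>) = pj 0 (ev x (pj (- k) \<eta>))"
    using pj_ev[OF \<eta>(1), of "- k" k x] by simp
  finally have "norm a = hnorm H (pj 0 (ev x (pj (- k) \<eta>)))" using f by simp
  also have "\<dots> \<le> hnorm H (ev x (pj (- k) \<eta>))" using \<eta> by (intro pj_contraction) simp
  also have "\<dots> \<le> reg_norm x * hnorm H (pj (- k) \<eta>)" by (rule ev_bound[OF \<eta>(2)])
  also have "\<dots> \<le> reg_norm x * hnorm H \<eta>" by (intro mult_left_mono pj_contraction \<eta> reg_norm_nonneg)
  also have "\<dots> \<le> reg_norm x * (reg_norm (free_adj x) * hnorm H ?\<xi>)"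
    unfolding \<eta>_def by (intro mult_left_mono ev_bound \<xi> reg_norm_nonneg)
  also have "\<dots> \<le> reg_norm x * (reg_norm x * 1)"
    unfolding r.p_adj by (intro mult_left_mono f(2) reg_norm_nonneg)
  finally have "norm a \<le> (reg_norm x)\<^sup>2" by (simp add: power2_eq_square)
  moreover have "(p (part k x))\<^sup>2 \<le> norm a"
    using p_cstar'[of "part k x"] eqv_p_eq[OF a p] p_c_le[OF p, of a] by (simp add: y_def)
  ultimately have "(p (part k x))\<^sup>2 \<le> (reg_norm x)\<^sup>2" by linarith
  then show ?thesis by (rule power2_le_imp_le) (rule reg_norm_nonneg)
qed


subsection \<open>Comparison on arbitrary elements\<close>

definition degree_bound :: "nat \<Rightarrow> 'x cp_gen free_star \<Rightarrow> bool" where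
  "degree_bound n x \<longleftrightarrow> (\<forall>w\<in>Poly_Mapping.keys x. \<bar>wdeg w\<bar> \<le> int n)"

lemma degree_bound_exists: "\<exists>n. degree_bound n x"
proof -
  have "finite ((\<lambda>w. nat \<bar>wdeg w\<bar>) ` Poly_Mapping.keys x)" by simp
  then obtain n where "\<forall>m\<in>(\<lambda>w. nat \<bar>wdeg w\<bar>) ` Poly_Mapping.keys x. m \<le> n"
    by (meson finite_nat_set_iff_bounded_le)
  then show ?thesis by (auto simp: degree_bound_def nat_le_iff intro!: exI[of _ n])
qed

lemma degree_bound_mult: "degree_bound m x \<Longrightarrow> degree_bound n y \<Longrightarrow> degree_bound (m + n) (x * y)"
  unfolding degree_bound_def
proof
  fix w assume *: "\<forall>w\<in>Poly_Mapping.keys x. \<bar>wdeg w\<bar> \<le> int m" "\<forall>w\<in>Poly_Mapping.keys y. \<bar>wdeg w\<bar> \<le> int n"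
    and "w \<in> Poly_Mapping.keys (x * y)"
  then obtain u v where "w = u + v" "u \<in> Poly_Mapping.keys x" "v \<in> Poly_Mapping.keys y"
    using keys_mult[of x y] by auto
  then have "\<bar>wdeg u\<bar> \<le> int m" "\<bar>wdeg v\<bar> \<le> int n" "wdeg w = wdeg u + wdeg v" using * by auto
  then show "\<bar>wdeg w\<bar> \<le> int (m + n)" by linarith
qed

lemma degree_bound_adj: "degree_bound n x \<Longrightarrow> degree_bound n (free_adj x)"
  using keys_free_adj[of x] by (fastforce simp: degree_bound_def)

lemma sum_parts:
  assumes "degree_bound n x"
  shows "x = (\<Sum>k\<in>{- int n..int n}. part k x)"
proof -
  have "(\<Sum>k\<in>{- int n..int n}. part k x) = (\<Sum>w\<in>Poly_Mapping.keys x. \<Sum>k\<in>{- int n..int n}.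
      if wdeg w = k then fterm w (Poly_Mapping.lookup x w) else 0)"
    unfolding part_def by (rule sum.swap)
  also have "\<dots> = (\<Sum>w\<in>Poly_Mapping.keys x. fterm w (Poly_Mapping.lookup x w))"
    using assms by (intro sum.cong) (auto simp: degree_bound_def)
  also have "\<dots> = x" by (rule sum_fterms[symmetric])
  finally show ?thesis by simp
qed

lemma le_degree_times_reg_norm:
  assumes p: "admissible p" and n: "degree_bound n x"
  shows "p x \<le> (2 * real n + 1) * reg_norm x"
proof -
  interpret cstar_sn p by (rule admissible_sn[OF p])
  have sum_le: "p (\<Sum>k\<in>A. g k) \<le> (\<Sum>k\<in>A. p (g k))" if "finite A" for A and g :: "int \<Rightarrow> _"
    using that by (induction A rule: finite_induct) (auto simp: p_zero intro: order_trans[OF p_triangle])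
  have "p x = p (\<Sum>k\<in>{- int n..int n}. part k x)" using sum_parts[OF n] by simp
  also have "\<dots> \<le> (\<Sum>k\<in>{- int n..int n}. p (part k x))" by (rule sum_le) simp
  also have "\<dots> \<le> (\<Sum>k\<in>{- int n..int n}. reg_norm x)" by (intro sum_mono part_le_reg_norm p)
  also have "\<dots> = (2 * real n + 1) * reg_norm x" by simp
  finally show ?thesis .
qed

text \<open>If \<open>P = (1 + e) Q\<close> with \<open>e > 0\<close>, the quotient of the powers is \<open>(1 + e)\<^sup>2\<^sup>m \<ge> m\<^sup>2e\<^sup>2\<close> for \<open>m = 2\<^sup>j\<close>, which
  outgrows the factor \<open>C m + 1\<close>.\<close>

lemma power_growth:
  fixes P Q :: real
  assumes Q: "Q \<ge> 0" and P: "P \<ge> 0"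
    and le: "\<And>j. P ^ (2 * 2 ^ j) \<le> (C * 2 ^ j + 1) * Q ^ (2 * 2 ^ j)" and C: "C \<ge> 0"
  shows "P \<le> Q"
proof (rule ccontr)
  assume "\<not> P \<le> Q"
  then have PQ: "P > Q" by simp
  show False
  proof (cases "Q = 0")
    case True
    then show ?thesis using le[of 0] PQ by simp
  next
    case False
    define e where "e = P / Q - 1"
    have Q0: "Q > 0" using Q False by simp
    have e: "e > 0" "P / Q = 1 + e" using PQ Q0 by (simp_all add: e_def field_simps)
    have bound: "real m * e\<^sup>2 \<le> C + 1" if m: "m = 2 ^ j" for m j :: nat
    proof -
      have m0: "real m > 0" using m by simp
      have "(real m * e)\<^sup>2 \<le> ((1 + e) ^ m)\<^sup>2"
        using Bernoulli_inequality[of e m] e m0 by (intro power_mono) auto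
      also have "\<dots> = (1 + e) ^ (2 * m)" by (simp add: power_mult mult.commute[of 2])
      also have "\<dots> = P ^ (2 * m) / Q ^ (2 * m)" using e(2) by (metis power_divide)
      also have "\<dots> \<le> C * real m + 1" using le[of j] Q0 m by (simp add: divide_le_eq)
      also have "\<dots> \<le> (C + 1) * real m" using m by (simp add: algebra_simps)
      finally have "real m * (real m * e\<^sup>2) \<le> real m * (C + 1)" by (simp add: power2_eq_square algebra_simps)
      then show ?thesis using m0 by simp
    qed
    obtain j :: nat where j: "real j > (C + 1) / e\<^sup>2" using reals_Archimedean2 by blast
    have "real j \<le> real (2 ^ j)" using less_exp[of j] by (simp only: of_nat_le_iff less_imp_le)
    then have "(C + 1) / e\<^sup>2 < real (2 ^ j)" using j by linarith
    then have "C + 1 < real (2 ^ j) * e\<^sup>2" using e by (simp add: divide_less_eq)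
    then show False using bound[of "2 ^ j" j] by simp
  qed
qed

text \<open>This is \<open>(x\<^sup>*x)\<^sup>m\<close> for \<open>m = 2\<^sup>j\<close>, built by squaring so that the C*-identity applies at each step.\<close>

fun square_power :: "'a cp_gen free_star \<Rightarrow> nat \<Rightarrow> 'a cp_gen free_star" where
  "square_power x 0 = free_adj x * x"
| "square_power x (Suc j) = square_power x j * square_power x j"

lemma square_power_adj: "free_adj (square_power x j) = square_power x j"
  by (induction j) (simp_all add: free_adj_mult)

lemma square_power_degree: "degree_bound n x \<Longrightarrow> degree_bound (2 * n * 2 ^ j) (square_power x j)"
proof (induction j)
  case 0
  then show ?case using degree_bound_mult[OF degree_bound_adj, of n x n x] by (simp add: mult_2)
next
  case (Suc j)
  then show ?case using degree_bound_mult[OF Suc.IH Suc.IH] by (simp add: algebra_simps)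
qed

lemma square_power_norm:
  assumes "admissible p"
  shows "p (square_power x j) = p x ^ (2 * 2 ^ j)"
proof -
  interpret cstar_sn p by (rule admissible_sn) fact
  show ?thesis
  proof (induction j)
    case 0
    show ?case by (simp add: p_cstar)
  next
    case (Suc j)
    have "p (square_power x (Suc j)) = (p (square_power x j))\<^sup>2"
      using p_cstar[of "square_power x j"] by (simp add: square_power_adj)
    then show ?case by (simp add: Suc power_mult[symmetric] mult.commute mult.left_commute)
  qed
qed

theorem admissible_le_reg_norm:
  assumes p: "admissible p"
  shows "p x \<le> reg_norm x"
proof -
  obtain n where n: "degree_bound n x" using degree_bound_exists by blast
  interpret cstar_sn p by (rule admissible_sn[OF p])
  show ?thesis
  proof (rule power_growth)
    show "0 \<le> 4 * real n" by simp
    show "p x ^ (2 * 2 ^ j) \<le> (4 * real n * 2 ^ j + 1) * reg_norm x ^ (2 * 2 ^ j)" for j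
      using le_degree_times_reg_norm[OF p square_power_degree[OF n, of j]]
      by (simp add: square_power_norm[OF p] square_power_norm[OF admissible_reg] mult.assoc)
  qed (rule reg_norm_nonneg p_pos)+
qed

theorem universal_seminorm_eq: "universal_seminorm (cp_relators \<delta> \<delta>s) = reg_norm"
proof
  fix x
  show "universal_seminorm (cp_relators \<delta> \<delta>s) x = reg_norm x"
    unfolding universal_seminorm_def
  proof (rule cSup_eq_maximum)
    show "reg_norm x \<in> {p x |p. cstar_seminorm p \<and> (\<forall>r\<in>cp_relators \<delta> \<delta>s. p r = 0)}"
      using admissible_reg by (auto simp: admissible_def)
    fix r assume "r \<in> {p x |p. cstar_seminorm p \<and> (\<forall>r\<in>cp_relators \<delta> \<delta>s. p r = 0)}"
    then show "r \<le> reg_norm x" using admissible_le_reg_norm by (auto simp: admissible_def)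
  qed
qed

end


section \<open>The representation of the crossed product\<close>

context hilb
begin

lemma conv_const: "x \<in> hcarrier H \<Longrightarrow> conv (\<lambda>_. x) x"
  by (simp add: conv_def)

lemma convI:
  assumes "\<And>n. X n \<in> hcarrier H" "x \<in> hcarrier H" "\<And>n. hnorm H (hsub H (X n) x) \<le> a n" "a \<longlonglongrightarrow> 0"
  shows "conv X x"
proof -
  have "(\<lambda>n. hnorm H (hsub H (X n) x)) \<longlonglongrightarrow> 0"
  proof (rule Lim_null_comparison[OF always_eventually[OF allI] assms(4)])
    fix n show "norm (hnorm H (hsub H (X n) x)) \<le> a n"
      using assms(3)[of n] hnorm_nonneg[of "hsub H (X n) x"] assms(1,2) by simp
  qed
  then show ?thesis using assms(1,2) by (simp add: conv_def)
qed

lemma convD: "conv X x \<Longrightarrow> X n \<in> hcarrier H" "conv X x \<Longrightarrow> x \<in> hcarrier H"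
  "conv X x \<Longrightarrow> (\<lambda>n. hnorm H (hsub H (X n) x)) \<longlonglongrightarrow> 0"
  by (simp_all add: conv_def)

lemma conv_plus:
  assumes X: "conv X x" and Y: "conv Y y"
  shows "conv (\<lambda>n. hplus H (X n) (Y n)) (hplus H x y)"
proof (rule convI)
  note [simp] = convD(1,2)[OF X] convD(1,2)[OF Y]
  fix n
  have "hsub H (hplus H (X n) (Y n)) (hplus H x y) = hplus H (hsub H (X n) x) (hsub H (Y n) y)"
    by (auto simp: algebra_simps intro!: ext)
  then show "hnorm H (hsub H (hplus H (X n) (Y n)) (hplus H x y)) \<le>
      hnorm H (hsub H (X n) x) + hnorm H (hsub H (Y n) y)"
    by (simp add: hnorm_triangle)
qed (use convD[OF X] convD[OF Y] in \<open>auto intro: tendsto_add_zero\<close>)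

lemma conv_scale:
  assumes X: "conv X x"
  shows "conv (\<lambda>n. hscale H a (X n)) (hscale H a x)"
proof (rule convI)
  note [simp] = convD(1,2)[OF X]
  fix n
  have "hsub H (hscale H a (X n)) (hscale H a x) = hscale H a (hsub H (X n) x)"
    by (auto simp: algebra_simps intro!: ext)
  then show "hnorm H (hsub H (hscale H a (X n)) (hscale H a x)) \<le> cmod a * hnorm H (hsub H (X n) x)"
    by (simp add: hnorm_scale)
qed (use convD[OF X] in \<open>auto intro: tendsto_mult_right_zero\<close>)

lemma conv_equi:
  assumes X: "conv X x" and Y: "\<And>n. Y n \<in> hcarrier H" and XY: "(\<lambda>n. hnorm H (hsub H (Y n) (X n))) \<longlonglongrightarrow> 0"
  shows "conv Y x"
proof (rule convI)
  show "hnorm H (hsub H (Y n) x) \<le> hnorm H (hsub H (Y n) (X n)) + hnorm H (hsub H (X n) x)" for n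
    using convD[OF X] Y by (intro hsub_triangle) auto
qed (use convD[OF X] Y XY in \<open>auto intro: tendsto_add_zero\<close>)

end

context cstar_sn
begin

lemma adj_lipschitz: "p (free_adj x - free_adj y) \<le> 1 * p (x - y)"
  by (simp add: p_adj flip: free_adj_diff)

lemma scale_lipschitz: "p (free_scale a x - free_scale a y) \<le> cmod a * p (x - y)"
  by (simp add: p_scale flip: free_scale_diff)

lemma p_mult_diff: "p (x * y - x' * y') \<le> p (x - x') * p y + p x' * p (y - y')"
proof -
  have "x * y - x' * y' = (x - x') * y + x' * (y - y')" by (simp add: algebra_simps)
  then show ?thesis
    using p_triangle[of "(x - x') * y" "x' * (y - y')"] p_mult[of "x - x'" y] p_mult[of x' "y - y'"] by simp
qed

lemma cauchy_mult:
  assumes X: "cauchy_wrt p X" and Y: "cauchy_wrt p Y"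
  shows "cauchy_wrt p (\<lambda>n. X n * Y n)"
proof (rule cauchyI)
  fix e :: real assume e: "e > 0"
  obtain A where A: "A > 0" "\<And>n. p (X n) \<le> A" using cauchy_bounded[OF X] by blast
  obtain B where B: "B > 0" "\<And>n. p (Y n) \<le> B" using cauchy_bounded[OF Y] by blast
  obtain N where N: "\<And>m n. m \<ge> N \<Longrightarrow> n \<ge> N \<Longrightarrow> p (X m - X n) < e / (2 * B)"
    using cauchyD[OF X, of "e / (2 * B)"] e B(1) by (metis divide_pos_pos mult_pos_pos zero_less_numeral)
  obtain M where M: "\<And>m n. m \<ge> M \<Longrightarrow> n \<ge> M \<Longrightarrow> p (Y m - Y n) < e / (2 * A)"
    using cauchyD[OF Y, of "e / (2 * A)"] e A(1) by (metis divide_pos_pos mult_pos_pos zero_less_numeral)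
  have "p (X m * Y m - X n * Y n) < e" if "m \<ge> max N M" "n \<ge> max N M" for m n
  proof -
    have "p (X m - X n) * p (Y m) \<le> p (X m - X n) * B" "p (X n) * p (Y m - Y n) \<le> A * p (Y m - Y n)"
      using A(2) B(2) p_pos by (auto intro: mult_left_mono mult_right_mono)
    moreover have "p (X m - X n) * B < e / 2" "A * p (Y m - Y n) < e / 2"
      using N[of m n] M[of m n] that A(1) B(1) by (auto simp: field_simps)
    ultimately show ?thesis using p_mult_diff[of "X m" "Y m" "X n" "Y n"] by linarith
  qed
  then show "\<exists>N. \<forall>m\<ge>N. \<forall>n\<ge>N. p (X m * Y m - X n * Y n) < e" by blast
qed

lemma equi_mult:
  assumes Y: "cauchy_wrt p Y" and X': "cauchy_wrt p X'" and "equi X X'" "equi Y Y'"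
  shows "equi (\<lambda>n. X n * Y n) (\<lambda>n. X' n * Y' n)"
proof -
  obtain A where A: "\<And>n. p (X' n) \<le> A" using cauchy_bounded[OF X'] by blast
  obtain B where B: "\<And>n. p (Y n) \<le> B" using cauchy_bounded[OF Y] by blast
  have "p (X n * Y n - X' n * Y' n) \<le> p (X n - X' n) * B + A * p (Y n - Y' n)" for n
    using p_mult_diff[of "X n" "Y n" "X' n" "Y' n"] mult_left_mono[OF B[of n] p_pos[of "X n - X' n"]]
      mult_right_mono[OF A[of n] p_pos[of "Y n - Y' n"]] by linarith
  moreover have "(\<lambda>n. p (X n - X' n) * B + A * p (Y n - Y' n)) \<longlonglongrightarrow> 0"
    using assms(3,4) unfolding equi_def
    by (intro tendsto_add_zero tendsto_mult_left_zero tendsto_mult_right_zero)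
  ultimately show ?thesis unfolding equi_def by (rule null_le[rotated])
qed

lemma lift2_mult:
  assumes X: "cauchy_wrt p X" and Y: "cauchy_wrt p Y"
  shows "lift2 p (*) (seq_class p X) (seq_class p Y) = seq_class p (\<lambda>n. X n * Y n)"
  unfolding lift2_def
  by (rule seq_class_eq_iff[THEN iffD2])
    (intro cauchy_mult equi_mult equi_sym[OF rep_seq_class(2)] rep_seq_class(1) assms)+

lemma lift1_scale: "cauchy_wrt p X \<Longrightarrow> lift1 p (free_scale a) (seq_class p X) = seq_class p (\<lambda>n. free_scale a (X n))"
  unfolding lift1_eq_cmap by (rule cmap_class[OF seminormed_axioms seminormed_axioms scale_lipschitz])

lemma lift1_adj: "cauchy_wrt p X \<Longrightarrow> lift1 p free_adj (seq_class p X) = seq_class p (\<lambda>n. free_adj (X n))"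
  unfolding lift1_eq_cmap by (rule cmap_class[OF seminormed_axioms seminormed_axioms adj_lipschitz])

lemma cauchy_scale: "cauchy_wrt p X \<Longrightarrow> cauchy_wrt p (\<lambda>n. free_scale a (X n))"
  by (rule seminormed_cauchy_map[OF seminormed_axioms seminormed_axioms scale_lipschitz])

lemma cauchy_adj: "cauchy_wrt p X \<Longrightarrow> cauchy_wrt p (\<lambda>n. free_adj (X n))"
  by (rule seminormed_cauchy_map[OF seminormed_axioms seminormed_axioms adj_lipschitz])

lemma cauchy_diff: "cauchy_wrt p X \<Longrightarrow> cauchy_wrt p Y \<Longrightarrow> cauchy_wrt p (\<lambda>n. X n - Y n)"
  using cauchy_add[of X "\<lambda>n. free_scale (- 1) (Y n)"] cauchy_scale[of Y "- 1"] by (simp add: free_scale_minus_one)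

text \<open>The Neumann series at the level of representing sequences: the partial sums of the geometric
  series of \<open>Y n\<close>, taken up to the same index \<open>n\<close>, form a Cauchy sequence inverting \<open>1 - Y n\<close>.\<close>

lemma neumann:
  assumes Y: "cauchy_wrt p Y" and \<theta>: "\<theta> < 1" "\<And>n. p (Y n) \<le> \<theta>"
  obtains G where "cauchy_wrt p G" "equi (\<lambda>n. G n * (1 - Y n)) (\<lambda>_. 1)"
proof -
  define G where "G n = (\<Sum>k<n. Y n ^ k)" for n
  have \<theta>0: "\<theta> \<ge> 0" using \<theta>(2)[of 0] p_pos[of "Y 0"] by linarith
  have left: "G n * (1 - Y n) = 1 - Y n ^ n" and right: "(1 - Y n) * G n = 1 - Y n ^ n" for n
  proof -
    have g: "(\<Sum>k<m. y ^ k) * (1 - y) = 1 - y ^ m \<and> (1 - y) * (\<Sum>k<m. y ^ k) = 1 - y ^ m"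
      for m and y :: "'g free_star"
    proof (induction m)
      case (Suc m)
      have "y ^ m * (1 - y) = y ^ m - y ^ Suc m" "(1 - y) * y ^ m = y ^ m - y ^ Suc m"
        by (simp_all add: right_diff_distrib left_diff_distrib power_commutes)
      then show ?case
        using Suc.IH by (simp only: sum.lessThan_Suc distrib_left distrib_right) simp
    qed simp
    show "G n * (1 - Y n) = 1 - Y n ^ n" "(1 - Y n) * G n = 1 - Y n ^ n"
      unfolding G_def using g[of "Y n" n] by blast+
  qed
  have pow: "p (Y n ^ k) \<le> \<theta> ^ k" for n k
  proof (induction k)
    case (Suc k)
    have "p (Y n ^ Suc k) \<le> p (Y n) * p (Y n ^ k)" by (simp add: p_mult)
    also have "\<dots> \<le> \<theta> * \<theta> ^ k" using Suc \<theta> \<theta>0 p_pos by (intro mult_mono) auto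
    finally show ?case by simp
  qed (simp add: p_one)
  have G: "p (G n) \<le> 1 / (1 - \<theta>)" for n
  proof -
    have "p (\<Sum>k<m. Y n ^ k) \<le> (\<Sum>k<m. \<theta> ^ k)" for m
    proof (induction m)
      case (Suc m)
      then show ?case using p_triangle[of "\<Sum>k<m. Y n ^ k" "Y n ^ m"] pow[of n m] by simp
    qed (simp add: p_zero)
    then have "p (G n) \<le> (\<Sum>k<n. \<theta> ^ k)" by (simp add: G_def)
    also have "\<dots> = (1 - \<theta> ^ n) / (1 - \<theta>)" using \<theta>(1) by (subst sum_gp_strict) auto
    also have "\<dots> \<le> 1 / (1 - \<theta>)" using \<theta>(1) \<theta>0 by (intro divide_right_mono) auto
    finally show ?thesis .
  qed
  define B where "B = 1 / (1 - \<theta>)"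
  have B: "B > 0" "\<And>n. p (G n) \<le> B" using \<theta>(1) G by (auto simp: B_def)
  have diff: "p (G n - G m) \<le> B * B * p (Y n - Y m) + B * (\<theta> ^ m + \<theta> ^ n)" for m n
  proof -
    have "G n - G m = G n * (Y n - Y m) * G m + (G n * Y m ^ m - Y n ^ n * G m)"
    proof -
      have "G n * (Y n - Y m) * G m = G n * ((1 - Y m) * G m) - (G n * (1 - Y n)) * G m"
        by (simp add: algebra_simps)
      also have "\<dots> = G n - G n * Y m ^ m - (G m - Y n ^ n * G m)"
        unfolding left right by (simp add: algebra_simps)
      finally show ?thesis by simp
    qed
    then have "p (G n - G m) \<le> p (G n * (Y n - Y m) * G m) + (p (G n * Y m ^ m) + p (Y n ^ n * G m))"
      using p_triangle[of "G n * (Y n - Y m) * G m" "G n * Y m ^ m - Y n ^ n * G m"]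
        p_diff_le[of "G n * Y m ^ m" "Y n ^ n * G m"] by simp
    moreover have "p (G n * (Y n - Y m) * G m) \<le> B * p (Y n - Y m) * B"
      using p_mult[of "G n * (Y n - Y m)" "G m"] p_mult[of "G n" "Y n - Y m"] B p_pos
      by (meson mult_mono order_trans p_pos mult_nonneg_nonneg less_imp_le order_refl)
    moreover have "p (G n * Y m ^ m) \<le> B * \<theta> ^ m"
      using p_mult[of "G n" "Y m ^ m"] mult_mono[OF B(2)[of n] pow[of m m]] B(1) p_pos by force
    moreover have "p (Y n ^ n * G m) \<le> \<theta> ^ n * B"
      using p_mult[of "Y n ^ n" "G m"] mult_mono[OF pow[of n n] B(2)[of m]] \<theta>0 p_pos by force
    ultimately show ?thesis by (simp add: algebra_simps)
  qed
  have \<theta>lim: "(\<lambda>n. \<theta> ^ n) \<longlonglongrightarrow> 0" using \<theta> \<theta>0 by (intro LIMSEQ_power_zero) auto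
  have "cauchy_wrt p G"
  proof (rule cauchyI)
    fix e :: real assume e: "e > 0"
    obtain N where N: "\<And>m n. m \<ge> N \<Longrightarrow> n \<ge> N \<Longrightarrow> p (Y m - Y n) < e / (2 * (B * B))"
      using cauchyD[OF Y, of "e / (2 * (B * B))"] e B(1) by (metis divide_pos_pos mult_pos_pos zero_less_numeral)
    obtain M where M: "\<And>n. n \<ge> M \<Longrightarrow> \<theta> ^ n < e / (4 * B)"
      using order_tendstoD(2)[OF \<theta>lim, of "e / (4 * B)"] e B(1) by (auto simp: eventually_sequentially)
    have "p (G n - G m) < e" if "n \<ge> max N M" "m \<ge> max N M" for n m
    proof -
      have "B * B * p (Y n - Y m) < e / 2" using N[of n m] that B(1) by (simp add: field_simps)
      moreover have "B * \<theta> ^ m < e / 4" "B * \<theta> ^ n < e / 4"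
        using M[of n] M[of m] that B(1) by (auto simp: field_simps)
      ultimately show ?thesis using diff[of n m] by (simp add: distrib_left)
    qed
    then show "\<exists>N. \<forall>m\<ge>N. \<forall>n\<ge>N. p (G m - G n) < e" by blast
  qed
  moreover have "equi (\<lambda>n. G n * (1 - Y n)) (\<lambda>_. 1)"
    unfolding equi_def left by (rule null_le[OF \<theta>lim]) (simp add: p_minus pow)
  ultimately show ?thesis using that by blast
qed

end

context transfer_system
begin

sublocale Q: cstar_sn reg_norm
  by (rule admissible_sn[OF admissible_reg])

abbreviation B where "B \<equiv> crossed_product \<delta> \<delta>s"
abbreviation cls where "cls \<equiv> seq_class reg_norm"

lemma B_simps:
  "acarrier B = completion reg_norm" "aplus B = lift2 reg_norm (+)"
  "ascale B = (\<lambda>a. lift1 reg_norm (free_scale a))" "atimes B = lift2 reg_norm (*)"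
  "astar B = lift1 reg_norm free_adj"
  by (simp_all add: crossed_product_def universal_cstar_algebra_def universal_seminorm_eq Let_def)

lemma B_class:
  assumes "cauchy_wrt reg_norm X"
  shows "cls X \<in> acarrier B" "ascale B a (cls X) = cls (\<lambda>n. free_scale a (X n))"
    "astar B (cls X) = cls (\<lambda>n. free_adj (X n))"
    "cauchy_wrt reg_norm Y \<Longrightarrow> aplus B (cls X) (cls Y) = cls (\<lambda>n. X n + Y n)"
    "cauchy_wrt reg_norm Y \<Longrightarrow> atimes B (cls X) (cls Y) = cls (\<lambda>n. X n * Y n)"
  using assms by (simp_all add: B_simps Q.seq_class_in Q.lift1_scale Q.lift1_adj Q.lift2_add Q.lift2_mult)

lemma B_cases:
  assumes "C \<in> acarrier B"
  obtains X where "cauchy_wrt reg_norm X" "C = cls X"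
  using assms by (auto simp: B_simps completion_def)

definition emb where "emb = embed reg_norm"

lemma emb_cls: "emb x = cls (\<lambda>_. x)"
  by (simp add: emb_def embed_def)

lemma emb_ops:
  "emb x \<in> acarrier B" "aplus B (emb x) (emb y) = emb (x + y)" "atimes B (emb x) (emb y) = emb (x * y)"
  "ascale B a (emb x) = emb (free_scale a x)" "astar B (emb x) = emb (free_adj x)"
  by (simp_all add: emb_cls B_class)

lemma cp_emb: "cp_coeff \<delta> \<delta>s a = emb (c a)" "cp_isometry \<delta> \<delta>s = emb V"
  by (simp_all add: cp_coeff_def cp_isometry_def universal_seminorm_eq emb_def)

lemma emb_one: "emb 1 = cp_coeff \<delta> \<delta>s 1"
  unfolding cp_emb emb_def Q.embed_eq_iff
  by (rule eqvD[OF eqv_sym[OF c_one] admissible_reg])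


subsection \<open>Existence\<close>

lemma ev_diff: "\<xi> \<in> hcarrier H \<Longrightarrow> ev (x - y) \<xi> = hsub H (ev x \<xi>) (ev y \<xi>)"
proof -
  assume \<xi>: "\<xi> \<in> hcarrier H"
  have "ev (x + free_scale (- 1) y) \<xi> = hsub H (ev x \<xi>) (ev y \<xi>)"
    using \<xi> unfolding ev_add ev_scale by simp
  then show ?thesis by (simp add: free_scale_minus_one)
qed

lemma ev_conv:
  assumes X: "cauchy_wrt reg_norm X" and \<xi>: "\<xi> \<in> hcarrier H"
  shows "\<exists>y. R.conv (\<lambda>n. ev (X n) \<xi>) y"
proof -
  have "\<exists>y\<in>hcarrier H. (\<lambda>n. hnorm H (hsub H (ev (X n) \<xi>) y)) \<longlonglongrightarrow> 0"
  proof (rule R.complete)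
    fix e :: real assume e: "e > 0"
    let ?k = "hnorm H \<xi> + 1"
    have k: "?k > 0" using R.hnorm_nonneg[OF \<xi>] by linarith
    obtain N where N: "\<And>m n. m \<ge> N \<Longrightarrow> n \<ge> N \<Longrightarrow> reg_norm (X m - X n) < e / ?k"
      using Q.cauchyD[OF X, of "e / ?k"] e k by (metis divide_pos_pos)
    have "hnorm H (hsub H (ev (X m) \<xi>) (ev (X n) \<xi>)) < e" if "m \<ge> N" "n \<ge> N" for m n
    proof -
      have "hnorm H (hsub H (ev (X m) \<xi>) (ev (X n) \<xi>)) \<le> reg_norm (X m - X n) * hnorm H \<xi>"
        using ev_bound[OF \<xi>, of "X m - X n"] by (simp only: ev_diff[OF \<xi>])
      also have "\<dots> \<le> reg_norm (X m - X n) * ?k" by (intro mult_left_mono reg_norm_nonneg) simp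
      also have "\<dots> < e" using N[OF that] k by (simp add: field_simps)
      finally show ?thesis .
    qed
    then show "\<exists>N. \<forall>m\<ge>N. \<forall>n\<ge>N. hnorm H (hsub H (ev (X m) \<xi>) (ev (X n) \<xi>)) < e" by blast
  qed (use \<xi> in simp)
  then show ?thesis using \<xi> by (auto simp: R.conv_def)
qed

lemma ev_conv_equi:
  assumes "Q.equi Y X" "\<xi> \<in> hcarrier H" "R.conv (\<lambda>n. ev (X n) \<xi>) y"
  shows "R.conv (\<lambda>n. ev (Y n) \<xi>) y"
proof (rule R.conv_equi[OF assms(3)])
  show "ev (Y n) \<xi> \<in> hcarrier H" for n using assms(2) by simp
  have nn: "0 \<le> hnorm H (hsub H (ev (Y n) \<xi>) (ev (X n) \<xi>))" for n using assms(2) by (intro R.hnorm_nonneg) auto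
  have le: "hnorm H (hsub H (ev (Y n) \<xi>) (ev (X n) \<xi>)) \<le> reg_norm (Y n - X n) * hnorm H \<xi>" for n
    using ev_bound[OF assms(2), of "Y n - X n"] by (simp only: ev_diff[OF assms(2)])
  have lim: "(\<lambda>n. reg_norm (Y n - X n) * hnorm H \<xi>) \<longlonglongrightarrow> 0"
    using assms(1) unfolding Q.equi_def by (rule tendsto_mult_left_zero)
  show "(\<lambda>n. hnorm H (hsub H (ev (Y n) \<xi>) (ev (X n) \<xi>))) \<longlonglongrightarrow> 0"
    by (rule tendsto_sandwich[OF always_eventually[OF allI] always_eventually[OF allI] tendsto_const lim])
      (rule nn le)+
qed

definition \<rho> :: "(nat \<Rightarrow> 'a cp_gen free_star) set \<Rightarrow> 'a reg_vector \<Rightarrow> 'a reg_vector" where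
  "\<rho> = (\<lambda>C\<in>acarrier B. \<lambda>\<xi>\<in>hcarrier H. SOME y. R.conv (\<lambda>n. ev (rep_seq C n) \<xi>) y)"

lemma \<rho>_conv:
  assumes X: "cauchy_wrt reg_norm X" and \<xi>: "\<xi> \<in> hcarrier H"
  shows "R.conv (\<lambda>n. ev (X n) \<xi>) (\<rho> (cls X) \<xi>)"
proof -
  let ?Y = "rep_seq (cls X)"
  note rX = Q.rep_seq_class[OF X]
  have "R.conv (\<lambda>n. ev (?Y n) \<xi>) (SOME y. R.conv (\<lambda>n. ev (?Y n) \<xi>) y)"
    by (rule someI_ex[OF ev_conv[OF rX(1) \<xi>]])
  then have "R.conv (\<lambda>n. ev (?Y n) \<xi>) (\<rho> (cls X) \<xi>)"
    using \<xi> B_class(1)[OF X] by (simp add: \<rho>_def)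
  then show ?thesis by (rule ev_conv_equi[OF rX(2) \<xi>])
qed

lemma \<rho>_eqI: "cauchy_wrt reg_norm X \<Longrightarrow> \<xi> \<in> hcarrier H \<Longrightarrow> R.conv (\<lambda>n. ev (X n) \<xi>) y \<Longrightarrow> \<rho> (cls X) \<xi> = y"
  by (rule R.conv_unique[OF \<rho>_conv])

lemma \<rho>_closed: "cauchy_wrt reg_norm X \<Longrightarrow> \<xi> \<in> hcarrier H \<Longrightarrow> \<rho> (cls X) \<xi> \<in> hcarrier H"
  by (rule R.convD(2)[OF \<rho>_conv])

lemma \<rho>_bound:
  fixes N :: nat
  assumes X: "cauchy_wrt reg_norm X" and \<xi>: "\<xi> \<in> hcarrier H" and b: "\<And>n. n \<ge> N \<Longrightarrow> reg_norm (X n) \<le> b"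
  shows "hnorm H (\<rho> (cls X) \<xi>) \<le> b * hnorm H \<xi>"
proof (rule LIMSEQ_le_const2[OF R.conv_hnorm[OF \<rho>_conv[OF X \<xi>]]])
  have "hnorm H (ev (X n) \<xi>) \<le> b * hnorm H \<xi>" if "n \<ge> N" for n
    using ev_bound[OF \<xi>, of "X n"] mult_right_mono[OF b[OF that] R.hnorm_nonneg[OF \<xi>]] by linarith
  then show "\<exists>N. \<forall>n\<ge>N. hnorm H (ev (X n) \<xi>) \<le> b * hnorm H \<xi>" by blast
qed

lemma \<rho>_in:
  assumes X: "cauchy_wrt reg_norm X"
  shows "\<rho> (cls X) \<in> bounded_ops H"
proof -
  obtain b where b: "\<And>n. reg_norm (X n) \<le> b" using Q.cauchy_bounded[OF X] by blast
  have "bdd_map H H b (\<rho> (cls X))"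
    unfolding bdd_map_def
  proof (intro conjI ballI allI funcsetI)
    fix \<xi> assume \<xi>: "\<xi> \<in> hcarrier H"
    show "\<rho> (cls X) \<xi> \<in> hcarrier H" by (rule \<rho>_closed[OF X \<xi>])
    show "hnorm H (\<rho> (cls X) \<xi>) \<le> b * hnorm H \<xi>" by (rule \<rho>_bound[OF X \<xi> b])
    show "\<rho> (cls X) (hscale H a \<xi>) = hscale H a (\<rho> (cls X) \<xi>)" for a
      using R.conv_scale[OF \<rho>_conv[OF X \<xi>], of a] \<xi>
      by (intro \<rho>_eqI[OF X]) (simp_all add: R.bounded_opsD(3)[OF ev_in])
    fix \<eta> assume \<eta>: "\<eta> \<in> hcarrier H"
    show "\<rho> (cls X) (hplus H \<xi> \<eta>) = hplus H (\<rho> (cls X) \<xi>) (\<rho> (cls X) \<eta>)"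
      using R.conv_plus[OF \<rho>_conv[OF X \<xi>] \<rho>_conv[OF X \<eta>]] \<xi> \<eta>
      by (intro \<rho>_eqI[OF X]) (simp_all add: R.bounded_opsD(2)[OF ev_in])
  qed
  then show ?thesis by (rule R.bounded_opsI[rotated]) (simp add: \<rho>_def B_class(1)[OF X])
qed

lemma \<rho>_emb: "\<rho> (emb x) = ev x"
  unfolding emb_cls
  by (rule R.op_eqI) (auto intro!: \<rho>_in \<rho>_eqI R.conv_const)

lemma \<rho>_representation: "star_representation B H \<rho>"
  unfolding star_representation_def
proof (intro conjI ballI allI funcsetI)
  fix C assume "C \<in> acarrier B"
  then obtain X where X: "cauchy_wrt reg_norm X" "C = cls X" by (rule B_cases)
  show "\<rho> C \<in> bounded_ops H" unfolding X(2) by (rule \<rho>_in[OF X(1)])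
  show "\<rho> (ascale B a C) \<xi> = hscale H a (\<rho> C \<xi>)" if \<xi>: "\<xi> \<in> hcarrier H" for a \<xi>
    unfolding X(2) B_class(2)[OF X(1)]
    using R.conv_scale[OF \<rho>_conv[OF X(1) \<xi>], of a] \<xi>
    by (intro \<rho>_eqI Q.cauchy_scale X) (simp_all add: ev_scale)
  show "mutually_adjoint H (\<rho> C) (\<rho> (astar B C))"
    unfolding mutually_adjoint_def
  proof (intro ballI)
    fix \<xi> \<eta> assume \<xi>: "\<xi> \<in> hcarrier H" and \<eta>: "\<eta> \<in> hcarrier H"
    have "(\<lambda>n. hinner H (ev (X n) \<xi>) \<eta>) \<longlonglongrightarrow> hinner H (\<rho> C \<xi>) \<eta>"
      unfolding X(2) by (rule R.conv_inner[OF \<rho>_conv[OF X(1) \<xi>] \<eta>])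
    moreover have "(\<lambda>n. cnj (hinner H (ev (free_adj (X n)) \<eta>) \<xi>)) \<longlonglongrightarrow> cnj (hinner H (\<rho> (astar B C) \<eta>) \<xi>)"
      unfolding X(2) B_class(3)[OF X(1)]
      by (intro tendsto_cnj R.conv_inner \<rho>_conv Q.cauchy_adj X \<eta> \<xi>)
    moreover have "cnj (hinner H (ev (free_adj (X n)) \<eta>) \<xi>) = hinner H (ev (X n) \<xi>) \<eta>" for n
      using R.adjointD[OF ev_adjoint \<xi> \<eta>] R.inner_cnj[OF ev_closed[OF \<eta>] \<xi>] by simp
    moreover have "cnj (hinner H (\<rho> (astar B C) \<eta>) \<xi>) = hinner H \<xi> (\<rho> (astar B C) \<eta>)"
      using R.inner_cnj[OF \<rho>_closed[OF Q.cauchy_adj[OF X(1)] \<eta>] \<xi>] unfolding X(2) B_class(3)[OF X(1)] by simp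
    ultimately show "hinner H (\<rho> C \<xi>) \<eta> = hinner H \<xi> (\<rho> (astar B C) \<eta>)"
      using LIMSEQ_unique by auto
  qed
  fix D assume "D \<in> acarrier B"
  then obtain Y where Y: "cauchy_wrt reg_norm Y" "D = cls Y" by (rule B_cases)
  show "\<rho> (aplus B C D) \<xi> = hplus H (\<rho> C \<xi>) (\<rho> D \<xi>)" if \<xi>: "\<xi> \<in> hcarrier H" for \<xi>
    unfolding X(2) Y(2) B_class(4)[OF X(1) Y(1)]
    using R.conv_plus[OF \<rho>_conv[OF X(1) \<xi>] \<rho>_conv[OF Y(1) \<xi>]] \<xi>
    by (intro \<rho>_eqI Q.cauchy_add X Y) (simp_all add: ev_add)
  show "\<rho> (atimes B C D) = op_comp H (\<rho> C) (\<rho> D)"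
  proof (rule R.op_eqI)
    fix \<xi> assume \<xi>: "\<xi> \<in> hcarrier H"
    obtain b where b: "\<And>n. reg_norm (X n) \<le> b" using Q.cauchy_bounded[OF X(1)] by blast
    let ?y = "\<rho> D \<xi>"
    have y: "?y \<in> hcarrier H" unfolding Y(2) by (rule \<rho>_closed[OF Y(1) \<xi>])
    note cY = \<rho>_conv[OF Y(1) \<xi>, folded Y(2)]
    have "R.conv (\<lambda>n. ev (X n) (ev (Y n) \<xi>)) (\<rho> C ?y)"
    proof (rule R.conv_equi[OF \<rho>_conv[OF X(1) y, folded X(2)]])
      show "ev (X n) (ev (Y n) \<xi>) \<in> hcarrier H" for n using \<xi> by simp
      have eq: "hsub H (ev (X n) (ev (Y n) \<xi>)) (ev (X n) ?y) = ev (X n) (hsub H (ev (Y n) \<xi>) ?y)" for n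
        using \<xi> y by (simp add: R.bounded_opsD(2,3)[OF ev_in])
      have s: "hsub H (ev (Y n) \<xi>) ?y \<in> hcarrier H" for n using \<xi> y by simp
      have le: "hnorm H (hsub H (ev (X n) (ev (Y n) \<xi>)) (ev (X n) ?y)) \<le> b * hnorm H (hsub H (ev (Y n) \<xi>) ?y)" for n
        unfolding eq using ev_bound[OF s, of "X n" n] mult_right_mono[OF b[of n] R.hnorm_nonneg[OF s[of n]]] by linarith
      have nn: "0 \<le> hnorm H (hsub H (ev (X n) (ev (Y n) \<xi>)) (ev (X n) ?y))" for n
        unfolding eq using s by (intro R.hnorm_nonneg) simp
      have lim: "(\<lambda>n. b * hnorm H (hsub H (ev (Y n) \<xi>) ?y)) \<longlonglongrightarrow> 0"
        using R.convD(3)[OF cY] by (rule tendsto_mult_right_zero)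
      show "(\<lambda>n. hnorm H (hsub H (ev (X n) (ev (Y n) \<xi>)) (ev (X n) ?y))) \<longlonglongrightarrow> 0"
        by (rule tendsto_sandwich[OF always_eventually[OF allI] always_eventually[OF allI] tendsto_const lim])
          (rule nn le)+
    qed
    then have "R.conv (\<lambda>n. ev (X n * Y n) \<xi>) (\<rho> C ?y)" using \<xi> by (simp add: ev_mult)
    then have "\<rho> (cls (\<lambda>n. X n * Y n)) \<xi> = \<rho> C ?y" by (rule \<rho>_eqI[OF Q.cauchy_mult[OF X(1) Y(1)] \<xi>])
    then show "\<rho> (atimes B C D) \<xi> = op_comp H (\<rho> C) (\<rho> D) \<xi>"
      using \<xi> B_class(5)[OF X(1) Y(1)] by (simp add: X(2) Y(2))
  qed (use B_class(5)[OF X(1) Y(1)] \<rho>_in X Y Q.cauchy_mult in auto)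
qed

lemma \<rho>_regular: "regular_representation \<delta> \<delta>s \<rho>"
  unfolding regular_representation_def
  by (auto simp: \<rho>_representation cp_emb \<rho>_emb ev_coeff ev_V) (simp add: \<rho>_def)

text \<open>If \<open>\<rho>\<close> kills the class of the Cauchy sequence \<open>Z\<close>, the operators of \<open>Z n\<close> are limits of those of
  \<open>Z n - Z m\<close>, so their norms are small.\<close>

lemma \<rho>_faithful: "faithful B \<rho>"
  unfolding faithful_def
proof (rule inj_onI)
  fix C D assume "C \<in> acarrier B" "D \<in> acarrier B" and eq: "\<rho> C = \<rho> D"
  then obtain X Y where X: "cauchy_wrt reg_norm X" "C = cls X" and Y: "cauchy_wrt reg_norm Y" "D = cls Y"
    using B_cases by metis
  define Z where "Z n = X n - Y n" for n
  have Z: "cauchy_wrt reg_norm Z" unfolding Z_def by (rule Q.cauchy_diff[OF X(1) Y(1)])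
  have lim0: "R.conv (\<lambda>n. ev (Z n) \<xi>) R.hzero" if \<xi>: "\<xi> \<in> hcarrier H" for \<xi>
  proof -
    note cX = \<rho>_conv[OF X(1) \<xi>] and cY = \<rho>_conv[OF Y(1) \<xi>]
    have "R.conv (\<lambda>n. hsub H (ev (X n) \<xi>) (ev (Y n) \<xi>)) (hsub H (\<rho> (cls X) \<xi>) (\<rho> (cls Y) \<xi>))"
      by (intro R.conv_plus R.conv_scale cX cY)
    moreover have "hsub H (\<rho> (cls X) \<xi>) (\<rho> (cls Y) \<xi>) = R.hzero"
      using eq R.convD(2)[OF cX] by (simp add: X(2) Y(2))
    ultimately show ?thesis by (simp add: Z_def ev_diff[OF \<xi>])
  qed
  have "(\<lambda>n. reg_norm (Z n)) \<longlonglongrightarrow> 0"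
  proof (rule LIMSEQ_I)
    fix e :: real assume e: "e > 0"
    obtain N where N: "\<And>m n. m \<ge> N \<Longrightarrow> n \<ge> N \<Longrightarrow> reg_norm (Z m - Z n) < e / 2"
      using Q.cauchyD[OF Z, of "e / 2"] e by auto
    have "reg_norm (Z n) \<le> e / 2" if n: "n \<ge> N" for n
    proof (rule reg_norm_le)
      fix \<xi> assume \<xi>: "\<xi> \<in> hcarrier H"
      have "R.conv (\<lambda>m. hsub H (ev (Z n) \<xi>) (ev (Z m) \<xi>)) (hsub H (ev (Z n) \<xi>) R.hzero)"
        by (intro R.conv_plus R.conv_scale R.conv_const lim0 \<xi> ev_closed)
      then have c: "R.conv (\<lambda>m. ev (Z n - Z m) \<xi>) (ev (Z n) \<xi>)" using \<xi> by (simp add: ev_diff)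
      show "hnorm H (ev (Z n) \<xi>) \<le> e / 2 * hnorm H \<xi>"
      proof (rule LIMSEQ_le_const2[OF R.conv_hnorm[OF c]])
        have "hnorm H (ev (Z n - Z m) \<xi>) \<le> e / 2 * hnorm H \<xi>" if "m \<ge> N" for m
          using ev_bound[OF \<xi>, of "Z n - Z m"]
            mult_right_mono[OF less_imp_le[OF N[OF n that]] R.hnorm_nonneg[OF \<xi>]] by linarith
        then show "\<exists>N. \<forall>m\<ge>N. hnorm H (ev (Z n - Z m) \<xi>) \<le> e / 2 * hnorm H \<xi>" by blast
      qed
    qed (use e in simp)
    then have "norm (reg_norm (Z n) - 0) < e" if "n \<ge> N" for n using that e reg_norm_nonneg[of "Z n"] by force
    then show "\<exists>N. \<forall>n\<ge>N. norm (reg_norm (Z n) - 0) < e" by blast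
  qed
  then show "C = D" using X Y by (simp add: Q.seq_class_eq_iff Q.equi_def Z_def)
qed


subsection \<open>Uniqueness\<close>

context
  fixes \<sigma>
  assumes \<sigma>: "regular_representation \<delta> \<delta>s \<sigma>"
begin

lemma \<sigma>_rep: "star_representation B H \<sigma>"
  using \<sigma> by (simp add: regular_representation_def)

lemma \<sigma>_in: "C \<in> acarrier B \<Longrightarrow> \<sigma> C \<in> bounded_ops H"
  and \<sigma>_plus: "C \<in> acarrier B \<Longrightarrow> D \<in> acarrier B \<Longrightarrow> \<xi> \<in> hcarrier H \<Longrightarrow> \<sigma> (aplus B C D) \<xi> = hplus H (\<sigma> C \<xi>) (\<sigma> D \<xi>)"
  and \<sigma>_scale: "C \<in> acarrier B \<Longrightarrow> \<xi> \<in> hcarrier H \<Longrightarrow> \<sigma> (ascale B a C) \<xi> = hscale H a (\<sigma> C \<xi>)"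
  and \<sigma>_times: "C \<in> acarrier B \<Longrightarrow> D \<in> acarrier B \<Longrightarrow> \<sigma> (atimes B C D) = op_comp H (\<sigma> C) (\<sigma> D)"
  and \<sigma>_adj: "C \<in> acarrier B \<Longrightarrow> mutually_adjoint H (\<sigma> C) (\<sigma> (astar B C))"
  using \<sigma>_rep unfolding star_representation_def by blast+

lemma adjoint_unique:
  assumes "mutually_adjoint H S T" "mutually_adjoint H S T'" "S \<in> bounded_ops H" "T \<in> bounded_ops H" "T' \<in> bounded_ops H"
  shows "T = T'"
proof (rule R.op_eqI[OF assms(4,5)])
  fix \<xi> assume \<xi>: "\<xi> \<in> hcarrier H"
  show "T \<xi> = T' \<xi>"
  proof (rule R.ext)
    fix \<eta> assume \<eta>: "\<eta> \<in> hcarrier H"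
    show "hinner H (T \<xi>) \<eta> = hinner H (T' \<xi>) \<eta>"
      using R.adjointD[OF R.adjoint_sym[OF assms(1,3,4)] \<xi> \<eta>] R.adjointD[OF R.adjoint_sym[OF assms(2,3,5)] \<xi> \<eta>] by simp
  qed (use \<xi> assms R.bounded_opsD(1) in auto)
qed

text \<open>The empty word is covered because \<open>1\<close> and the coefficient \<open>1\<close> coincide in the crossed product and
  \<open>\<pi>(1)\<close> is the identity.\<close>

lemma \<sigma>_emb: "\<sigma> (emb x) = ev x"
proof (induction x rule: free_induct)
  case (add x y)
  show ?case
  proof (rule R.op_eqI)
    fix \<xi> assume "\<xi> \<in> hcarrier H"
    then show "\<sigma> (emb (x + y)) \<xi> = ev (x + y) \<xi>"
      using \<sigma>_plus[OF emb_ops(1) emb_ops(1)] add by (simp add: emb_ops(2) ev_add)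
  qed (simp_all add: \<sigma>_in emb_ops)
next
  case (fterm w a)
  have gens: "\<sigma> (emb (gen g)) = ev (gen g)" for g
  proof (cases g)
    case (Coeff b)
    then show ?thesis using \<sigma> by (simp add: regular_representation_def cp_emb(1) ev_coeff)
  next
    case PIso
    then show ?thesis using \<sigma> by (simp add: regular_representation_def cp_emb(2) ev_V)
  qed
  have "\<sigma> (emb (fterm (Word ls) 1)) = ev (fterm (Word ls) 1)" for ls
  proof (induction ls)
    case Nil
    have "fterm (Word []) 1 = (1 :: 'a cp_gen free_star)" by (simp flip: zero_word_def)
    then show ?case
      using \<sigma> by (simp add: emb_one ev_one regular_representation_def pi_one)
  next
    case (Cons l ls)
    have "\<sigma> (emb (fterm (Word [l]) 1)) = ev (fterm (Word [l]) 1)"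
    proof (cases l)
      case (Gen g)
      then show ?thesis using gens[of g] by (simp add: gen_def)
    next
      case (Adj g)
      have "\<sigma> (emb (free_adj (gen g))) = ev (free_adj (gen g))"
        using adjoint_unique[OF \<sigma>_adj[OF emb_ops(1), of "gen g"], of "ev (free_adj (gen g))"]
          ev_adjoint[of "gen g"]
        by (simp add: gens emb_ops \<sigma>_in)
      then show ?thesis by (simp add: Adj fterm_Adj)
    qed
    then show ?case
      by (subst (1 2) fterm_Cons) (simp add: emb_ops(3)[symmetric] \<sigma>_times[OF emb_ops(1) emb_ops(1)] Cons.IH ev_mult)
  qed
  then have w: "\<sigma> (emb (fterm w 1)) = ev (fterm w 1)" by (metis word.collapse)
  have "fterm w a = free_scale a (fterm w 1)" by (simp add: free_scale_fterm)
  moreover have "\<sigma> (emb (free_scale a (fterm w 1))) = ev (free_scale a (fterm w 1))"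
  proof (rule R.op_eqI)
    fix \<xi> assume "\<xi> \<in> hcarrier H"
    then show "\<sigma> (emb (free_scale a (fterm w 1))) \<xi> = ev (free_scale a (fterm w 1)) \<xi>"
      using \<sigma>_scale[OF emb_ops(1)] w by (simp add: emb_ops(4)[symmetric] ev_scale)
  qed (simp_all add: \<sigma>_in emb_ops)
  ultimately show ?case by simp
qed

text \<open>Automatic continuity. If the operator \<open>A = \<sigma>(Z)\<close> had norm \<open>> r\<close>, then with \<open>\<lambda> = \<parallel>A\<parallel>\<^sup>2\<close> the
  element \<open>1 - \<lambda>\<^sup>-\<^sup>1 Z\<^sup>*Z\<close> would have a left inverse, which bounds \<open>1 - \<lambda>\<^sup>-\<^sup>1 A\<^sup>*A\<close> from below and
  contradicts the choice of \<open>\<lambda>\<close>.\<close>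

lemma \<sigma>_contractive:
  assumes Z: "cauchy_wrt reg_norm Z" and b: "\<And>n. reg_norm (Z n) \<le> r"
  shows "R.opnorm (\<sigma> (cls Z)) \<le> r"
proof (rule ccontr)
  define A where "A = \<sigma> (cls Z)"
  define A' where "A' = \<sigma> (astar B (cls Z))"
  assume "\<not> R.opnorm (\<sigma> (cls Z)) \<le> r"
  then have Ar: "R.opnorm A > r" by (simp add: A_def)
  have r0: "r \<ge> 0" using b[of 0] reg_norm_nonneg[of "Z 0"] by linarith
  have Z': "cauchy_wrt reg_norm (\<lambda>n. free_adj (Z n))" by (rule Q.cauchy_adj[OF Z])
  have A: "A \<in> bounded_ops H" "A' \<in> bounded_ops H"
    unfolding A_def A'_def by (auto intro!: \<sigma>_in B_class(1) Z Z' simp: B_class(3)[OF Z])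
  have adj: "mutually_adjoint H A A'" unfolding A_def A'_def by (rule \<sigma>_adj[OF B_class(1)[OF Z]])
  define l where "l = (R.opnorm A)\<^sup>2"
  have l: "l > r\<^sup>2" "l > 0" using Ar r0 by (auto simp: l_def power_strict_mono)
  define S where "S n = free_adj (Z n) * Z n" for n
  have S: "cauchy_wrt reg_norm S" unfolding S_def by (rule Q.cauchy_mult[OF Z' Z])
  have clsS: "cls S = atimes B (astar B (cls Z)) (cls Z)"
    using B_class(5)[OF Z' Z] by (simp add: B_class(3)[OF Z] S_def[abs_def])
  have \<sigma>S: "\<sigma> (cls S) = op_comp H A' A"
    unfolding clsS A_def A'_def by (rule \<sigma>_times) (auto intro!: B_class(1) Z Z' simp: B_class(3)[OF Z])
  define Y where "Y n = free_scale (of_real (1 / l)) (S n)" for n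
  have Y: "cauchy_wrt reg_norm Y" unfolding Y_def by (rule Q.cauchy_scale[OF S])
  have "reg_norm (Y n) \<le> r\<^sup>2 / l" for n
    using power_mono[OF b[of n] reg_norm_nonneg, of 2] l
    by (simp add: Y_def S_def Q.p_scale Q.p_cstar norm_divide divide_right_mono)
  moreover have "r\<^sup>2 / l < 1" using l by simp
  ultimately obtain G where G: "cauchy_wrt reg_norm G" "Q.equi (\<lambda>n. G n * (1 - Y n)) (\<lambda>_. 1)"
    using Q.neumann[OF Y] by blast
  define Y1 where "Y1 n = 1 - Y n" for n
  have Y1: "cauchy_wrt reg_norm Y1" unfolding Y1_def by (rule Q.cauchy_diff[OF Q.cauchy_const Y])
  have "cls (\<lambda>n. G n * Y1 n) = emb 1"
    unfolding emb_cls using G(2) by (intro Q.seq_class_eq_iff[THEN iffD2] Q.cauchy_mult G Y1 Q.cauchy_const) (simp add: Y1_def[abs_def])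
  then have GY: "atimes B (cls G) (cls Y1) = emb 1" using B_class(5)[OF G(1) Y1] by simp
  have "cls Y1 = aplus B (emb 1) (ascale B (- of_real (1 / l)) (cls S))"
  proof -
    have "Y1 = (\<lambda>n. 1 + free_scale (- of_real (1 / l)) (S n))"
      by (rule HOL.ext) (simp add: Y1_def Y_def free_scale_def single_uminus)
    then show ?thesis by (simp add: B_class(2)[OF S] emb_cls B_class(4) Q.cauchy_scale[OF S])
  qed
  then have \<sigma>Y1: "\<sigma> (cls Y1) \<xi> = hplus H \<xi> (hscale H (- of_real (1 / l)) (A' (A \<xi>)))" if "\<xi> \<in> hcarrier H" for \<xi>
    using that \<sigma>_plus[OF emb_ops(1), of "ascale B (- of_real (1 / l)) (cls S)"] \<sigma>_scale[OF B_class(1)[OF S]]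
      B_class(1,2)[OF S] B_class(1)[OF Q.cauchy_scale[OF S]]
    by (simp add: \<sigma>_emb ev_one \<sigma>S)
  define K where "K = max 1 (R.opnorm (\<sigma> (cls G)))"
  have below: "hnorm H \<xi> \<le> K * hnorm H (hplus H \<xi> (hscale H (- of_real (1 / l)) (A' (A \<xi>))))"
    if \<xi>: "\<xi> \<in> hcarrier H" for \<xi>
  proof -
    have in1: "\<sigma> (cls Y1) \<xi> \<in> hcarrier H" using R.bounded_opsD(1)[OF \<sigma>_in[OF B_class(1)[OF Y1]] \<xi>] .
    have "R.op_id = op_comp H (\<sigma> (cls G)) (\<sigma> (cls Y1))"
      using \<sigma>_times[OF B_class(1)[OF G(1)] B_class(1)[OF Y1]] by (simp add: GY \<sigma>_emb ev_one)
    then have "R.op_id \<xi> = op_comp H (\<sigma> (cls G)) (\<sigma> (cls Y1)) \<xi>" by (rule fun_cong)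
    then have "hnorm H \<xi> = hnorm H (\<sigma> (cls G) (\<sigma> (cls Y1) \<xi>))" using \<xi> by simp
    also have "\<dots> \<le> R.opnorm (\<sigma> (cls G)) * hnorm H (\<sigma> (cls Y1) \<xi>)"
      by (rule R.opnorm_bound[OF \<sigma>_in[OF B_class(1)[OF G(1)]] in1])
    also have "\<dots> \<le> K * hnorm H (\<sigma> (cls Y1) \<xi>)"
      using in1 by (intro mult_right_mono) (auto simp: K_def)
    finally show ?thesis using \<sigma>Y1[OF \<xi>] by simp
  qed
  have K: "K \<ge> 1" by (simp add: K_def)
  define q where "q = l * (1 - 1 / K\<^sup>2)"
  have K2: "K\<^sup>2 \<ge> 1" using K by simp
  then have K2': "K\<^sup>2 > 0" by linarith
  have Ki: "1 / K\<^sup>2 \<le> 1" "1 / K\<^sup>2 > 0" using K2 K2' by (simp_all add: pos_divide_le_eq)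
  have q: "0 \<le> q" "q < l" using Ki l by (auto simp: q_def)
  have Aq: "(hnorm H (A \<xi>))\<^sup>2 \<le> q * (hnorm H \<xi>)\<^sup>2" if \<xi>: "\<xi> \<in> hcarrier H" for \<xi>
  proof -
    have A\<xi>: "A \<xi> \<in> hcarrier H" "A' (A \<xi>) \<in> hcarrier H" using \<xi> A R.bounded_opsD(1) by auto
    have "hnorm H (A' (A \<xi>)) \<le> R.opnorm A * hnorm H (A \<xi>)"
      using R.opnorm_bound[OF A(2) A\<xi>(1)] R.opnorm_adjoint[OF adj A] by simp
    then have TT: "(hnorm H (A' (A \<xi>)))\<^sup>2 \<le> l * (hnorm H (A \<xi>))\<^sup>2"
      using power_mono[of "hnorm H (A' (A \<xi>))" "R.opnorm A * hnorm H (A \<xi>)" 2] A\<xi>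
      by (simp add: l_def power_mult_distrib)
    have in1: "hinner H \<xi> (A' (A \<xi>)) = of_real ((hnorm H (A \<xi>))\<^sup>2)"
      using R.adjointD[OF adj \<xi> A\<xi>(1)] R.inner_self[OF A\<xi>(1)] by simp
    have in2: "hinner H (A' (A \<xi>)) \<xi> = of_real ((hnorm H (A \<xi>))\<^sup>2)"
      using R.inner_cnj[OF \<xi> A\<xi>(2)] in1 by simp
    let ?z = "hplus H \<xi> (hscale H (- of_real (1 / l)) (A' (A \<xi>)))"
    have "hinner H ?z ?z = of_real ((hnorm H \<xi>)\<^sup>2 - 2 / l * (hnorm H (A \<xi>))\<^sup>2 + (1 / l)\<^sup>2 * (hnorm H (A' (A \<xi>)))\<^sup>2)"
      using \<xi> A\<xi>
      by (simp add: in1 in2 R.inner_self[OF \<xi>] R.inner_self[OF A\<xi>(2)] power2_eq_square algebra_simps)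
    then have "(hnorm H ?z)\<^sup>2
        = (hnorm H \<xi>)\<^sup>2 - 2 / l * (hnorm H (A \<xi>))\<^sup>2 + (1 / l)\<^sup>2 * (hnorm H (A' (A \<xi>)))\<^sup>2"
      using R.hnorm_sq[of ?z] \<xi> A\<xi> by (simp del: of_real_add of_real_diff of_real_mult of_real_power)
    also have "(1 / l)\<^sup>2 * (hnorm H (A' (A \<xi>)))\<^sup>2 \<le> (1 / l)\<^sup>2 * (l * (hnorm H (A \<xi>))\<^sup>2)"
      using TT by (rule mult_left_mono) simp
    also have "(1 / l)\<^sup>2 * (l * (hnorm H (A \<xi>))\<^sup>2) = 1 / l * (hnorm H (A \<xi>))\<^sup>2"
      using l by (simp add: power2_eq_square)
    finally have le: "(hnorm H (hplus H \<xi> (hscale H (- of_real (1 / l)) (A' (A \<xi>)))))\<^sup>2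
        \<le> (hnorm H \<xi>)\<^sup>2 - 1 / l * (hnorm H (A \<xi>))\<^sup>2" by (simp add: algebra_simps)
    have "(hnorm H \<xi>)\<^sup>2 \<le> (K * hnorm H (hplus H \<xi> (hscale H (- of_real (1 / l)) (A' (A \<xi>)))))\<^sup>2"
      using below[OF \<xi>] \<xi> by (intro power_mono) auto
    also have "\<dots> \<le> K\<^sup>2 * ((hnorm H \<xi>)\<^sup>2 - 1 / l * (hnorm H (A \<xi>))\<^sup>2)"
      using le by (simp add: power_mult_distrib mult_left_mono)
    finally have "(hnorm H \<xi>)\<^sup>2 / K\<^sup>2 \<le> (hnorm H \<xi>)\<^sup>2 - 1 / l * (hnorm H (A \<xi>))\<^sup>2"
      using K2' by (simp only: pos_divide_le_eq) (simp add: mult.commute)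
    then have "(hnorm H (A \<xi>))\<^sup>2 / l \<le> (hnorm H \<xi>)\<^sup>2 - (hnorm H \<xi>)\<^sup>2 / K\<^sup>2" by simp
    then have "(hnorm H (A \<xi>))\<^sup>2 \<le> l * ((hnorm H \<xi>)\<^sup>2 - (hnorm H \<xi>)\<^sup>2 / K\<^sup>2)"
      using l by (simp add: pos_divide_le_eq mult.commute)
    then show ?thesis by (simp add: q_def algebra_simps)
  qed
  have "R.opnorm A \<le> sqrt q"
  proof (rule R.opnorm_le)
    fix \<xi> assume \<xi>: "\<xi> \<in> hcarrier H"
    show "hnorm H (A \<xi>) \<le> sqrt q * hnorm H \<xi>"
      by (rule power2_le_imp_le) (use Aq[OF \<xi>] q \<xi> in \<open>auto simp: power_mult_distrib\<close>)
  qed (use q in simp)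
  then have "l \<le> (sqrt q)\<^sup>2" unfolding l_def using R.opnorm_nonneg[OF A(1)] by (rule power_mono)
  then show False using q by simp
qed

lemma regular_representation_unique: "\<sigma> = \<rho>"
proof (rule extensionalityI[of _ "acarrier B"])
  show "\<sigma> \<in> extensional (acarrier B)" "\<rho> \<in> extensional (acarrier B)"
    using \<sigma> \<rho>_regular by (auto simp: regular_representation_def)
  fix C assume "C \<in> acarrier B"
  then obtain X where X: "cauchy_wrt reg_norm X" "C = cls X" by (rule B_cases)
  show "\<sigma> C = \<rho> C"
  proof (rule R.op_eqI)
    show "\<sigma> C \<in> bounded_ops H" "\<rho> C \<in> bounded_ops H"
      unfolding X(2) by (auto intro: \<sigma>_in B_class(1) \<rho>_in X)
    fix \<xi> assume \<xi>: "\<xi> \<in> hcarrier H"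
    have \<sigma>\<xi>: "\<sigma> C \<xi> \<in> hcarrier H"
      unfolding X(2) by (rule R.bounded_opsD(1)[OF \<sigma>_in[OF B_class(1)[OF X(1)]] \<xi>])
    have "(\<lambda>n. hnorm H (hsub H (ev (X n) \<xi>) (\<sigma> C \<xi>))) \<longlonglongrightarrow> 0"
    proof (rule LIMSEQ_I)
      fix e :: real assume e: "e > 0"
      let ?k = "hnorm H \<xi> + 1"
      have k: "?k > 0" using R.hnorm_nonneg[OF \<xi>] by linarith
      obtain N where N: "\<And>m n. m \<ge> N \<Longrightarrow> n \<ge> N \<Longrightarrow> reg_norm (X m - X n) < e / ?k"
        using Q.cauchyD[OF X(1), of "e / ?k"] e k by (metis divide_pos_pos)
      have "hnorm H (hsub H (ev (X n) \<xi>) (\<sigma> C \<xi>)) < e" if n: "n \<ge> N" for n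
      proof -
        define Z where "Z m = X n - X (m + N)" for m
        define X' where "X' m = X (m + N)" for m
        have X': "cauchy_wrt reg_norm X'"
        proof (rule Q.cauchyI)
          fix e :: real assume "e > 0"
          then obtain M where "\<And>m n. m \<ge> M \<Longrightarrow> n \<ge> M \<Longrightarrow> reg_norm (X m - X n) < e" using Q.cauchyD[OF X(1)] by blast
          then show "\<exists>M. \<forall>m\<ge>M. \<forall>n\<ge>M. reg_norm (X' m - X' n) < e" by (intro exI[of _ M]) (auto simp: X'_def)
        qed
        have "Q.equi X X'"
          unfolding Q.equi_def
        proof (rule LIMSEQ_I)
          fix e :: real assume "e > 0"
          then obtain M where "\<And>m n. m \<ge> M \<Longrightarrow> n \<ge> M \<Longrightarrow> reg_norm (X m - X n) < e" using Q.cauchyD[OF X(1)] by blast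
          then show "\<exists>M. \<forall>n\<ge>M. norm (reg_norm (X n - X' n) - 0) < e"
            by (intro exI[of _ M]) (auto simp: X'_def reg_norm_nonneg)
        qed
        then have CX': "C = cls X'" using X X' by (simp add: Q.seq_class_eq_iff)
        have Z: "cauchy_wrt reg_norm Z" unfolding Z_def using Q.cauchy_diff[OF Q.cauchy_const X'] by (simp add: X'_def)
        have "cls Z = aplus B (emb (X n)) (ascale B (- 1) C)"
        proof -
          have "Z = (\<lambda>m. X n + free_scale (- 1) (X' m))"
            by (rule HOL.ext) (simp add: Z_def X'_def free_scale_minus_one)
          then show ?thesis unfolding CX' by (simp add: B_class(2)[OF X'] emb_cls B_class(4) Q.cauchy_scale[OF X'])
        qed
        then have \<sigma>Z: "\<sigma> (cls Z) \<xi> = hsub H (ev (X n) \<xi>) (\<sigma> C \<xi>)"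
          using \<xi> \<sigma>_plus[OF emb_ops(1), of "ascale B (- 1) C"] \<sigma>_scale[of C \<xi> "- 1"] B_class(1)[OF X'] B_class(2)[OF X', of "- 1"]
            B_class(1)[OF Q.cauchy_scale[OF X', of "- 1"]]
          by (simp add: \<sigma>_emb CX')
        have "R.opnorm (\<sigma> (cls Z)) \<le> e / ?k"
          by (rule \<sigma>_contractive[OF Z]) (use N n in \<open>auto simp: Z_def intro!: less_imp_le\<close>)
        then have "hnorm H (\<sigma> (cls Z) \<xi>) \<le> e / ?k * hnorm H \<xi>"
          using R.opnorm_bound[OF \<sigma>_in[OF B_class(1)[OF Z]] \<xi>] mult_right_mono[OF _ R.hnorm_nonneg[OF \<xi>]] order_trans by blast
        also have "\<dots> < e" using e k by (simp add: field_simps)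
        finally show ?thesis by (simp add: \<sigma>Z)
      qed
      moreover have "0 \<le> hnorm H (hsub H (ev (X n) \<xi>) (\<sigma> C \<xi>))" for n using \<xi> \<sigma>\<xi> by (intro R.hnorm_nonneg) auto
      ultimately show "\<exists>N. \<forall>n\<ge>N. norm (hnorm H (hsub H (ev (X n) \<xi>) (\<sigma> C \<xi>)) - 0) < e" by auto
    qed
    then have "R.conv (\<lambda>n. ev (X n) \<xi>) (\<sigma> C \<xi>)" using \<xi> \<sigma>\<xi> by (simp add: R.conv_def)
    then show "\<sigma> C \<xi> = \<rho> C \<xi>" unfolding X(2) using \<rho>_eqI[OF X(1) \<xi>] by simp
  qed
qed

end

end


section \<open>Faithfulness of the regular representation\<close>

theorem mainTheorem2:
  fixes \<delta> \<delta>s :: "'a::unital_cstar_algebra \<Rightarrow> 'a"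
  assumes "star_endomorphism \<delta>"
    and "complete_transfer_operator \<delta> \<delta>s"
  shows
    "let H = reg_space \<delta> \<delta>s; U = reg_U \<delta> \<delta>s; Us = reg_Ustar \<delta> \<delta>s; \<pi> = reg_pi \<delta> \<delta>s in
       (\<exists>!T. continuous_extension \<delta> \<delta>s (U_formula \<delta>) T) \<and>
       (\<exists>!T. continuous_extension \<delta> \<delta>s (Ustar_formula \<delta> \<delta>s) T) \<and>
       (\<forall>a. \<exists>!T. continuous_extension \<delta> \<delta>s (pi_formula \<delta> a) T) \<and>
       mutually_adjoint H U Us \<and>
       star_representation type_algebra H \<pi> \<and>
       faithful type_algebra \<pi> \<and>
       nondegenerate type_algebra H \<pi> \<and>
       (\<forall>a. \<pi> (\<delta> a) = op_comp H U (op_comp H (\<pi> a) Us) \<and>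
            op_comp H Us (op_comp H (\<pi> a) U) \<in> range \<pi> \<and>
            op_comp H U (\<pi> a) = op_comp H (\<pi> (\<delta> a)) U) \<and>
       (\<exists>!\<rho>. regular_representation \<delta> \<delta>s \<rho>) \<and>
       (\<forall>\<rho>. regular_representation \<delta> \<delta>s \<rho> \<longrightarrow> faithful (crossed_product \<delta> \<delta>s) \<rho>)"
proof -
  interpret transfer_system \<delta> \<delta>s
    using assms by (rule transfer_system.intro)
  have "\<exists>!\<rho>. regular_representation \<delta> \<delta>s \<rho>"
    using \<rho>_regular regular_representation_unique by blast
  moreover have "faithful (crossed_product \<delta> \<delta>s) \<sigma>" if "regular_representation \<delta> \<delta>s \<sigma>" for \<sigma>
    using \<rho>_faithful regular_representation_unique[OF that] by simp
  moreover have "\<exists>!T. continuous_extension \<delta> \<delta>s (U_formula \<delta>) T"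
    "\<exists>!T. continuous_extension \<delta> \<delta>s (Ustar_formula \<delta> \<delta>s) T"
    "\<forall>a. \<exists>!T. continuous_extension \<delta> \<delta>s (pi_formula \<delta> a) T"
    unfolding U_ext Us_ext pi_ext by blast+
  ultimately show ?thesis
    unfolding Let_def
    by (simp add: U_adjoint star_representation_pi faithful_pi nondegenerate_pi
        U_pi_Us Us_pi_U U_pi)
qed

end
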